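(* Let $\Omega\subset\mathbb R^2$ be an admissible domain with $\partial\Omega=\mathcal F\cup\mathcal B$ and free part $\mathcal F=(0,\ell)\times\{0\}$ (up to endpoints), $\ell>0$. Assume that $\Omega$ satisfies the John condition, $\Omega\subset\mathcal F\times(-\infty,0)$. Then for every $\gamma\ge1$ and every $z>0$ the Riesz means of the sloshing eigenvalues of $\Omega$ satisfy $$R^\Omega_\gamma(z)\ \ge\ \frac{\ell}{\pi(\gamma+1)}z^{\gamma+1}+\frac12z^\gamma.$$
   Context: Admissible domain in $\mathbb R^2$: a bounded domain $\Omega\subset\mathbb R^2$ with Lipschitz, piecewise smooth boundary $\partial\Omega=\mathcal F\cup\mathcal B$, $\mathcal F\subset\{x_2=0\}$, $\mathcal B\subset\{x_2<0\}$. $\mathcal F$ is identified with a subset of $\mathbb R$. Sloshing (Steklov--Neumann) eigenvalues of $\Omega$: the numbers $0=\nu_1\le\nu_2\le\cdots\nearrow\infty$ (counted with multiplicity) for which $\Delta f=0$ in $\Omega$, $\partial f/\partial\mathbf n=0$ on $\mathcal B$, $\partial f/\partial x_2=\nu f$ on $\mathcal F$ has a nontrivial (weak) solution; equivalently, the eigenvalues given by min-max for $\int_\Omega|\nabla f|^2dx/\int_{\mathcal F}|f|^2ds$, $f\in H^1(\Omega)$. Riesz mean: $R_\gamma^\Omega(z)=\sum_j(z-\nu_j)_+^\gamma$, with $(t)_+=\max\{0,t\}$. *)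

theory Defs
  imports "HOL-Analysis.Analysis"
begin

section \<open>Admissible domains in the plane\<close>

text \<open>The plane is the type \<^typ>\<open>real \<times> real\<close>. Near every boundary point, in suitable
  orthonormal coordinates \<open>(s, t)\<close> centred at that point, \<open>\<Omega>\<close> is the part below the graph of a
  Lipschitz function.\<close>

definition lipschitz_boundary :: "(real \<times> real) set \<Rightarrow> bool" where
  "lipschitz_boundary \<Omega> \<longleftrightarrow>
     (\<forall>p \<in> frontier \<Omega>. \<exists>e n r h L \<phi>.
        norm e = 1 \<and> norm n = 1 \<and> e \<bullet> n = 0 \<and> 0 < r \<and> 0 < h \<and>
        L-lipschitz_on {-r<..<r} \<phi> \<and>
        (\<forall>s t. \<bar>s\<bar> < r \<longrightarrow> \<bar>t\<bar> < h \<longrightarrow>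
           (p + s *\<^sub>R e + t *\<^sub>R n \<in> \<Omega> \<longleftrightarrow> t < \<phi> s)))"

text \<open>A simple regular arc that is infinitely differentiable up to its end points;
  \<open>D k\<close> is its \<open>k\<close>-th derivative.\<close>

definition smooth_arc :: "(real \<Rightarrow> real \<times> real) \<Rightarrow> bool" where
  "smooth_arc \<gamma> \<longleftrightarrow> inj_on \<gamma> {0..1} \<and>
     (\<exists>D. D 0 = \<gamma> \<and>
        (\<forall>k. \<forall>t\<in>{0..1}. (D k has_vector_derivative D (Suc k) t) (at t within {0..1})) \<and>
        (\<forall>t\<in>{0..1}. D (Suc 0) t \<noteq> 0))"

definition piecewise_smooth_boundary :: "(real \<times> real) set \<Rightarrow> bool" where
  "piecewise_smooth_boundary \<Omega> \<longleftrightarrow>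
     (\<exists>(m::nat) \<gamma>. (\<forall>i<m. smooth_arc (\<gamma> i)) \<and>
        frontier \<Omega> = (\<Union>i<m. \<gamma> i ` {0..1}) \<and>
        (\<forall>i<m. \<forall>j<m. i \<noteq> j \<longrightarrow> \<gamma> i ` {0<..<1} \<inter> \<gamma> j ` {0..1} = {}))"

text \<open>The free part of the boundary is \<open>F \<times> {0}\<close>; it is represented by the subset \<open>F\<close> of the
  real line.\<close>

definition admissible_domain ::
    "(real \<times> real) set \<Rightarrow> real set \<Rightarrow> (real \<times> real) set \<Rightarrow> bool" where
  "admissible_domain \<Omega> F B \<longleftrightarrow>
     open \<Omega> \<and> connected \<Omega> \<and> \<Omega> \<noteq> {} \<and> bounded \<Omega> \<and>
     lipschitz_boundary \<Omega> \<and> piecewise_smooth_boundary \<Omega> \<and>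
     frontier \<Omega> = F \<times> {0} \<union> B \<and> B \<subseteq> {x. snd x < 0}"

definition john_condition :: "(real \<times> real) set \<Rightarrow> real set \<Rightarrow> bool" where
  "john_condition \<Omega> F \<longleftrightarrow> \<Omega> \<subseteq> F \<times> {..<0}"


section \<open>Sobolev functions and their traces\<close>

text \<open>Infinite differentiability on the whole plane: \<open>P i j\<close> is the mixed partial derivative
  of order \<open>i\<close> in the first and \<open>j\<close> in the second variable.\<close>

definition smooth_fun :: "(real \<times> real \<Rightarrow> real) \<Rightarrow> bool" where
  "smooth_fun f \<longleftrightarrow>
     (\<exists>P :: nat \<Rightarrow> nat \<Rightarrow> real \<times> real \<Rightarrow> real. P 0 0 = f \<and>
        (\<forall>i j x. (P i j has_derivative
            (\<lambda>v. P (Suc i) j x * fst v + P i (Suc j) x * snd v)) (at x)))"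

definition grad :: "(real \<times> real \<Rightarrow> real) \<Rightarrow> real \<times> real \<Rightarrow> real \<times> real" where
  "grad f x = (frechet_derivative f (at x) (1, 0), frechet_derivative f (at x) (0, 1))"

definition L2_on :: "'a::euclidean_space set \<Rightarrow> ('a \<Rightarrow> 'b::euclidean_space) \<Rightarrow> bool" where
  "L2_on S f \<longleftrightarrow> set_borel_measurable lborel S f \<and> set_integrable lborel S (\<lambda>x. (norm (f x))\<^sup>2)"

definition is_weak_gradient ::
    "(real \<times> real) set \<Rightarrow> (real \<times> real \<Rightarrow> real) \<Rightarrow> (real \<times> real \<Rightarrow> real \<times> real) \<Rightarrow> bool" where
  "is_weak_gradient \<Omega> u G \<longleftrightarrow>
     (\<forall>\<psi>. smooth_fun \<psi> \<and> compact (closure {x. \<psi> x \<noteq> 0}) \<and> closure {x. \<psi> x \<noteq> 0} \<subseteq> \<Omega> \<longrightarrow>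
        (LINT x:\<Omega>|lborel. u x *\<^sub>R grad \<psi> x) = - (LINT x:\<Omega>|lborel. \<psi> x *\<^sub>R G x))"

text \<open>\<open>u\<close> belongs to \<open>H\<^sup>1(\<Omega>)\<close> and has weak gradient \<open>G\<close>. Functions are representatives: \<open>u\<close> and
  \<open>G\<close> matter only up to null subsets of \<open>\<Omega>\<close>.\<close>

definition H1_with_gradient ::
    "(real \<times> real) set \<Rightarrow> (real \<times> real \<Rightarrow> real) \<Rightarrow> (real \<times> real \<Rightarrow> real \<times> real) \<Rightarrow> bool" where
  "H1_with_gradient \<Omega> u G \<longleftrightarrow> L2_on \<Omega> u \<and> L2_on \<Omega> G \<and> is_weak_gradient \<Omega> u G"

text \<open>\<open>g\<close> is the trace on \<open>F \<times> {0}\<close> of the \<open>H\<^sup>1\<close> function \<open>u\<close> with weak gradient \<open>G\<close>. The trace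
  operator is the continuous extension to \<open>H\<^sup>1(\<Omega>)\<close> of the restriction of smooth functions, which
  are dense in \<open>H\<^sup>1(\<Omega>)\<close> because the boundary is Lipschitz; so every \<open>H\<^sup>1\<close> function has a trace,
  unique up to null sets.\<close>

definition is_trace ::
    "(real \<times> real) set \<Rightarrow> real set \<Rightarrow> (real \<times> real \<Rightarrow> real) \<Rightarrow> (real \<times> real \<Rightarrow> real \<times> real) \<Rightarrow>
     (real \<Rightarrow> real) \<Rightarrow> bool" where
  "is_trace \<Omega> F u G g \<longleftrightarrow> L2_on F g \<and>
     (\<exists>\<phi> :: nat \<Rightarrow> real \<times> real \<Rightarrow> real. (\<forall>n. smooth_fun (\<phi> n)) \<and>
        (\<lambda>n. LINT x:\<Omega>|lborel. (\<phi> n x - u x)\<^sup>2) \<longlonglongrightarrow> 0 \<and>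
        (\<lambda>n. LINT x:\<Omega>|lborel. (norm (grad (\<phi> n) x - G x))\<^sup>2) \<longlonglongrightarrow> 0 \<and>
        (\<lambda>n. LINT s:F|lborel. (\<phi> n (s, 0) - g s)\<^sup>2) \<longlonglongrightarrow> 0)"


section \<open>Sloshing eigenvalues and their Riesz means\<close>

text \<open>Weak form of \<open>\<Delta>u = 0\<close> in \<open>\<Omega>\<close>, \<open>\<partial>u/\<partial>\<^bold>n = 0\<close> on \<open>B\<close>, \<open>\<partial>u/\<partial>x\<^sub>2 = \<nu> u\<close> on \<open>F \<times> {0}\<close>: for all
  \<open>v\<close> in \<open>H\<^sup>1(\<Omega>)\<close>, with gradient \<open>H\<close> and trace \<open>h\<close>, the Dirichlet form of \<open>u\<close> and \<open>v\<close> equals \<open>\<nu>\<close>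
  times the \<open>L\<^sup>2\<close> product of their traces on \<open>F\<close>.\<close>

definition sloshing_solution ::
    "(real \<times> real) set \<Rightarrow> real set \<Rightarrow> real \<Rightarrow> (real \<times> real \<Rightarrow> real) \<Rightarrow> bool" where
  "sloshing_solution \<Omega> F \<nu> u \<longleftrightarrow>
     (\<exists>G g. H1_with_gradient \<Omega> u G \<and> is_trace \<Omega> F u G g \<and>
        (\<forall>v H h. H1_with_gradient \<Omega> v H \<and> is_trace \<Omega> F v H h \<longrightarrow>
           (LINT x:\<Omega>|lborel. G x \<bullet> H x) = \<nu> * (LINT s:F|lborel. g s * h s)))"

definition sloshing_eigenvalue :: "(real \<times> real) set \<Rightarrow> real set \<Rightarrow> real \<Rightarrow> bool" where
  "sloshing_eigenvalue \<Omega> F \<nu> \<longleftrightarrow>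
     (\<exists>u. sloshing_solution \<Omega> F \<nu> u \<and> \<not> (AE x in lborel. x \<in> \<Omega> \<longrightarrow> u x = 0))"

text \<open>Dimension of the solution space, where functions that agree almost everywhere in \<open>\<Omega>\<close> are
  identified.\<close>

definition sloshing_multiplicity :: "(real \<times> real) set \<Rightarrow> real set \<Rightarrow> real \<Rightarrow> enat" where
  "sloshing_multiplicity \<Omega> F \<nu> =
     Sup {enat k |k. \<exists>u :: nat \<Rightarrow> real \<times> real \<Rightarrow> real.
        (\<forall>i<k. sloshing_solution \<Omega> F \<nu> (u i)) \<and>
        (\<forall>c :: nat \<Rightarrow> real. (AE x in lborel. x \<in> \<Omega> \<longrightarrow> (\<Sum>i<k. c i * u i x) = 0) \<longrightarrow>
           (\<forall>i<k. c i = 0))}"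

text \<open>The sum over the eigenvalues, each repeated according to its multiplicity. It is taken in
  the extended nonnegative reals, so it is meaningful independently of the discreteness of the
  spectrum.\<close>

definition riesz_mean ::
    "(real \<times> real) set \<Rightarrow> real set \<Rightarrow> real \<Rightarrow> real \<Rightarrow> ennreal" where
  "riesz_mean \<Omega> F \<gamma> z =
     (\<Sum>\<^sub>\<infinity>\<nu>\<in>{\<nu>. sloshing_eigenvalue \<Omega> F \<nu>}.
        ennreal_of_enat (sloshing_multiplicity \<Omega> F \<nu>) * ennreal (max 0 (z - \<nu>) powr \<gamma>))"

end

(* The functions cos (mu x) exp (mu y) with mu = pi k / l are harmonic and satisfy the sloshing
   condition on the half-strip (0,l) x (-oo,0). Restricted to Omega, which lies in the half-strip,
   their Dirichlet energy can only decrease while their boundary norm on F is unchanged, so by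
   min-max the k-th sloshing eigenvalue is at most pi k / l. The Riesz mean is therefore at least
   the sum of the (z - pi k / l)_+^gamma, and this sum dominates the claimed expression because
   the trapezoidal rule overestimates the integral of a convex function.

   The eigenvalues exist because E-bounded sequences (E = Dirichlet form + boundary form) have
   subsequences that converge in L^2(F). For smooth functions this comes from comparing a function
   on F with its means over short intervals along short segments that enter Omega transversally;
   the Poincare inequality, which makes E complete, is proved by moving sets along segments inside
   Omega. Both extend to H^1 because traces are limits of smooth functions. *)

theory Submission
  imports Defs "HOL-Complex_Analysis.Great_Picard" "HOL-Library.Function_Algebras"
begin

section \<open>Variational eigenvalues of a pair of quadratic forms\<close>

text \<open>The Riesz mean is a sum over all eigenvalues in the extended nonnegative reals, so a
  lower bound only has to exhibit finitely many eigenvectors with upper bounds on their eigenvalues.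
  They are produced one at a time, by minimising the Rayleigh quotient on the boundary-orthogonal
  complement of the earlier ones. Two obstacles shape the rest. The trace is not the restriction of
  a representative but a limit, so it is carried along as a separate component, and the forms live
  on a space of triples where they are only semidefinite. Multiplicity counts independence almost
  everywhere in \<Omega>, while the eigenvectors are orthonormal on F; the bridge is a trace
  inequality with arbitrarily small weight on the gradient. The Lipschitz condition enters through
  one consequence: near each boundary point a single direction leads from the closure into \<Omega>.
  The term with factor 1/2 in the bound is the half weight that the trapezoidal rule gives to its
  end node, here the node of frequency 0.\<close>

locale psd_form =
  fixes V :: "'v::real_vector set" and a :: "'v \<Rightarrow> 'v \<Rightarrow> real"
  assumes subspace: "subspace V"
    and sym: "x \<in> V \<Longrightarrow> y \<in> V \<Longrightarrow> a x y = a y x"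
    and add_left: "x \<in> V \<Longrightarrow> y \<in> V \<Longrightarrow> w \<in> V \<Longrightarrow> a (x + y) w = a x w + a y w"
    and scale_left: "x \<in> V \<Longrightarrow> w \<in> V \<Longrightarrow> a (c *\<^sub>R x) w = c * a x w"
    and nonneg: "x \<in> V \<Longrightarrow> 0 \<le> a x x"
begin

lemmas mem_intros = subspace_add[OF subspace] subspace_diff[OF subspace]
  subspace_scale[OF subspace] subspace_sum[OF subspace] subspace_0[OF subspace]

lemma add_right: "x \<in> V \<Longrightarrow> y \<in> V \<Longrightarrow> w \<in> V \<Longrightarrow> a w (x + y) = a w x + a w y"
  using add_left[of x y w] sym mem_intros by metis

lemma scale_right: "x \<in> V \<Longrightarrow> w \<in> V \<Longrightarrow> a w (c *\<^sub>R x) = c * a w x"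
  using scale_left[of x w c] sym mem_intros by metis

lemma diff_left: "x \<in> V \<Longrightarrow> y \<in> V \<Longrightarrow> w \<in> V \<Longrightarrow> a (x - y) w = a x w - a y w"
  using add_left[of x "(-1) *\<^sub>R y" w] scale_left[of y w "-1"] mem_intros(3)[of y "-1"] by simp

lemma diff_right: "x \<in> V \<Longrightarrow> y \<in> V \<Longrightarrow> w \<in> V \<Longrightarrow> a w (x - y) = a w x - a w y"
  using diff_left[of x y w] sym mem_intros by metis

lemma zero_left: "w \<in> V \<Longrightarrow> a 0 w = 0"
  using scale_left[of w w 0] by simp

lemma sum_left: "finite I \<Longrightarrow> (\<And>i. i \<in> I \<Longrightarrow> f i \<in> V) \<Longrightarrow> w \<in> V \<Longrightarrow> a (\<Sum>i\<in>I. f i) w = (\<Sum>i\<in>I. a (f i) w)"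
  by (induction I rule: finite_induct) (auto simp: zero_left add_left mem_intros)

lemma sum_scale_left:
  assumes "finite I" "\<And>i. i \<in> I \<Longrightarrow> f i \<in> V" "w \<in> V"
  shows "a (\<Sum>i\<in>I. c i *\<^sub>R f i) w = (\<Sum>i\<in>I. c i * a (f i) w)"
  using assms by (simp add: sum_left scale_left mem_intros)

lemma quadratic_add:
  assumes "x \<in> V" "y \<in> V"
  shows "a (x + t *\<^sub>R y) (x + t *\<^sub>R y) = a x x + 2 * t * a x y + t\<^sup>2 * a y y"
  using assms by (simp add: add_left add_right scale_left scale_right mem_intros sym[of y x]
      algebra_simps power2_eq_square)

lemma parallelogram:
  assumes "x \<in> V" "y \<in> V"
  shows "a (x + y) (x + y) = 2 * a x x + 2 * a y y - a (x - y) (x - y)"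
  using quadratic_add[OF assms, of 1] quadratic_add[OF assms, of "-1"] by simp

lemma cauchy_schwarz:
  assumes "x \<in> V" "y \<in> V"
  shows "(a x y)\<^sup>2 \<le> a x x * a y y"
proof (cases "a y y = 0")
  case True
  have "a x y = 0"
  proof (rule ccontr)
    assume *: "a x y \<noteq> 0"
    \<comment> \<open>With \<open>a y y = 0\<close> the quadratic in \<open>t\<close> is affine, and
      this \<open>t\<close> gives it the value -1.\<close>
    define t where "t = - (a x x + 1) / (2 * a x y)"
    have "0 \<le> a x x + 2 * t * a x y + t\<^sup>2 * a y y"
      using quadratic_add[OF assms, of t] nonneg[of "x + t *\<^sub>R y"] assms mem_intros by simp
    then show False using * True by (simp add: t_def field_simps)
  qed
  then show ?thesis by (simp add: True)
next
  case False
  then have pos: "a y y > 0" using nonneg[OF assms(2)] by simp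
  \<comment> \<open>The minimiser of the quadratic in \<open>t\<close>.\<close>
  define t where "t = - a x y / a y y"
  have "0 \<le> a x x + 2 * t * a x y + t\<^sup>2 * a y y"
    using quadratic_add[OF assms, of t] nonneg[of "x + t *\<^sub>R y"] assms mem_intros by simp
  also have "\<dots> = a x x - (a x y)\<^sup>2 / a y y"
    using pos by (simp add: t_def field_simps power2_eq_square)
  finally show ?thesis using pos by (simp add: field_simps)
qed

lemma tendsto_left:
  assumes "\<And>n. v n \<in> V" "w \<in> V" "y \<in> V"
    and lim: "(\<lambda>n. a (v n - w) (v n - w)) \<longlonglongrightarrow> 0"
  shows "(\<lambda>n. a (v n) y) \<longlonglongrightarrow> a w y"
proof -
  have "(\<lambda>n. (a (v n - w) y)\<^sup>2) \<longlonglongrightarrow> 0"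
  proof (rule tendsto_sandwich[OF _ _ tendsto_const])
    show "\<forall>\<^sub>F n in sequentially. (a (v n - w) y)\<^sup>2 \<le> a (v n - w) (v n - w) * a y y"
      using assms by (intro always_eventually allI cauchy_schwarz mem_intros)
    show "(\<lambda>n. a (v n - w) (v n - w) * a y y) \<longlonglongrightarrow> 0"
      using tendsto_mult_right[OF lim, of "a y y"] by simp
  qed simp
  then have "(\<lambda>n. a (v n - w) y) \<longlonglongrightarrow> 0"
    by simp
  then have "(\<lambda>n. a (v n) y - a w y) \<longlonglongrightarrow> 0"
    using assms by (simp add: diff_left)
  then show ?thesis by (simp add: LIM_zero_iff)
qed

lemma tendsto_square:
  assumes "\<And>n. v n \<in> V" "w \<in> V"
    and lim: "(\<lambda>n. a (v n - w) (v n - w)) \<longlonglongrightarrow> 0"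
  shows "(\<lambda>n. a (v n) (v n)) \<longlonglongrightarrow> a w w"
proof -
  have "(\<lambda>n. a (v n - w) (v n - w) + 2 * a (v n) w - a w w) \<longlonglongrightarrow> 0 + 2 * a w w - a w w"
    by (intro tendsto_intros lim tendsto_left assms)
  then show ?thesis
    using assms by (simp add: diff_left diff_right mem_intros sym[of w "v _"] algebra_simps)
qed

text \<open>First-order condition at a minimum: for small \<open>t\<close> of the sign opposite to
  \<open>p\<close> the linear term wins.\<close>

lemma quadratic_minimum:
  assumes "\<And>t. 0 \<le> 2 * t * p + t\<^sup>2 * q"
  shows "p = (0::real)"
proof (rule ccontr)
  assume p: "p \<noteq> 0"
  \<comment> \<open>\<open>D\<close> is positive and exceeds \<open>q\<close> whatever the sign of
    \<open>q\<close>, so the value below is negative.\<close>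
  define D where "D = \<bar>q\<bar> + 1"
  define t where "t = - p / D"
  have D: "0 < D" "q < 2 * D" by (auto simp: D_def)
  have "2 * t * p + t\<^sup>2 * q = p\<^sup>2 * (q - 2 * D) / D\<^sup>2"
    unfolding t_def using D(1) by (simp add: field_simps power2_eq_square)
  moreover have "p\<^sup>2 * (q - 2 * D) / D\<^sup>2 < 0"
    using p D by (intro divide_neg_pos mult_pos_neg) auto
  ultimately show False using assms[of t] by linarith
qed

end

section \<open>Upper min-max bounds from linear algebra and the direct method\<close>

lemma homogeneous_system_nontrivial_solution:
  fixes A :: "nat \<Rightarrow> nat \<Rightarrow> real"
  shows "\<exists>c. (\<exists>j\<le>k. c j \<noteq> 0) \<and> (\<forall>i<k. (\<Sum>j\<le>k. c j * A i j) = 0)"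
proof (induction k arbitrary: A)
  case 0
  show ?case by (intro exI[of _ "\<lambda>_. 1"]) auto
next
  case (Suc k)
  show ?case
  proof (cases "\<forall>i<Suc k. A i (Suc k) = 0")
    case True
    show ?thesis
    proof (intro exI[of _ "\<lambda>j. if j = Suc k then 1 else 0"] conjI)
      show "\<forall>i<Suc k. (\<Sum>j\<le>Suc k. (if j = Suc k then 1 else 0) * A i j) = 0"
        using True by (simp add: if_distrib[of "\<lambda>x. x * _"] cong: if_cong)
    qed auto
  next
    case False
    then obtain p where p: "p < Suc k" "A p (Suc k) \<noteq> 0" by auto
    \<comment> \<open>\<open>s\<close> enumerates the rows other than the pivot row
      \<open>p\<close>; \<open>A'\<close> is the system after the last unknown has been eliminated
      with that row.\<close>
    define s where "s i = (if i < p then i else Suc i)" for i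
    define A' where "A' i j = A (s i) j - A (s i) (Suc k) / A p (Suc k) * A p j" for i j
    obtain c where c: "\<exists>j\<le>k. c j \<noteq> 0" "\<And>i. i < k \<Longrightarrow> (\<Sum>j\<le>k. c j * A' i j) = 0"
      using Suc.IH[of A'] by auto
    define S where "S i = (\<Sum>j\<le>k. c j * A i j)" for i
    \<comment> \<open>The eliminated unknown takes the value forced by the pivot equation.\<close>
    define c' where "c' = c(Suc k := - S p / A p (Suc k))"
    have sum': "(\<Sum>j\<le>Suc k. c' j * A i j) = S i - S p / A p (Suc k) * A i (Suc k)" for i
      by (simp add: c'_def S_def)
    have "(\<Sum>j\<le>Suc k. c' j * A i j) = 0" if "i < Suc k" for i
    proof (cases "i = p")
      case True
      then show ?thesis using p unfolding sum' by simp
    next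
      case False
      have "(if i < p then i else i - 1) < k" "s (if i < p then i else i - 1) = i"
        using \<open>i < Suc k\<close> p(1) False by (auto simp: s_def)
      then obtain i' where i': "i' < k" "s i' = i" by blast
      have "0 = (\<Sum>j\<le>k. c j * A i j - A i (Suc k) / A p (Suc k) * (c j * A p j))"
        using c(2)[OF i'(1)] by (simp add: A'_def i'(2) algebra_simps)
      also have "\<dots> = S i - A i (Suc k) / A p (Suc k) * S p"
        by (simp add: sum_subtractf sum_distrib_left S_def)
      finally show ?thesis unfolding sum' by simp
    qed
    moreover have "\<exists>j\<le>Suc k. c' j \<noteq> 0"
    proof -
      obtain j where "j \<le> k" "c j \<noteq> 0" using c(1) by blast
      then show ?thesis by (intro exI[of _ j]) (simp add: c'_def)
    qed
    ultimately show ?thesis by blast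
  qed
qed

text \<open>Completeness refers to the energy \<open>a + b\<close>. Compactness asks only for a
  \<open>b\<close>-Cauchy subsequence: a limit for \<open>b\<close> alone need not lie in
  \<open>V\<close>, and minimality will upgrade \<open>b\<close>-Cauchy to energy-Cauchy.\<close>

locale compact_form_pair = a: psd_form V a + b: psd_form V b
  for V :: "'v::real_vector set" and a b :: "'v \<Rightarrow> 'v \<Rightarrow> real" +
  assumes complete: "\<And>v :: nat \<Rightarrow> 'v. (\<And>n. v n \<in> V) \<Longrightarrow>
      (\<And>\<epsilon>. 0 < \<epsilon> \<Longrightarrow> \<exists>N. \<forall>m\<ge>N. \<forall>n\<ge>N.
          a (v m - v n) (v m - v n) + b (v m - v n) (v m - v n) < \<epsilon>) \<Longrightarrow>
      \<exists>w\<in>V. (\<lambda>n. a (v n - w) (v n - w) + b (v n - w) (v n - w)) \<longlonglongrightarrow> 0"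
    and compact: "\<And>(v :: nat \<Rightarrow> 'v) M. (\<And>n. v n \<in> V) \<Longrightarrow> (\<And>n. a (v n) (v n) + b (v n) (v n) \<le> M) \<Longrightarrow>
      \<exists>r :: nat \<Rightarrow> nat. strict_mono r \<and> (\<forall>\<epsilon>>0. \<exists>N. \<forall>m\<ge>N. \<forall>n\<ge>N.
          b (v (r m) - v (r n)) (v (r m) - v (r n)) < \<epsilon>)"
begin

text \<open>Direct method on a subspace \<open>W\<close> that will be the
  \<open>b\<close>-orthogonal complement of earlier eigenvectors; orthogonality passes to
  \<open>b\<close>-limits, hence the form of the closedness hypothesis. The trial vector
  \<open>x\<close> bounds the infimum by \<mu>. The eigenvalue equation comes out against
  \<open>W\<close> only.\<close>

lemma minimizer_exists:
  assumes W: "subspace W" "W \<subseteq> V"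
    and closed: "\<And>v w. (\<And>n. v n \<in> W) \<Longrightarrow> w \<in> V \<Longrightarrow> (\<lambda>n. b (v n - w) (v n - w)) \<longlonglongrightarrow> 0 \<Longrightarrow> w \<in> W"
    and x: "x \<in> W" "0 < b x x" "a x x \<le> \<mu> * b x x"
  shows "\<exists>e\<in>W. \<exists>\<nu>\<le>\<mu>. b e e = 1 \<and> (\<forall>v\<in>W. a e v = \<nu> * b e v)"
proof -
  define S where "S = {a v v |v. v \<in> W \<and> b v v = 1}"
  have bdd: "bdd_below S" unfolding S_def using a.nonneg W(2) by (intro bdd_belowI[of _ 0]) auto
  define \<nu> where "\<nu> = Inf S"
  have normalise: "\<exists>c. b (c *\<^sub>R w) (c *\<^sub>R w) = 1 \<and> a (c *\<^sub>R w) (c *\<^sub>R w) = a w w / b w w"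
    if "w \<in> W" "0 < b w w" for w
    using that W(2) subspace_scale[OF a.subspace]
    by (intro exI[of _ "1 / sqrt (b w w)"])
       (auto simp: a.scale_left a.scale_right b.scale_left b.scale_right subset_iff)
  have in_S: "a w w / b w w \<in> S" if w: "w \<in> W" "0 < b w w" for w
  proof -
    obtain c where "b (c *\<^sub>R w) (c *\<^sub>R w) = 1" "a (c *\<^sub>R w) (c *\<^sub>R w) = a w w / b w w"
      using normalise[OF w] by blast
    then show ?thesis unfolding S_def using subspace_scale[OF W(1) w(1), of c] by force
  qed
  have lower: "\<nu> * b w w \<le> a w w" if "w \<in> W" for w
  proof (cases "b w w = 0")
    case True
    then show ?thesis using a.nonneg that W(2) by auto
  next
    case False
    then have pos: "0 < b w w" using b.nonneg that W(2) by (metis less_eq_real_def subsetD)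
    have "\<nu> \<le> a w w / b w w"
      unfolding \<nu>_def using in_S[OF that pos] bdd by (rule cInf_lower)
    then show ?thesis using pos by (simp add: field_simps)
  qed
  have "\<nu> \<le> a x x / b x x"
    unfolding \<nu>_def using in_S[OF x(1,2)] bdd by (rule cInf_lower)
  also have "\<dots> \<le> \<mu>" using x by (simp add: field_simps)
  finally have "\<nu> \<le> \<mu>" .
  have "\<exists>v. v \<in> W \<and> b v v = 1 \<and> a v v < \<nu> + 1 / real (Suc n)" for n
  proof -
    have "Inf S < \<nu> + 1 / real (Suc n)" by (simp add: \<nu>_def)
    then show ?thesis
      using cInf_lessD[of S] in_S[OF x(1,2)] unfolding S_def by blast
  qed
  then obtain v where v: "\<And>n. v n \<in> W" "\<And>n. b (v n) (v n) = 1"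
      "\<And>n. a (v n) (v n) < \<nu> + 1 / real (Suc n)" by metis
  have vV: "v n \<in> V" for n using v(1) W(2) by auto
  have bounded: "a (v n) (v n) + b (v n) (v n) \<le> \<nu> + 2" for n
  proof -
    have "1 / real (Suc n) \<le> 1" by simp
    then show ?thesis using v(2)[of n] v(3)[of n] by linarith
  qed
  from compact[of v, OF vV bounded] obtain r :: "nat \<Rightarrow> nat" where "strict_mono r \<and>
      (\<forall>\<epsilon>>0. \<exists>N. \<forall>m\<ge>N. \<forall>n\<ge>N. b (v (r m) - v (r n)) (v (r m) - v (r n)) < \<epsilon>)"
    by (rule exE)
  note r = this[THEN conjunct1] and b_cauchy = this[THEN conjunct2]
  define y where "y n = v (r n)" for n
  have y: "y n \<in> V" "y n \<in> W" "b (y n) (y n) = 1" for n using vV v by (auto simp: y_def)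
  have ay: "a (y n) (y n) < \<nu> + 1 / real (Suc n)" for n
  proof -
    have "1 / real (Suc (r n)) \<le> 1 / real (Suc n)"
      using seq_suble[OF r, of n] by (simp add: field_simps)
    then show ?thesis using v(3)[of "r n"] by (simp add: y_def)
  qed
  \<comment> \<open>Parallelogram law: a minimizing sequence that is Cauchy for \<open>b\<close> is also Cauchy for \<open>a\<close>.\<close>
  have ay_diff: "a (y m - y n) (y m - y n) \<le> 2 / real (Suc m) + 2 / real (Suc n) + \<nu> * b (y m - y n) (y m - y n)" for m n
  proof -
    have "\<nu> * b (y m + y n) (y m + y n) \<le> a (y m + y n) (y m + y n)"
      by (intro lower subspace_add W y)
    then have "\<nu> * (4 - b (y m - y n) (y m - y n)) \<le> 2 * a (y m) (y m) + 2 * a (y n) (y n) - a (y m - y n) (y m - y n)"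
      by (simp add: a.parallelogram b.parallelogram y)
    then show ?thesis using ay[of m] ay[of n] by (simp add: algebra_simps)
  qed
  have nu0: "0 \<le> \<nu>"
    unfolding \<nu>_def using in_S[OF x(1,2)] a.nonneg W(2) by (intro cInf_greatest) (auto simp: S_def)
  have "\<exists>N. \<forall>m\<ge>N. \<forall>n\<ge>N. a (y m - y n) (y m - y n) + b (y m - y n) (y m - y n) < \<epsilon>"
    if \<epsilon>: "\<epsilon> > 0" for \<epsilon>
  proof -
    \<comment> \<open>Adding the \<open>b\<close> part to \<open>ay_diff\<close> puts \<nu> + 1 in
      front of \<open>b\<close>, so that part is below \<epsilon>/2; the constant 8 chosen for
      \<open>N2\<close> makes each of the two other terms smaller than \<epsilon>/4.\<close>
    obtain N1 where N1: "\<And>m n. m \<ge> N1 \<Longrightarrow> n \<ge> N1 \<Longrightarrow> b (y m - y n) (y m - y n) < \<epsilon> / (2 * (\<nu> + 1))"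
      using b_cauchy[rule_format, of "\<epsilon> / (2 * (\<nu> + 1))"] \<epsilon> nu0 by (auto simp: y_def)
    obtain N2 where N2: "8 / \<epsilon> < real N2" using reals_Archimedean2 by blast
    have small: "2 / real (Suc m) < \<epsilon> / 4" if "m \<ge> N2" for m
    proof -
      have "8 / \<epsilon> < real (Suc m)" using N2 that by linarith
      then show ?thesis using \<epsilon> by (simp add: field_simps)
    qed
    have "a (y m - y n) (y m - y n) + b (y m - y n) (y m - y n) < \<epsilon>" if "m \<ge> max N1 N2" "n \<ge> max N1 N2" for m n
    proof -
      have "(\<nu> + 1) * b (y m - y n) (y m - y n) < \<epsilon> / 2"
        using N1[of m n] that nu0 by (simp add: field_simps)
      then show ?thesis using ay_diff[of m n] small[of m] small[of n] that by (simp add: algebra_simps)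
    qed
    then show ?thesis by blast
  qed
  from complete[OF y(1) this] obtain e where e: "e \<in> V"
    and lim: "(\<lambda>n. a (y n - e) (y n - e) + b (y n - e) (y n - e)) \<longlonglongrightarrow> 0" by blast
  have ne: "0 \<le> a (y n - e) (y n - e)" "0 \<le> b (y n - e) (y n - e)" for n
    using y e a.nonneg b.nonneg a.mem_intros by auto
  have lima: "(\<lambda>n. a (y n - e) (y n - e)) \<longlonglongrightarrow> 0"
    by (rule tendsto_sandwich[OF _ _ tendsto_const lim]) (use ne in auto)
  have limb: "(\<lambda>n. b (y n - e) (y n - e)) \<longlonglongrightarrow> 0"
    by (rule tendsto_sandwich[OF _ _ tendsto_const lim]) (use ne in auto)
  have eW: "e \<in> W" by (rule closed[OF y(2) e limb])
  have be: "b e e = 1"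
    using b.tendsto_square[OF y(1) e limb] y(3) by (simp add: LIMSEQ_const_iff)
  have "a e e \<le> \<nu>"
  proof (rule LIMSEQ_le[OF a.tendsto_square[OF y(1) e lima]])
    show "(\<lambda>n. \<nu> + 1 / real (Suc n)) \<longlonglongrightarrow> \<nu>"
      using tendsto_add[OF tendsto_const LIMSEQ_Suc[OF lim_1_over_n], of \<nu>] by simp
    show "\<exists>N. \<forall>n\<ge>N. a (y n) (y n) \<le> \<nu> + 1 / real (Suc n)" using ay less_imp_le by blast
  qed
  then have ae: "a e e = \<nu>" using lower[OF eW] be by simp
  have "a e u = \<nu> * b e u" if u: "u \<in> W" for u
  proof -
    have uV: "u \<in> V" using u W(2) by auto
    \<comment> \<open>The form \<open>a - \<nu> b\<close> is nonnegative on \<open>W\<close> and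
      vanishes at \<open>e\<close>, so its first variation there is zero.\<close>
    have "a e u - \<nu> * b e u = 0"
    proof (rule a.quadratic_minimum)
      fix t :: real
      have "\<nu> * b (e + t *\<^sub>R u) (e + t *\<^sub>R u) \<le> a (e + t *\<^sub>R u) (e + t *\<^sub>R u)"
        by (intro lower subspace_add subspace_scale W eW u)
      then show "0 \<le> 2 * t * (a e u - \<nu> * b e u) + t\<^sup>2 * (a u u - \<nu> * b u u)"
        by (simp add: a.quadratic_add[OF e uV] b.quadratic_add[OF e uV] ae be algebra_simps)
    qed
    then show ?thesis by simp
  qed
  then show ?thesis using eW be \<open>\<nu> \<le> \<mu>\<close> by blast
qed

text \<open>Upper half of the min-max principle. The trial vectors up to index \<open>k\<close>
  offer k + 1 coefficients against k orthogonality conditions, so some nonzero combination is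
  admissible for the next minimisation and bounds its infimum by \<open>\<mu> k\<close>. Only the
  individual bounds on the eigenvalues matter later, for a sum of decreasing functions of
  them.\<close>

theorem eigenvectors_below_trial_bounds:
  assumes \<phi>: "\<And>j. \<phi> j \<in> V"
    and upper: "\<And>k c. a (\<Sum>j\<le>k. c j *\<^sub>R \<phi> j) (\<Sum>j\<le>k. c j *\<^sub>R \<phi> j)
        \<le> \<mu> k * b (\<Sum>j\<le>k. c j *\<^sub>R \<phi> j) (\<Sum>j\<le>k. c j *\<^sub>R \<phi> j)"
    and definite: "\<And>k c. \<exists>j\<le>k. c j \<noteq> 0 \<Longrightarrow>
        0 < b (\<Sum>j\<le>k. c j *\<^sub>R \<phi> j) (\<Sum>j\<le>k. c j *\<^sub>R \<phi> j)"
  shows "\<exists>e \<nu>. \<forall>i<k::nat. e i \<in> V \<and> \<nu> i \<le> \<mu> i \<and> (\<forall>v\<in>V. a (e i) v = \<nu> i * b (e i) v) \<and>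
      (\<forall>j<k. b (e i) (e j) = (if i = j then 1 else 0))"
proof (induction k)
  case 0
  show ?case by simp
next
  case (Suc k)
  then obtain e \<nu> where e: "\<And>i. i < k \<Longrightarrow> e i \<in> V" and \<nu>: "\<And>i. i < k \<Longrightarrow> \<nu> i \<le> \<mu> i"
    and eig: "\<And>i v. i < k \<Longrightarrow> v \<in> V \<Longrightarrow> a (e i) v = \<nu> i * b (e i) v"
    and orth: "\<And>i j. i < k \<Longrightarrow> j < k \<Longrightarrow> b (e i) (e j) = (if i = j then 1 else 0)"
    by blast
  define W where "W = {v \<in> V. \<forall>i<k. b v (e i) = 0}"
  have W: "subspace W"
    by (auto simp: W_def subspace_def b.zero_left b.add_left b.scale_left e intro: b.mem_intros)
  have closed: "w \<in> W" if v: "\<And>n. v n \<in> W" and w: "w \<in> V"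
      and lim: "(\<lambda>n. b (v n - w) (v n - w)) \<longlonglongrightarrow> 0" for v w
  proof -
    have "b w (e i) = 0" if "i < k" for i
    proof -
      have "(\<lambda>n. b (v n) (e i)) \<longlonglongrightarrow> b w (e i)"
        using v w lim e[OF that] by (intro b.tendsto_left) (auto simp: W_def)
      moreover have "b (v n) (e i) = 0" for n using v that by (auto simp: W_def)
      ultimately show ?thesis by (simp add: LIMSEQ_const_iff)
    qed
    then show ?thesis using w by (simp add: W_def)
  qed
  obtain c where c: "\<exists>j\<le>k. c j \<noteq> 0" "\<And>i. i < k \<Longrightarrow> (\<Sum>j\<le>k. c j * b (\<phi> j) (e i)) = 0"
    using homogeneous_system_nontrivial_solution[where A = "\<lambda>i j. b (\<phi> j) (e i)"] by blast
  define w0 where "w0 = (\<Sum>j\<le>k. c j *\<^sub>R \<phi> j)"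
  have "w0 \<in> W"
    using c(2) \<phi> e by (auto simp: W_def w0_def b.sum_left b.scale_left b.mem_intros)
  then have "\<exists>f\<in>W. \<exists>l\<le>\<mu> k. b f f = 1 \<and> (\<forall>v\<in>W. a f v = l * b f v)"
    using definite[OF c(1)] upper[where c = c and k = k] closed
    by (intro minimizer_exists[OF W, of w0]) (auto simp: w0_def W_def)
  then obtain f l where f: "f \<in> W" "l \<le> \<mu> k" "b f f = 1" and f_eig: "\<And>v. v \<in> W \<Longrightarrow> a f v = l * b f v"
    by blast
  have fV: "f \<in> V" and f_orth: "\<And>i. i < k \<Longrightarrow> b f (e i) = 0" using f(1) by (auto simp: W_def)
  have f_eig': "a f v = l * b f v" if v: "v \<in> V" for v
  proof -
    \<comment> \<open>The \<open>b\<close>-projection of \<open>v\<close> onto the earlier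
      eigenvectors. The remainder lies in \<open>W\<close>, and the projection contributes zero to
      both sides, since \<open>f\<close> is \<open>b\<close>-orthogonal and, by the eigenvalue
      equations, also \<open>a\<close>-orthogonal to each \<open>e i\<close>.\<close>
    define s where "s = (\<Sum>i<k. b v (e i) *\<^sub>R e i)"
    have sV: "s \<in> V" unfolding s_def by (intro b.mem_intros) (use e in auto)
    have bs: "b s (e j) = b v (e j)" if j: "j < k" for j
    proof -
      have "b s (e j) = (\<Sum>i<k. b v (e i) * b (e i) (e j))"
        unfolding s_def by (rule b.sum_scale_left) (use e j in auto)
      also have "\<dots> = (\<Sum>i<k. if i = j then b v (e i) else 0)"
        by (intro sum.cong refl) (use j orth in auto)
      finally show ?thesis using j by simp
    qed
    have "v - s \<in> W" using v sV bs by (auto simp: W_def b.diff_left e b.mem_intros)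
    then have "a f (v - s) = l * b f (v - s)" by (rule f_eig)
    moreover have "a s f = (\<Sum>i<k. b v (e i) * a (e i) f)" "b s f = (\<Sum>i<k. b v (e i) * b (e i) f)"
      unfolding s_def by (rule a.sum_scale_left b.sum_scale_left; use e fV in simp)+
    moreover have "a (e i) f = 0" "b (e i) f = 0" if "i < k" for i
      using eig[OF that fV] f_orth[OF that] b.sym[OF e[OF that] fV] by simp_all
    ultimately show ?thesis
      using v sV fV a.sym[OF sV fV] b.sym[OF sV fV] by (simp add: a.diff_right b.diff_right)
  qed
  show ?case
  proof (intro exI[of _ "e(k := f)"] exI[of _ "\<nu>(k := l)"] allI impI)
    fix i assume i: "i < Suc k"
    have "b (e i) f = 0" if "i < k" for i
      using b.sym[OF fV e[OF that]] f_orth[OF that] by simp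
    then have "\<forall>j<Suc k. b ((e(k := f)) i) ((e(k := f)) j) = (if i = j then 1 else 0)"
      using i orth f(3) f_orth by (auto simp: less_Suc_eq)
    moreover have "(e(k := f)) i \<in> V \<and> (\<nu>(k := l)) i \<le> \<mu> i \<and>
        (\<forall>v\<in>V. a ((e(k := f)) i) v = (\<nu>(k := l)) i * b ((e(k := f)) i) v)"
    proof (cases "i = k")
      case True
      then show ?thesis using fV f(2) f_eig' by simp
    next
      case False
      then have "i < k" using i by simp
      then show ?thesis using e[of i] \<nu>[of i] eig[of i] by simp
    qed
    ultimately show "(e(k := f)) i \<in> V \<and> (\<nu>(k := l)) i \<le> \<mu> i \<and>
        (\<forall>v\<in>V. a ((e(k := f)) i) v = (\<nu>(k := l)) i * b ((e(k := f)) i) v) \<and>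
        (\<forall>j<Suc k. b ((e(k := f)) i) ((e(k := f)) j) = (if i = j then 1 else 0))"
      by blast
  qed
qed

end

section \<open>Square integrable functions\<close>

text \<open>Representatives are plain functions, added and scaled pointwise, so that the abstract
  forms apply to them.\<close>

instantiation "fun" :: (type, real_vector) real_vector
begin

definition "c *\<^sub>R f = (\<lambda>x. c *\<^sub>R f x)"

instance
  by standard (simp_all add: scaleR_fun_def fun_eq_iff scaleR_add_left scaleR_add_right)

end

lemma scaleR_fun_apply [simp]: "(c *\<^sub>R f) x = c *\<^sub>R f x"
  by (simp add: scaleR_fun_def)

definition L2_inner ::
    "'a::euclidean_space set \<Rightarrow> ('a \<Rightarrow> 'b::euclidean_space) \<Rightarrow> ('a \<Rightarrow> 'b) \<Rightarrow> real" where
  "L2_inner S f g = (LINT x:S|lborel. f x \<bullet> g x)"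

lemma L2_inner_self: "L2_inner S f f = (LINT x:S|lborel. (norm (f x))\<^sup>2)"
  by (simp add: L2_inner_def dot_square_norm)

lemma L2_inner_integrable:
  assumes "L2_on S f" "L2_on S g"
  shows "set_integrable lborel S (\<lambda>x. f x \<bullet> g x)"
proof -
  let ?F = "\<lambda>x. indicator S x *\<^sub>R f x" and ?G = "\<lambda>x. indicator S x *\<^sub>R g x"
  have F[measurable]: "?F \<in> borel_measurable lborel" and G[measurable]: "?G \<in> borel_measurable lborel"
    using assms by (auto simp: L2_on_def set_borel_measurable_def)
  have eq: "indicator S x *\<^sub>R (f x \<bullet> g x) = ?F x \<bullet> ?G x" for x
    by (simp add: indicator_def)
  have int: "integrable lborel (\<lambda>x. indicator S x *\<^sub>R (norm (f x))\<^sup>2 + indicator S x *\<^sub>R (norm (g x))\<^sup>2)"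
    using assms by (auto simp: L2_on_def set_integrable_def)
  show ?thesis
    unfolding set_integrable_def eq
  proof (rule Bochner_Integration.integrable_bound[OF int])
    show "(\<lambda>x. ?F x \<bullet> ?G x) \<in> borel_measurable lborel" by measurable
    have "\<bar>u \<bullet> v\<bar> \<le> (norm u)\<^sup>2 + (norm v)\<^sup>2" for u v :: 'b
    proof -
      have "\<bar>u \<bullet> v\<bar> \<le> norm u * norm v" by (rule Cauchy_Schwarz_ineq2)
      also have "\<dots> \<le> (norm u)\<^sup>2 + (norm v)\<^sup>2"
        using sum_squares_bound[of "norm u" "norm v"] mult_nonneg_nonneg[OF norm_ge_zero norm_ge_zero, of u v] by linarith
      finally show ?thesis .
    qed
    then show "AE x in lborel. norm (?F x \<bullet> ?G x)
        \<le> norm (indicator S x *\<^sub>R (norm (f x))\<^sup>2 + indicator S x *\<^sub>R (norm (g x))\<^sup>2)"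
      by (auto simp: indicator_def)
  qed
qed

lemma L2_on_zero: "L2_on S 0"
  by (simp add: L2_on_def set_borel_measurable_def set_integrable_def)

lemma L2_on_scaleR:
  assumes "L2_on S f" shows "L2_on S (c *\<^sub>R f)"
proof -
  have "(\<lambda>x. c *\<^sub>R (indicator S x *\<^sub>R f x)) \<in> borel_measurable lborel"
    using borel_measurable_scaleR[OF borel_measurable_const, of "\<lambda>x. indicator S x *\<^sub>R f x" lborel c] assms
    unfolding L2_on_def set_borel_measurable_def by blast
  moreover have "set_integrable lborel S (\<lambda>x. c\<^sup>2 * (norm (f x))\<^sup>2)"
    using assms by (auto simp: L2_on_def)
  ultimately show ?thesis
    by (simp add: L2_on_def set_borel_measurable_def power_mult_distrib mult.commute)
qed

lemma L2_on_add:
  assumes "L2_on S f" "L2_on S g" shows "L2_on S (f + g)"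
proof -
  have "(\<lambda>x. indicator S x *\<^sub>R f x + indicator S x *\<^sub>R g x) \<in> borel_measurable lborel"
    using assms by (auto simp: L2_on_def set_borel_measurable_def)
  moreover have "set_integrable lborel S (\<lambda>x. (norm (f x))\<^sup>2 + (norm (g x))\<^sup>2 + 2 * (f x \<bullet> g x))"
    using assms L2_inner_integrable[OF assms] by (auto simp: L2_on_def)
  moreover have "(norm (f x + g x))\<^sup>2 = (norm (f x))\<^sup>2 + (norm (g x))\<^sup>2 + 2 * (f x \<bullet> g x)" for x
    by (simp add: power2_norm_eq_inner inner_add_left inner_add_right inner_commute)
  ultimately show ?thesis
    by (simp add: L2_on_def set_borel_measurable_def scaleR_add_right)
qed

lemma subspace_L2: "subspace {f. L2_on S f}"
  by (simp add: subspace_def L2_on_zero L2_on_add L2_on_scaleR)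

lemma L2_on_diff: "L2_on S f \<Longrightarrow> L2_on S g \<Longrightarrow> L2_on S (f - g)"
  using subspace_diff[OF subspace_L2, of f S g] by simp

interpretation L2: psd_form "{f. L2_on S f}" "L2_inner S" for S
proof
  show "subspace {f. L2_on S f}" by (rule subspace_L2)
  show "L2_inner S f g = L2_inner S g f" for f g by (simp add: L2_inner_def inner_commute)
  show "0 \<le> L2_inner S f f" for f
    by (auto simp: L2_inner_self set_lebesgue_integral_def intro!: integral_nonneg_AE)
  show "L2_inner S (f + g) h = L2_inner S f h + L2_inner S g h"
    if "f \<in> {f. L2_on S f}" "g \<in> {f. L2_on S f}" "h \<in> {f. L2_on S f}" for f g h
    using that by (simp add: L2_inner_def inner_add_left L2_inner_integrable)
  show "L2_inner S (c *\<^sub>R f) g = c * L2_inner S f g" for f g c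
    by (simp add: L2_inner_def)
qed

lemma L2_inner_cauchy_schwarz:
  "L2_on S f \<Longrightarrow> L2_on S g \<Longrightarrow> (L2_inner S f g)\<^sup>2 \<le> L2_inner S f f * L2_inner S g g"
  by (rule L2.cauchy_schwarz) simp_all

lemma nn_integral_L2:
  assumes "L2_on S f"
  shows "(\<integral>\<^sup>+x\<in>S. ennreal ((norm (f x))\<^sup>2) \<partial>lborel) = ennreal (L2_inner S f f)"
proof -
  have "(\<integral>\<^sup>+x. ennreal (indicator S x *\<^sub>R (norm (f x))\<^sup>2) \<partial>lborel) = ennreal (L2_inner S f f)"
    unfolding L2_inner_self set_lebesgue_integral_def
    using assms by (intro nn_integral_eq_integral) (auto simp: L2_on_def set_integrable_def)
  moreover have "ennreal (indicator S x *\<^sub>R (norm (f x))\<^sup>2) = ennreal ((norm (f x))\<^sup>2) * indicator S x" for x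
    by (simp add: indicator_def)
  ultimately show ?thesis by simp
qed

lemma L2_on_if_nn_integral:
  fixes f :: "'a::euclidean_space \<Rightarrow> 'b::euclidean_space"
  assumes "set_borel_measurable lborel S f"
    and "(\<integral>\<^sup>+x\<in>S. ennreal ((norm (f x))\<^sup>2) \<partial>lborel) < \<infinity>"
  shows "L2_on S f"
proof -
  have m: "(\<lambda>x. indicator S x *\<^sub>R f x) \<in> borel_measurable lborel"
    using assms(1) by (simp add: set_borel_measurable_def)
  have eq: "indicator S x *\<^sub>R (norm (f x))\<^sup>2 = (norm (indicator S x *\<^sub>R f x))\<^sup>2" for x
    by (simp add: indicator_def)
  have eq': "ennreal ((norm (indicator S x *\<^sub>R f x))\<^sup>2) = ennreal ((norm (f x))\<^sup>2) * indicator S x" for x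
    by (simp add: indicator_def)
  have "integrable lborel (\<lambda>x. (norm (indicator S x *\<^sub>R f x))\<^sup>2)"
    using assms(2) borel_measurable_power[OF measurable_compose[OF m borel_measurable_norm], of 2]
    unfolding eq'[symmetric] by (intro integrableI_nonneg) simp_all
  then show ?thesis
    using assms(1) unfolding L2_on_def set_integrable_def eq by blast
qed

text \<open>Riesz-Fischer: the pointwise limit along a fast subsequence serves as \<open>g\<close>,
  and Fatou's lemma bounds its distance to the whole sequence.\<close>

theorem L2_complete:
  fixes f :: "nat \<Rightarrow> 'a::euclidean_space \<Rightarrow> 'b::euclidean_space"
  assumes f: "\<And>n. L2_on S (f n)"
    and cauchy: "\<And>\<epsilon>. 0 < \<epsilon> \<Longrightarrow> \<exists>N. \<forall>m\<ge>N. \<forall>n\<ge>N. L2_inner S (f m - f n) (f m - f n) < \<epsilon>"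
  shows "\<exists>g. L2_on S g \<and> (\<lambda>n. L2_inner S (f n - g) (f n - g)) \<longlonglongrightarrow> 0"
proof -
  define F where "F n x = indicator S x *\<^sub>R f n x" for n x
  have F[measurable]: "F n \<in> borel_measurable lborel" for n
    using f[of n] by (simp add: F_def[abs_def] L2_on_def set_borel_measurable_def)
  have FF: "(\<integral>\<^sup>+x. ennreal ((norm (F m x - F n x))\<^sup>2) \<partial>lborel) = ennreal (L2_inner S (f m - f n) (f m - f n))" for m n
    unfolding nn_integral_L2[OF L2_on_diff[OF f f], symmetric]
    by (intro nn_integral_cong) (simp add: F_def indicator_def)
  have "\<exists>N. \<forall>m\<ge>N. \<forall>n\<ge>N. L2_inner S (f m - f n) (f m - f n) < (1/8)^k" for k :: nat
    by (rule cauchy) simp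
  then obtain N where N: "\<And>k m n. m \<ge> N k \<Longrightarrow> n \<ge> N k \<Longrightarrow> L2_inner S (f m - f n) (f m - f n) < (1/8)^k"
    by metis
  \<comment> \<open>Along \<open>r\<close> the squared increments are below \<open>8\<^sup>-\<^sup>k\<close>, so their sum with weights \<open>4\<^sup>k\<close> is finite almost
    everywhere, which forces geometric pointwise convergence.\<close>
  define r where "r k = (\<Sum>i\<le>k. N i)" for k
  have r: "N k \<le> r k" "r k \<le> r (Suc k)" for k
    by (auto simp: r_def intro: member_le_sum)
  have r_ge: "N k \<le> r j" if "k \<le> j" for k j
    using that by (auto simp: r_def intro: member_le_sum)
  define D where "D k x = (norm (F (r (Suc k)) x - F (r k) x))\<^sup>2" for k x
  have D[measurable]: "D k \<in> borel_measurable lborel" for k unfolding D_def[abs_def] by measurable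
  have "(\<integral>\<^sup>+x. (\<Sum>k. ennreal (4^k * D k x)) \<partial>lborel) = (\<Sum>k. \<integral>\<^sup>+x. ennreal (4^k * D k x) \<partial>lborel)"
    by (rule nn_integral_suminf) measurable
  also have "\<dots> \<le> (\<Sum>k. ennreal ((1/2)^k))"
  proof (intro suminf_le allI)
    fix k
    have "(\<integral>\<^sup>+x. ennreal (4^k * D k x) \<partial>lborel) = ennreal (4^k) * (\<integral>\<^sup>+x. ennreal (D k x) \<partial>lborel)"
      by (subst nn_integral_cmult[symmetric]) (auto simp: D_def ennreal_mult)
    also have "\<dots> \<le> ennreal (4^k) * ennreal ((1/8)^k)"
      using N[of k "r (Suc k)" "r k"] r(1,2)[of k] unfolding D_def FF
      by (intro mult_left_mono ennreal_leI) auto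
    also have "\<dots> = ennreal ((1/2)^k)"
      by (simp add: ennreal_mult[symmetric] power_mult_distrib[symmetric])
    finally show "(\<integral>\<^sup>+x. ennreal (4^k * D k x) \<partial>lborel) \<le> ennreal ((1/2)^k)" .
  qed auto
  also have "\<dots> < \<infinity>"
  proof -
    have "summable (\<lambda>k. (1/2::real)^k)" by simp
    then show ?thesis by (subst suminf_ennreal2) auto
  qed
  finally have "AE x in lborel. (\<Sum>k. ennreal (4^k * D k x)) \<noteq> \<infinity>"
    by (intro nn_integral_PInf_AE) (auto simp: less_top)
  then have conv: "AE x in lborel. convergent (\<lambda>k. F (r k) x)"
  proof eventually_elim
    fix x assume fin: "(\<Sum>k. ennreal (4^k * D k x)) \<noteq> \<infinity>"
    define C where "C = enn2real (\<Sum>k. ennreal (4^k * D k x))"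
    have C: "0 \<le> C" by (simp add: C_def)
    have bound: "norm (F (r (Suc k)) x - F (r k) x) \<le> sqrt C * (1/2)^k" for k
    proof -
      have "(\<Sum>j\<in>{k}. ennreal (4^j * D j x)) \<le> (\<Sum>k. ennreal (4^k * D k x))"
        by (intro sum_le_suminf) auto
      then have "ennreal (4^k * D k x) \<le> ennreal C"
        using fin by (simp add: C_def less_top)
      then have "4^k * D k x \<le> C" using C by (simp add: ennreal_le_iff)
      then have "sqrt (4^k * D k x) \<le> sqrt C" by simp
      moreover have "sqrt (4^k * D k x) = 2^k * norm (F (r (Suc k)) x - F (r k) x)"
        by (simp add: D_def real_sqrt_mult real_sqrt_power)
      ultimately have "2^k * norm (F (r (Suc k)) x - F (r k) x) \<le> sqrt C" by metis
      then show ?thesis by (simp add: field_simps power_divide)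
    qed
    have "summable (\<lambda>k. F (r (Suc k)) x - F (r k) x)"
      by (rule summable_comparison_test'[where N = 0, OF _ bound]) (intro summable_mult summable_geometric, simp)
    then have "convergent (\<lambda>n. \<Sum>k<n. F (r (Suc k)) x - F (r k) x)"
      by (simp add: summable_iff_convergent)
    then have "convergent (\<lambda>n. F (r n) x - F (r 0) x)" by (simp add: sum_lessThan_telescope[of "\<lambda>n. F (r n) x"])
    then have "convergent (\<lambda>n. (F (r n) x - F (r 0) x) + F (r 0) x)"
      by (intro convergent_add convergent_const)
    then show "convergent (\<lambda>k. F (r k) x)" by simp
  qed
  define g where "g x = lim (\<lambda>k. F (r k) x)" for x
  have g[measurable]: "g \<in> borel_measurable lborel"
    unfolding g_def[abs_def] by (rule borel_measurable_lim_metric) measurable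
  have g0: "g x = 0" if "x \<notin> S" for x using that by (simp add: g_def F_def)
  \<comment> \<open>The Cauchy bound for \<open>F n - F (r k)\<close> survives the limit in
    \<open>k\<close>.\<close>
  have close: "(\<integral>\<^sup>+x. ennreal ((norm (F n x - g x))\<^sup>2) \<partial>lborel) \<le> ennreal ((1/8)^j)" if "n \<ge> N j" for n j
  proof -
    have "(\<integral>\<^sup>+x. ennreal ((norm (F n x - g x))\<^sup>2) \<partial>lborel)
        = (\<integral>\<^sup>+x. liminf (\<lambda>k. ennreal ((norm (F n x - F (r k) x))\<^sup>2)) \<partial>lborel)"
    proof (rule nn_integral_cong_AE, use conv in eventually_elim)
      fix x assume "convergent (\<lambda>k. F (r k) x)"
      then have "(\<lambda>k. F (r k) x) \<longlonglongrightarrow> g x" by (simp add: g_def convergent_LIMSEQ_iff)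
      then have "(\<lambda>k. ennreal ((norm (F n x - F (r k) x))\<^sup>2)) \<longlonglongrightarrow> ennreal ((norm (F n x - g x))\<^sup>2)"
        by (intro tendsto_intros tendsto_ennrealI)
      then show "ennreal ((norm (F n x - g x))\<^sup>2) = liminf (\<lambda>k. ennreal ((norm (F n x - F (r k) x))\<^sup>2))"
        by (intro lim_imp_Liminf[symmetric]) simp_all
    qed
    also have "\<dots> \<le> liminf (\<lambda>k. \<integral>\<^sup>+x. ennreal ((norm (F n x - F (r k) x))\<^sup>2) \<partial>lborel)"
      by (rule nn_integral_liminf) measurable
    also have "\<dots> \<le> ennreal ((1/8)^j)"
    proof (rule Liminf_le)
      show "\<forall>\<^sub>F k in sequentially. (\<integral>\<^sup>+x. ennreal ((norm (F n x - F (r k) x))\<^sup>2) \<partial>lborel) \<le> ennreal ((1/8)^j)"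
        unfolding FF eventually_sequentially
        using N[OF that r_ge] by (intro exI[of _ j] allI impI ennreal_leI order_less_imp_le) simp
    qed simp
    finally show ?thesis .
  qed
  have close': "(\<integral>\<^sup>+x\<in>S. ennreal ((norm ((f n - g) x))\<^sup>2) \<partial>lborel) \<le> ennreal ((1/8)^j)" if "n \<ge> N j" for n j
  proof -
    have "(\<integral>\<^sup>+x\<in>S. ennreal ((norm ((f n - g) x))\<^sup>2) \<partial>lborel) = (\<integral>\<^sup>+x. ennreal ((norm (F n x - g x))\<^sup>2) \<partial>lborel)"
      by (intro nn_integral_cong) (auto simp: F_def indicator_def g0)
    then show ?thesis using close[OF that] by simp
  qed
  have meas: "set_borel_measurable lborel S (f n - g)" for n
  proof -
    have "(\<lambda>x. indicator S x *\<^sub>R (f n - g) x) = (\<lambda>x. F n x - g x)"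
      by (auto simp: F_def indicator_def g0)
    then show ?thesis unfolding set_borel_measurable_def by simp
  qed
  \<comment> \<open>Finiteness for one late index already places \<open>g\<close> itself in L2, and
    with it all differences.\<close>
  have L2: "L2_on S (f n - g)" if "n \<ge> N 0" for n
    using le_less_trans[OF close'[OF that] ennreal_less_top] by (intro L2_on_if_nn_integral meas) simp
  have gL2: "L2_on S g"
    using L2_on_diff[OF f[of "N 0"] L2[of "N 0"]] by simp
  have L2': "L2_on S (f n - g)" for n using f gL2 by (rule L2_on_diff)
  have le: "L2_inner S (f n - g) (f n - g) \<le> (1/8)^j" if "n \<ge> N j" for n j
    using close'[OF that] unfolding nn_integral_L2[OF L2'] by (simp add: ennreal_le_iff)
  have nonneg: "0 \<le> L2_inner S (f n - g) (f n - g)" for n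
    using L2' by (intro L2.nonneg) simp
  have "(\<lambda>n. L2_inner S (f n - g) (f n - g)) \<longlonglongrightarrow> 0"
  proof (rule LIMSEQ_I)
    fix e :: real assume "0 < e"
    then obtain j where j: "(1/8)^j < e" using real_arch_pow_inv[of e "1/8"] by auto
    show "\<exists>no. \<forall>n\<ge>no. norm (L2_inner S (f n - g) (f n - g) - 0) < e"
      using le_less_trans[OF le j] nonneg by (intro exI[of _ "N j"]) auto
  qed
  with gL2 show ?thesis by blast
qed

section \<open>Estimates for smooth functions along segments\<close>

lemma smooth_fun_has_derivative:
  assumes "smooth_fun \<phi>"
  shows "(\<phi> has_derivative (\<lambda>v. grad \<phi> x \<bullet> v)) (at x)"
proof -
  obtain P where P: "P 0 0 = \<phi>"
    "\<And>i j x. (P i j has_derivative (\<lambda>v. P (Suc i) j x * fst v + P i (Suc j) x * snd v)) (at x)"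
    using assms unfolding smooth_fun_def by blast
  have D: "(\<phi> has_derivative (\<lambda>v. P (Suc 0) 0 x * fst v + P 0 (Suc 0) x * snd v)) (at x)"
    using P(2)[of 0 0 x] by (simp add: P(1))
  have "frechet_derivative \<phi> (at x) = (\<lambda>v. P (Suc 0) 0 x * fst v + P 0 (Suc 0) x * snd v)"
    using frechet_derivative_at[OF D] by simp
  then have "(\<lambda>v. grad \<phi> x \<bullet> v) = (\<lambda>v. P (Suc 0) 0 x * fst v + P 0 (Suc 0) x * snd v)"
    by (simp add: grad_def inner_prod_def fun_eq_iff)
  then show ?thesis using D by simp
qed

lemma grad_eqI:
  assumes "(\<phi> has_derivative (\<lambda>v. g1 * fst v + g2 * snd v)) (at x)"
  shows "grad \<phi> x = (g1, g2)"
  using frechet_derivative_at[OF assms, symmetric] by (simp add: grad_def)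

lemma smooth_fun_continuous:
  assumes "smooth_fun \<phi>"
  shows "continuous_on UNIV \<phi>" "continuous_on UNIV (grad \<phi>)"
proof -
  obtain P where P: "P 0 0 = \<phi>"
    "\<And>i j x. (P i j has_derivative (\<lambda>v. P (Suc i) j x * fst v + P i (Suc j) x * snd v)) (at x)"
    using assms unfolding smooth_fun_def by blast
  have cont: "continuous_on UNIV (P i j)" for i j
    using P(2)[of i j] by (intro continuous_at_imp_continuous_on ballI has_derivative_continuous)
  have "grad \<phi> = (\<lambda>x. (P 1 0 x, P 0 1 x))"
    using P(2)[of 0 0] by (intro ext grad_eqI) (simp add: P(1))
  then show "continuous_on UNIV (grad \<phi>)" by (auto intro!: continuous_intros cont)
  show "continuous_on UNIV \<phi>" using cont[of 0 0] by (simp add: P(1))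
qed

lemma smooth_fun_borel [measurable_dest]:
  assumes "smooth_fun \<phi>"
  shows "\<phi> \<in> borel_measurable borel" "grad \<phi> \<in> borel_measurable borel"
  using smooth_fun_continuous[OF assms] by (auto intro: borel_measurable_continuous_onI)

lemma smooth_fun_line_derivative:
  assumes "smooth_fun \<phi>"
  shows "((\<lambda>t. \<phi> (x + t *\<^sub>R v)) has_real_derivative grad \<phi> (x + t *\<^sub>R v) \<bullet> v) (at t)"
proof -
  have "((\<lambda>t. \<phi> (x + t *\<^sub>R v)) has_derivative (\<lambda>h. grad \<phi> (x + t *\<^sub>R v) \<bullet> (h *\<^sub>R v))) (at t)"
    by (rule has_derivative_compose[OF _ smooth_fun_has_derivative[OF assms]])
       (auto intro!: derivative_eq_intros)
  then show ?thesis by (simp add: has_field_derivative_def mult.commute[of _ "_ \<bullet> v"] mult_commute_abs)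
qed

text \<open>Extended values let the estimates use Fubini, translation and monotonicity without
  tracking integrability; real numbers return once square integrability is known.\<close>

definition L2sq :: "'a::euclidean_space set \<Rightarrow> ('a \<Rightarrow> 'b::euclidean_space) \<Rightarrow> ennreal" where
  "L2sq S f = (\<integral>\<^sup>+x\<in>S. ennreal ((norm (f x))\<^sup>2) \<partial>lborel)"

lemma L2sq_mono: "S \<subseteq> T \<Longrightarrow> L2sq S f \<le> L2sq T f"
  unfolding L2sq_def by (intro nn_integral_mono) (auto simp: indicator_def)

lemma L2sq_Un:
  assumes [measurable]: "f \<in> borel_measurable borel" "S \<in> sets borel" "T \<in> sets borel"
  shows "L2sq (S \<union> T) f \<le> L2sq S f + L2sq T f"
proof -
  have "L2sq (S \<union> T) f \<le> (\<integral>\<^sup>+x. ennreal ((norm (f x))\<^sup>2) * indicator S x + ennreal ((norm (f x))\<^sup>2) * indicator T x \<partial>lborel)"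
    unfolding L2sq_def by (intro nn_integral_mono) (auto simp: indicator_def)
  also have "\<dots> = L2sq S f + L2sq T f"
    unfolding L2sq_def by (rule nn_integral_add) auto
  finally show ?thesis .
qed

lemma nn_integral_Icc_eq_Ioc:
  fixes a b :: real
  shows "(\<integral>\<^sup>+x\<in>{a..b}. f x \<partial>lborel) = (\<integral>\<^sup>+x\<in>{a<..b}. f x \<partial>lborel)"
proof (rule nn_integral_cong_AE)
  have "AE x in lborel. x \<noteq> a" by (rule AE_lborel_singleton)
  then show "AE x in lborel. f x * indicator {a..b} x = f x * indicator {a<..b} x"
    by eventually_elim (auto simp: indicator_def)
qed

text \<open>Cauchy-Schwarz applied to the fundamental theorem of calculus.\<close>

lemma increment_sq_le:
  fixes h h' :: "real \<Rightarrow> real"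
  assumes ab: "a \<le> b" and deriv: "\<And>x. (h has_real_derivative h' x) (at x)"
    and cont: "continuous_on UNIV h'"
  shows "ennreal ((h b - h a)\<^sup>2) \<le> ennreal (b - a) * (\<integral>\<^sup>+x\<in>{a..b}. ennreal ((h' x)\<^sup>2) \<partial>lborel)"
proof (cases "a = b")
  case False
  then have L: "0 < b - a" using ab by simp
  \<comment> \<open>The mean slope. Integrating the tangent inequality
    \<open>2 * c * h' - c\<^sup>2 \<le> h'\<^sup>2\<close> with this \<open>c\<close> is
    Cauchy-Schwarz.\<close>
  define c where "c = (h b - h a) / (b - a)"
  have int: "set_integrable lborel {a..b} f" if "continuous_on UNIV f" for f :: "real \<Rightarrow> real"
    by (rule borel_integrable_atLeastAtMost') (rule continuous_on_subset[OF that subset_UNIV])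
  have "(LINT x:{a..b}|lborel. 2 * c * h' x - c\<^sup>2) = (2 * c * h b - c\<^sup>2 * b) - (2 * c * h a - c\<^sup>2 * a)"
    unfolding set_lebesgue_integral_def
    by (rule integral_FTC_Icc[OF ab])
       (auto intro!: derivative_eq_intros DERIV_subset[OF deriv] continuous_intros
          continuous_on_subset[OF cont] simp: has_real_derivative_iff_has_vector_derivative[symmetric])
  also have "\<dots> = (h b - h a)\<^sup>2 / (b - a)"
  proof -
    have sq: "(h b - h a)\<^sup>2 / (b - a) = c\<^sup>2 * (b - a)" and hb: "h b = h a + c * (b - a)"
      using L by (simp_all add: c_def power2_eq_square)
    show ?thesis unfolding sq unfolding hb by (simp add: algebra_simps power2_eq_square)
  qed
  finally have "(h b - h a)\<^sup>2 / (b - a) = (LINT x:{a..b}|lborel. 2 * c * h' x - c\<^sup>2)" by simp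
  also have "\<dots> \<le> (LINT x:{a..b}|lborel. (h' x)\<^sup>2)"
  proof (rule set_integral_mono)
    show "2 * c * h' x - c\<^sup>2 \<le> (h' x)\<^sup>2" for x
      using zero_le_power2[of "h' x - c"] by (simp add: power2_diff algebra_simps)
  qed (intro int continuous_intros cont)+
  finally have *: "(h b - h a)\<^sup>2 \<le> (b - a) * (LINT x:{a..b}|lborel. (h' x)\<^sup>2)"
    using L by (simp add: field_simps)
  have "(\<integral>\<^sup>+x\<in>{a..b}. ennreal ((h' x)\<^sup>2) \<partial>lborel) = ennreal (LINT x:{a..b}|lborel. (h' x)\<^sup>2)"
  proof -
    have "set_integrable lborel {a..b} (\<lambda>x. (h' x)\<^sup>2)" by (intro int continuous_intros cont)
    then have "(\<integral>\<^sup>+x. ennreal (indicator {a..b} x *\<^sub>R (h' x)\<^sup>2) \<partial>lborel) = ennreal (LINT x:{a..b}|lborel. (h' x)\<^sup>2)"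
      unfolding set_lebesgue_integral_def set_integrable_def by (intro nn_integral_eq_integral) auto
    moreover have "ennreal (indicator {a..b} x *\<^sub>R (h' x)\<^sup>2) = ennreal ((h' x)\<^sup>2) * indicator {a..b} x" for x
      by (simp add: indicator_def)
    ultimately show ?thesis by simp
  qed
  then show ?thesis using ennreal_leI[OF *] L by (simp add: ennreal_mult')
qed simp

text \<open>The parameter 0 is excluded from the integral because \<open>x\<close> may be a boundary
  point with only the rest of the segment inside \<Omega>.\<close>

lemma segment_increment_sq_le:
  assumes \<phi>: "smooth_fun \<phi>" and s: "0 \<le> s"
  shows "ennreal ((\<phi> (x + s *\<^sub>R v) - \<phi> x)\<^sup>2)
    \<le> ennreal (s * (norm v)\<^sup>2) * (\<integral>\<^sup>+t\<in>{0<..s}. ennreal ((norm (grad \<phi> (x + t *\<^sub>R v)))\<^sup>2) \<partial>lborel)"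
proof -
  note [measurable] = smooth_fun_borel[OF \<phi>]
  have "ennreal ((\<phi> (x + s *\<^sub>R v) - \<phi> (x + 0 *\<^sub>R v))\<^sup>2)
      \<le> ennreal (s - 0) * (\<integral>\<^sup>+t\<in>{0..s}. ennreal ((grad \<phi> (x + t *\<^sub>R v) \<bullet> v)\<^sup>2) \<partial>lborel)"
  proof (rule increment_sq_le[OF s smooth_fun_line_derivative[OF \<phi>]])
    show "continuous_on UNIV (\<lambda>t. grad \<phi> (x + t *\<^sub>R v) \<bullet> v)"
      by (intro continuous_intros continuous_on_compose2[OF smooth_fun_continuous(2)[OF \<phi>]]) auto
  qed
  also have "(\<integral>\<^sup>+t\<in>{0..s}. ennreal ((grad \<phi> (x + t *\<^sub>R v) \<bullet> v)\<^sup>2) \<partial>lborel)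
      \<le> (\<integral>\<^sup>+t. ennreal ((norm v)\<^sup>2) * (ennreal ((norm (grad \<phi> (x + t *\<^sub>R v)))\<^sup>2) * indicator {0..s} t) \<partial>lborel)"
  proof (rule nn_integral_mono)
    fix t
    have "(grad \<phi> (x + t *\<^sub>R v) \<bullet> v)\<^sup>2 \<le> (norm v)\<^sup>2 * (norm (grad \<phi> (x + t *\<^sub>R v)))\<^sup>2"
      using Cauchy_Schwarz_ineq[of "grad \<phi> (x + t *\<^sub>R v)" v] by (simp add: power2_norm_eq_inner mult.commute)
    then show "ennreal ((grad \<phi> (x + t *\<^sub>R v) \<bullet> v)\<^sup>2) * indicator {0..s} t
        \<le> ennreal ((norm v)\<^sup>2) * (ennreal ((norm (grad \<phi> (x + t *\<^sub>R v)))\<^sup>2) * indicator {0..s} t)"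
      by (auto simp: indicator_def ennreal_mult[symmetric] intro: ennreal_leI)
  qed
  also have "\<dots> = ennreal ((norm v)\<^sup>2) * (\<integral>\<^sup>+t\<in>{0..s}. ennreal ((norm (grad \<phi> (x + t *\<^sub>R v)))\<^sup>2) \<partial>lborel)"
    by (rule nn_integral_cmult) measurable
  finally show ?thesis
    using s by (simp add: nn_integral_Icc_eq_Ioc ennreal_mult mult.assoc mult_left_mono)
qed

lemma nn_integral_lborel_translate:
  fixes f :: "'a::euclidean_space \<Rightarrow> ennreal"
  assumes [measurable]: "f \<in> borel_measurable borel"
  shows "(\<integral>\<^sup>+x. f (x + c) \<partial>lborel) = (\<integral>\<^sup>+x. f x \<partial>lborel)"
proof -
  have "(\<integral>\<^sup>+x. f x \<partial>lborel) = (\<integral>\<^sup>+x. f x \<partial>distr lborel borel ((+) c))"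
    by (simp add: lborel_distr_plus)
  also have "\<dots> = (\<integral>\<^sup>+x. f (c + x) \<partial>lborel)"
    by (rule nn_integral_distr) measurable
  finally show ?thesis by (simp add: add.commute)
qed

text \<open>After Fubini the inner integral for fixed \<open>t\<close> is the energy over a
  translate of \<open>S\<close>, which lies in \<Omega>; this is why whole segments, and not only
  their end points, have to stay in \<Omega>.\<close>

lemma translate_increment_L2sq_le:
  assumes \<phi>: "smooth_fun \<phi>" and [measurable]: "S \<in> sets borel" "\<Omega> \<in> sets borel"
    and S: "\<And>x t. x \<in> S \<Longrightarrow> 0 < t \<Longrightarrow> t \<le> 1 \<Longrightarrow> x + t *\<^sub>R v \<in> \<Omega>"
  shows "L2sq S (\<lambda>x. \<phi> (x + v) - \<phi> x) \<le> ennreal ((norm v)\<^sup>2) * L2sq \<Omega> (grad \<phi>)"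
proof -
  note [measurable] = smooth_fun_borel[OF \<phi>]
  let ?E = "\<lambda>x. ennreal ((norm (grad \<phi> x))\<^sup>2)"
  have "L2sq S (\<lambda>x. \<phi> (x + v) - \<phi> x)
      \<le> (\<integral>\<^sup>+x. ennreal ((norm v)\<^sup>2) * (\<integral>\<^sup>+t. ?E (x + t *\<^sub>R v) * indicator {0<..1} t * indicator S x \<partial>lborel) \<partial>lborel)"
    unfolding L2sq_def
  proof (rule nn_integral_mono)
    fix x
    show "ennreal ((norm (\<phi> (x + v) - \<phi> x))\<^sup>2) * indicator S x
      \<le> ennreal ((norm v)\<^sup>2) * (\<integral>\<^sup>+t. ?E (x + t *\<^sub>R v) * indicator {0<..1} t * indicator S x \<partial>lborel)"
      using segment_increment_sq_le[OF \<phi>, of 1 x v] by (simp add: indicator_def)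
  qed
  also have "\<dots> = ennreal ((norm v)\<^sup>2) * (\<integral>\<^sup>+x. (\<integral>\<^sup>+t. ?E (x + t *\<^sub>R v) * indicator {0<..1} t * indicator S x \<partial>lborel) \<partial>lborel)"
    by (rule nn_integral_cmult) measurable
  also have "(\<integral>\<^sup>+x. (\<integral>\<^sup>+t. ?E (x + t *\<^sub>R v) * indicator {0<..1} t * indicator S x \<partial>lborel) \<partial>lborel)
      = (\<integral>\<^sup>+t. (\<integral>\<^sup>+x. ?E (x + t *\<^sub>R v) * indicator {0<..1} t * indicator S x \<partial>lborel) \<partial>lborel)"
    by (rule lborel_pair.Fubini') measurable
  also have "\<dots> \<le> (\<integral>\<^sup>+t. indicator {0<..1::real} t * L2sq \<Omega> (grad \<phi>) \<partial>lborel)"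
  proof (rule nn_integral_mono)
    fix t :: real
    have "(\<integral>\<^sup>+x. ?E (x + t *\<^sub>R v) * indicator {0<..1} t * indicator S x \<partial>lborel)
        \<le> (\<integral>\<^sup>+x. indicator {0<..1} t * (?E (x + t *\<^sub>R v) * indicator \<Omega> (x + t *\<^sub>R v)) \<partial>lborel)"
      using S by (intro nn_integral_mono) (auto simp: indicator_def)
    also have "\<dots> = indicator {0<..1} t * (\<integral>\<^sup>+x. ?E (x + t *\<^sub>R v) * indicator \<Omega> (x + t *\<^sub>R v) \<partial>lborel)"
      by (rule nn_integral_cmult) measurable
    also have "(\<integral>\<^sup>+x. ?E (x + t *\<^sub>R v) * indicator \<Omega> (x + t *\<^sub>R v) \<partial>lborel) = L2sq \<Omega> (grad \<phi>)"
      unfolding L2sq_def by (rule nn_integral_lborel_translate[where f = "\<lambda>x. ?E x * indicator \<Omega> x"]) measurable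
    finally show "(\<integral>\<^sup>+x. ?E (x + t *\<^sub>R v) * indicator {0<..1} t * indicator S x \<partial>lborel)
        \<le> indicator {0<..1} t * L2sq \<Omega> (grad \<phi>)" .
  qed
  also have "\<dots> = L2sq \<Omega> (grad \<phi>)"
    by (subst nn_integral_multc) auto
  finally show ?thesis by (simp add: mult_left_mono)
qed

text \<open>A horizontal shear preserves area and the vertical coordinate is scaled by
  \<open>snd w\<close>, hence the Jacobian.\<close>

lemma nn_integral_slanted:
  fixes H :: "real \<times> real \<Rightarrow> ennreal"
  assumes [measurable]: "H \<in> borel_measurable borel" and w: "snd w \<noteq> 0"
  shows "(\<integral>\<^sup>+x. (\<integral>\<^sup>+s. H ((x, 0) + s *\<^sub>R w) \<partial>lborel) \<partial>lborel) = ennreal (1 / \<bar>snd w\<bar>) * (\<integral>\<^sup>+z. H z \<partial>lborel)"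
proof -
  have "(\<integral>\<^sup>+x. (\<integral>\<^sup>+s. H ((x, 0) + s *\<^sub>R w) \<partial>lborel) \<partial>lborel)
      = (\<integral>\<^sup>+s. (\<integral>\<^sup>+x. H ((x, 0) + s *\<^sub>R w) \<partial>lborel) \<partial>lborel)"
    by (rule lborel_pair.Fubini') measurable
  also have "\<dots> = (\<integral>\<^sup>+s. (\<integral>\<^sup>+x. H (x, snd w * s) \<partial>lborel) \<partial>lborel)"
  proof (rule nn_integral_cong)
    fix s
    have "(\<integral>\<^sup>+x. H (x + s * fst w, snd w * s) \<partial>lborel) = (\<integral>\<^sup>+x. H (x, snd w * s) \<partial>lborel)"
      by (rule nn_integral_lborel_translate[where f = "\<lambda>x. H (x, snd w * s)"]) measurable
    then show "(\<integral>\<^sup>+x. H ((x, 0) + s *\<^sub>R w) \<partial>lborel) = (\<integral>\<^sup>+x. H (x, snd w * s) \<partial>lborel)"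
      by (cases w) (simp add: mult.commute)
  qed
  also have "\<dots> = ennreal (1 / \<bar>snd w\<bar>) * (ennreal \<bar>snd w\<bar> * (\<integral>\<^sup>+s. (\<integral>\<^sup>+x. H (x, 0 + snd w * s) \<partial>lborel) \<partial>lborel))"
    using w by (simp add: mult.assoc[symmetric] ennreal_mult[symmetric])
  also have "ennreal \<bar>snd w\<bar> * (\<integral>\<^sup>+s. (\<integral>\<^sup>+x. H (x, 0 + snd w * s) \<partial>lborel) \<partial>lborel)
      = (\<integral>\<^sup>+y. (\<integral>\<^sup>+x. H (x, y) \<partial>lborel) \<partial>lborel)"
    by (rule nn_integral_real_affine[symmetric, OF _ w]) measurable
  also have "\<dots> = (\<integral>\<^sup>+z. H z \<partial>lborel)"
    by (subst lborel_prod[symmetric], rule lborel_pair.nn_integral_snd) (simp add: lborel_prod)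
  finally show ?thesis .
qed

section \<open>Trace estimates on a slanted strip\<close>

lemma L2_on_continuous:
  fixes f :: "'a::euclidean_space \<Rightarrow> 'b::euclidean_space"
  assumes "bounded S" "S \<in> sets borel" "continuous_on UNIV f"
  shows "L2_on S f"
proof -
  obtain r where "\<forall>x\<in>S. norm x \<le> r" using assms(1) bounded_iff by blast
  then have r: "S \<subseteq> cball 0 r" by auto
  have "set_integrable lborel (cball 0 r) (\<lambda>x. (norm (f x))\<^sup>2)"
    unfolding set_integrable_def
    by (rule borel_integrable_compact)
       (auto intro!: continuous_intros continuous_on_subset[OF assms(3)])
  then have "set_integrable lborel S (\<lambda>x. (norm (f x))\<^sup>2)"
    by (rule set_integrable_subset) (use r assms(2) in auto)
  moreover have "set_borel_measurable lborel S f"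
    using borel_measurable_continuous_onI[OF assms(3)] assms(2)
    by (auto simp: set_borel_measurable_def)
  ultimately show ?thesis by (simp add: L2_on_def)
qed

lemma L2sq_eq_L2_inner: "L2_on S f \<Longrightarrow> L2sq S f = ennreal (L2_inner S f f)"
  by (simp add: L2sq_def nn_integral_L2)

lemma integral_sq_le_L2sq:
  fixes u :: "real \<Rightarrow> real"
  assumes "c \<le> d" "continuous_on UNIV u"
  shows "ennreal ((LINT x:{c..d}|lborel. u x)\<^sup>2) \<le> ennreal (d - c) * L2sq {c..d} u"
proof -
  have L2: "L2_on {c..d} u" "L2_on {c..d} (\<lambda>_. 1::real)"
    by (auto intro!: L2_on_continuous assms continuous_intros)
  have "(L2_inner {c..d} u (\<lambda>_. 1))\<^sup>2 \<le> L2_inner {c..d} u u * L2_inner {c..d} (\<lambda>_. 1::real) (\<lambda>_. 1)"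
    by (rule L2_inner_cauchy_schwarz) (rule L2)+
  moreover have "L2_inner {c..d} (\<lambda>_. 1::real) (\<lambda>_. 1) = d - c"
    using assms(1) by (simp add: L2_inner_def set_lebesgue_integral_def)
  moreover have "L2_inner {c..d} u (\<lambda>_. 1) = (LINT x:{c..d}|lborel. u x)"
    by (simp add: L2_inner_def)
  ultimately have "ennreal ((LINT x:{c..d}|lborel. u x)\<^sup>2) \<le> ennreal ((d - c) * L2_inner {c..d} u u)"
    by (intro ennreal_leI) (simp add: mult.commute)
  then show ?thesis using assms(1) by (simp add: L2sq_eq_L2_inner[OF L2(1)] ennreal_mult')
qed

lemma sq_le_two_sq: "(x::real)\<^sup>2 \<le> 2 * y\<^sup>2 + 2 * (x - y)\<^sup>2"
  using zero_le_power2[of "x - 2 * y"] by (simp add: power2_eq_square algebra_simps)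

lemma mean_value_on_interval:
  fixes g :: "real \<Rightarrow> real"
  assumes "c < d" "continuous_on UNIV g"
  obtains x where "x \<in> {c..d}" "(LINT t:{c..d}|lborel. g t) = g x * (d - c)"
proof -
  have cont: "continuous_on {c..d} g" using assms(2) continuous_on_subset by blast
  obtain G where G: "\<And>x. x \<in> {c..d} \<Longrightarrow> (G has_vector_derivative g x) (at x within {c..d})"
    using antiderivative_continuous[OF cont] by blast
  have "(LINT t:{c..d}|lborel. g t) = G d - G c"
    unfolding set_lebesgue_integral_def using assms(1) G cont by (intro integral_FTC_Icc) auto
  moreover obtain x where "x \<in> {c<..<d}" "G d - G c = (d - c) *\<^sub>R g x"
    using mvt_simple[OF assms(1), of G "\<lambda>x h. h *\<^sub>R g x"] G
    by (auto simp: has_vector_derivative_def)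
  ultimately show ?thesis using that[of x] by (simp add: mult.commute)
qed

text \<open>The mean is attained at some \<open>y\<close>, and every other value differs from
  \<open>g y\<close> by an increment that the energy controls.\<close>

lemma poincare_interval:
  fixes g g' :: "real \<Rightarrow> real"
  assumes cd: "c < d" and deriv: "\<And>x. (g has_real_derivative g' x) (at x)"
    and cont: "continuous_on UNIV g'"
  shows "L2sq {c..d} g \<le> ennreal (2 / (d - c) * (LINT t:{c..d}|lborel. g t)\<^sup>2)
    + ennreal (2 * (d - c)\<^sup>2) * L2sq {c..d} g'"
proof -
  have contg: "continuous_on UNIV g"
    using deriv by (intro continuous_at_imp_continuous_on ballI) (rule DERIV_isCont)
  obtain y where y: "y \<in> {c..d}" and m: "(LINT t:{c..d}|lborel. g t) = g y * (d - c)"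
    using mean_value_on_interval[OF cd contg] by blast
  define K where "K = ennreal (2 * (g y)\<^sup>2) + ennreal (2 * (d - c)) * L2sq {c..d} g'"
  have pt: "ennreal ((g x)\<^sup>2) \<le> K" if x: "x \<in> {c..d}" for x
  proof -
    have "ennreal ((g x - g y)\<^sup>2) \<le> ennreal (d - c) * L2sq {c..d} g'"
    proof (cases "x \<le> y")
      case True
      have "ennreal ((g y - g x)\<^sup>2) \<le> ennreal (y - x) * (\<integral>\<^sup>+x\<in>{x..y}. ennreal ((g' x)\<^sup>2) \<partial>lborel)"
        by (rule increment_sq_le[OF True deriv cont])
      also have "\<dots> \<le> ennreal (d - c) * L2sq {c..d} g'"
        unfolding L2sq_def using x y
        by (intro mult_mono ennreal_leI nn_integral_mono) (auto simp: indicator_def)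
      finally show ?thesis by (simp add: power2_commute)
    next
      case False
      have "ennreal ((g x - g y)\<^sup>2) \<le> ennreal (x - y) * (\<integral>\<^sup>+x\<in>{y..x}. ennreal ((g' x)\<^sup>2) \<partial>lborel)"
        by (rule increment_sq_le[OF _ deriv cont]) (use False in simp)
      also have "\<dots> \<le> ennreal (d - c) * L2sq {c..d} g'"
        unfolding L2sq_def using x y
        by (intro mult_mono ennreal_leI nn_integral_mono) (auto simp: indicator_def)
      finally show ?thesis .
    qed
    then have *: "2 * ennreal ((g x - g y)\<^sup>2) \<le> 2 * (ennreal (d - c) * L2sq {c..d} g')"
      by (intro mult_left_mono) auto
    have "ennreal ((g x)\<^sup>2) \<le> ennreal (2 * (g y)\<^sup>2) + 2 * ennreal ((g x - g y)\<^sup>2)"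
      using ennreal_leI[OF sq_le_two_sq[of "g x" "g y"]] by (simp add: ennreal_mult' ennreal_plus)
    from order_trans[OF this add_left_mono[OF *]] show ?thesis
      unfolding K_def by (subst ennreal_mult'[of 2 "d - c"]) (simp_all only: mult.assoc ennreal_numeral zero_le_numeral)
  qed
  have "L2sq {c..d} g \<le> (\<integral>\<^sup>+x. K * indicator {c..d} x \<partial>lborel)"
    unfolding L2sq_def by (intro nn_integral_mono) (simp add: indicator_def pt)
  also have "\<dots> = K * ennreal (d - c)"
    using cd by (simp add: nn_integral_cmult_indicator)
  also have "\<dots> = ennreal (2 * (g y)\<^sup>2 * (d - c)) + ennreal (2 * (d - c) * (d - c)) * L2sq {c..d} g'"
  proof -
    have "(ennreal (2 * a) + ennreal (2 * e) * X) * ennreal e = ennreal (2 * a * e) + ennreal (2 * e * e) * X"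
      if "0 \<le> a" "0 < e" for a e X
      using that by (simp add: distrib_right distrib_left ennreal_mult ac_simps)
    from this[OF zero_le_power2, of "d - c"] show ?thesis
      unfolding K_def by this (use cd in simp)
  qed
  also have "2 * (g y)\<^sup>2 * (d - c) = 2 / (d - c) * (LINT t:{c..d}|lborel. g t)\<^sup>2"
    using cd unfolding m by (simp add: power2_eq_square)
  also have "2 * (d - c) * (d - c) = 2 * (d - c)\<^sup>2" by (simp add: power2_eq_square)
  finally show ?thesis .
qed

text \<open>The pairs \<open>(x, s)\<close> are slanted coordinates for the point \<open>(x, 0) + s w\<close>; for suitable \<open>w\<close> and
  small \<open>s > 0\<close> this point lies in \<open>\<Omega>\<close>.\<close>

locale smooth_slanted =
  fixes \<phi> :: "real \<times> real \<Rightarrow> real" and w :: "real \<times> real"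
  assumes smooth: "smooth_fun \<phi>" and norm_w: "norm w = 1"
begin

lemma borel [measurable]: "\<phi> \<in> borel_measurable borel" "grad \<phi> \<in> borel_measurable borel"
  using smooth_fun_borel[OF smooth] .

definition E :: "real \<Rightarrow> real \<Rightarrow> ennreal" where
  "E x s = ennreal ((norm (grad \<phi> ((x, 0) + s *\<^sub>R w)))\<^sup>2)"

definition f :: "real \<Rightarrow> real \<Rightarrow> real" where
  "f s x = \<phi> ((x, 0) + s *\<^sub>R w)"

lemma f_0: "f 0 = (\<lambda>x. \<phi> (x, 0))"
  by (simp add: f_def fun_eq_iff)

lemma E_borel [measurable]:
  "(\<lambda>(x, s). E x s) \<in> borel_measurable (borel \<Otimes>\<^sub>M borel)" "E x \<in> borel_measurable borel"
  unfolding E_def[abs_def] by measurable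

lemma f_borel [measurable]:
  "(\<lambda>(s, x). f s x) \<in> borel_measurable (borel \<Otimes>\<^sub>M borel)" "f s \<in> borel_measurable borel"
  unfolding f_def[abs_def] by measurable

lemma increment:
  assumes "0 < s" "s \<le> \<delta>"
  shows "ennreal ((f s x - f 0 x)\<^sup>2) \<le> ennreal \<delta> * (\<integral>\<^sup>+t\<in>{0<..\<delta>}. E x t \<partial>lborel)"
proof -
  have "ennreal ((f s x - f 0 x)\<^sup>2) \<le> ennreal s * (\<integral>\<^sup>+t\<in>{0<..s}. E x t \<partial>lborel)"
    using segment_increment_sq_le[OF smooth, of s "(x, 0)" w] assms
    by (simp add: f_def E_def norm_w)
  also have "\<dots> \<le> ennreal \<delta> * (\<integral>\<^sup>+t\<in>{0<..\<delta>}. E x t \<partial>lborel)"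
    using assms by (intro mult_mono ennreal_leI nn_integral_mono) (auto simp: indicator_def)
  finally show ?thesis .
qed

lemma sq_le:
  assumes "0 < s" "s \<le> \<delta>"
  shows "ennreal ((f 0 x)\<^sup>2) \<le> 2 * ennreal ((f s x)\<^sup>2) + ennreal (2 * \<delta>) * (\<integral>\<^sup>+t\<in>{0<..\<delta>}. E x t \<partial>lborel)"
    and "ennreal ((f s x)\<^sup>2) \<le> 2 * ennreal ((f 0 x)\<^sup>2) + ennreal (2 * \<delta>) * (\<integral>\<^sup>+t\<in>{0<..\<delta>}. E x t \<partial>lborel)"
proof -
  have *: "ennreal (a\<^sup>2) \<le> 2 * ennreal (b\<^sup>2) + ennreal (2 * \<delta>) * Z" if "ennreal ((a - b)\<^sup>2) \<le> ennreal \<delta> * Z" for a b Z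
  proof -
    have "ennreal (a\<^sup>2) \<le> 2 * ennreal (b\<^sup>2) + 2 * ennreal ((a - b)\<^sup>2)"
      using ennreal_leI[OF sq_le_two_sq[of a b]] by (simp add: ennreal_mult' ennreal_plus)
    also have "\<dots> \<le> 2 * ennreal (b\<^sup>2) + 2 * (ennreal \<delta> * Z)"
      by (intro add_left_mono mult_left_mono that) auto
    finally show ?thesis using assms by (simp add: ennreal_mult' mult.assoc)
  qed
  show "ennreal ((f 0 x)\<^sup>2) \<le> 2 * ennreal ((f s x)\<^sup>2) + ennreal (2 * \<delta>) * (\<integral>\<^sup>+t\<in>{0<..\<delta>}. E x t \<partial>lborel)"
    by (rule *) (use increment[OF assms] in \<open>simp add: power2_commute\<close>)
  show "ennreal ((f s x)\<^sup>2) \<le> 2 * ennreal ((f 0 x)\<^sup>2) + ennreal (2 * \<delta>) * (\<integral>\<^sup>+t\<in>{0<..\<delta>}. E x t \<partial>lborel)"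
    by (rule *) (rule increment[OF assms])
qed

text \<open>The Dirichlet energy of the slanted strip below \<open>J\<close>, measured in the
  coordinates \<open>(x, s)\<close>: it is the energy in the plane divided by
  \<open>|snd w|\<close>.\<close>

definition A :: "real set \<Rightarrow> real \<Rightarrow> ennreal" where
  "A J \<delta> = (\<integral>\<^sup>+x\<in>J. (\<integral>\<^sup>+t\<in>{0<..\<delta>}. E x t \<partial>lborel) \<partial>lborel)"

lemma A_swap:
  assumes [measurable]: "J \<in> sets borel"
  shows "A J \<delta> = (\<integral>\<^sup>+s\<in>{0<..\<delta>}. (\<integral>\<^sup>+x\<in>J. E x s \<partial>lborel) \<partial>lborel)"
proof -
  have "A J \<delta> = (\<integral>\<^sup>+x. (\<integral>\<^sup>+t. E x t * indicator {0<..\<delta>} t * indicator J x \<partial>lborel) \<partial>lborel)"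
    unfolding A_def by (intro nn_integral_cong nn_integral_multc[symmetric]) measurable
  also have "\<dots> = (\<integral>\<^sup>+t. (\<integral>\<^sup>+x. E x t * indicator {0<..\<delta>} t * indicator J x \<partial>lborel) \<partial>lborel)"
    by (rule lborel_pair.Fubini') measurable
  also have "\<dots> = (\<integral>\<^sup>+s\<in>{0<..\<delta>}. (\<integral>\<^sup>+x\<in>J. E x s \<partial>lborel) \<partial>lborel)"
    by (intro nn_integral_cong, subst nn_integral_multc[symmetric]) (auto simp: ac_simps)
  finally show ?thesis .
qed

text \<open>Level 0 is compared with each level \<open>s\<close> and the result is averaged over
  \<open>s\<close>. The first inequality bounds the trace by interior values; the second bounds
  interior values by the trace and starts the Poincare argument.\<close>

lemma strip_sq_le:
  assumes [measurable]: "J \<in> sets borel" and \<delta>: "0 < \<delta>"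
  shows "ennreal \<delta> * L2sq J (f 0) \<le> 2 * (\<integral>\<^sup>+s\<in>{0<..\<delta>}. L2sq J (f s) \<partial>lborel) + ennreal (2 * \<delta>\<^sup>2) * A J \<delta>"
    and "(\<integral>\<^sup>+s\<in>{0<..\<delta>}. L2sq J (f s) \<partial>lborel) \<le> ennreal (2 * \<delta>) * L2sq J (f 0) + ennreal (2 * \<delta>\<^sup>2) * A J \<delta>"
proof -
  have bound: "L2sq J g \<le> 2 * L2sq J h + ennreal (2 * \<delta>) * A J \<delta>"
    if [measurable]: "h \<in> borel_measurable borel"
      and le: "\<And>x. ennreal ((g x)\<^sup>2) \<le> 2 * ennreal ((h x)\<^sup>2) + ennreal (2 * \<delta>) * (\<integral>\<^sup>+t\<in>{0<..\<delta>}. E x t \<partial>lborel)"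
    for g h :: "real \<Rightarrow> real"
  proof -
    have "L2sq J g \<le> (\<integral>\<^sup>+x. 2 * (ennreal ((h x)\<^sup>2) * indicator J x)
        + ennreal (2 * \<delta>) * ((\<integral>\<^sup>+t\<in>{0<..\<delta>}. E x t \<partial>lborel) * indicator J x) \<partial>lborel)"
      unfolding L2sq_def using le by (intro nn_integral_mono) (auto simp: indicator_def)
    also have "\<dots> = 2 * L2sq J h + ennreal (2 * \<delta>) * A J \<delta>"
      unfolding L2sq_def A_def
      by (subst nn_integral_add) (auto simp: nn_integral_cmult)
    finally show ?thesis .
  qed
  have [measurable]: "(\<lambda>s. L2sq J (f s)) \<in> borel_measurable borel"
    unfolding L2sq_def by measurable
  have const: "(\<integral>\<^sup>+s. C * indicator {0<..\<delta>} s \<partial>lborel) = C * ennreal \<delta>" for C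
    using \<delta> by (subst nn_integral_cmult_indicator) simp_all
  have "ennreal \<delta> * L2sq J (f 0) = (\<integral>\<^sup>+s. L2sq J (f 0) * indicator {0<..\<delta>} s \<partial>lborel)"
    unfolding const by (rule mult.commute)
  also have "\<dots> \<le> (\<integral>\<^sup>+s. 2 * (L2sq J (f s) * indicator {0<..\<delta>} s) + ennreal (2 * \<delta>) * A J \<delta> * indicator {0<..\<delta>} s \<partial>lborel)"
    using bound[OF _ sq_le(1)] by (intro nn_integral_mono) (auto simp: indicator_def)
  also have "\<dots> = 2 * (\<integral>\<^sup>+s\<in>{0<..\<delta>}. L2sq J (f s) \<partial>lborel) + ennreal (2 * \<delta>) * A J \<delta> * ennreal \<delta>"
    unfolding const[symmetric] by (subst nn_integral_add) (simp_all add: nn_integral_cmult)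
  also have "ennreal (2 * \<delta>) * A J \<delta> * ennreal \<delta> = ennreal (2 * \<delta>\<^sup>2) * A J \<delta>"
    using \<delta> by (simp add: ennreal_mult power2_eq_square ac_simps)
  finally show "ennreal \<delta> * L2sq J (f 0) \<le> 2 * (\<integral>\<^sup>+s\<in>{0<..\<delta>}. L2sq J (f s) \<partial>lborel) + ennreal (2 * \<delta>\<^sup>2) * A J \<delta>" .
  have "(\<integral>\<^sup>+s\<in>{0<..\<delta>}. L2sq J (f s) \<partial>lborel)
      \<le> (\<integral>\<^sup>+s. (2 * L2sq J (f 0) + ennreal (2 * \<delta>) * A J \<delta>) * indicator {0<..\<delta>} s \<partial>lborel)"
    using bound[OF _ sq_le(2)] by (intro nn_integral_mono) (auto simp: indicator_def)
  also have "\<dots> = ennreal (2 * \<delta>) * L2sq J (f 0) + ennreal (2 * \<delta>\<^sup>2) * A J \<delta>"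
    unfolding const using \<delta> by (simp add: ennreal_mult power2_eq_square distrib_right distrib_left ac_simps)
  finally show "(\<integral>\<^sup>+s\<in>{0<..\<delta>}. L2sq J (f s) \<partial>lborel) \<le> ennreal (2 * \<delta>) * L2sq J (f 0) + ennreal (2 * \<delta>\<^sup>2) * A J \<delta>" .
qed

text \<open>The slanted coordinates of \<open>z\<close> are recovered as
  \<open>s = snd z / snd w\<close> and \<open>x = fst z - s * fst w\<close>, which describes the
  region swept out below \<open>J\<close>.\<close>

lemma slanted_eq:
  fixes H :: "real \<times> real \<Rightarrow> ennreal"
  assumes [measurable]: "H \<in> borel_measurable borel" "J \<in> sets borel" and w2: "snd w \<noteq> 0"
  shows "(\<integral>\<^sup>+s\<in>{0<..\<delta>}. (\<integral>\<^sup>+x\<in>J. H ((x, 0) + s *\<^sub>R w) \<partial>lborel) \<partial>lborel)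
    = ennreal (1 / \<bar>snd w\<bar>) * (\<integral>\<^sup>+z. H z * indicator {z. fst z - snd z / snd w * fst w \<in> J \<and> snd z / snd w \<in> {0<..\<delta>}} z \<partial>lborel)"
proof -
  let ?Q = "{z. fst z - snd z / snd w * fst w \<in> J \<and> snd z / snd w \<in> {0<..\<delta>}}"
  have Q: "?Q = (\<lambda>z. fst z - snd z / snd w * fst w) -` J \<inter> (\<lambda>z. snd z / snd w) -` {0<..\<delta>}" by auto
  have "(\<lambda>z. fst z - snd z / snd w * fst w) \<in> borel_measurable borel" "(\<lambda>z::real\<times>real. snd z / snd w) \<in> borel_measurable borel"
    using w2 by (auto intro!: borel_measurable_continuous_onI continuous_intros)
  then have [measurable]: "?Q \<in> sets borel"
    unfolding Q using measurable_sets[of "\<lambda>z. fst z - snd z / snd w * fst w" borel borel J]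
      measurable_sets[of "\<lambda>z::real\<times>real. snd z / snd w" borel borel "{0<..\<delta>}"] assms(2)
    by (intro sets.Int) (auto simp: vimage_def)
  have "(\<integral>\<^sup>+s\<in>{0<..\<delta>}. (\<integral>\<^sup>+x\<in>J. H ((x, 0) + s *\<^sub>R w) \<partial>lborel) \<partial>lborel)
      = (\<integral>\<^sup>+s. (\<integral>\<^sup>+x. H ((x, 0) + s *\<^sub>R w) * indicator J x * indicator {0<..\<delta>} s \<partial>lborel) \<partial>lborel)"
    by (intro nn_integral_cong nn_integral_multc[symmetric]) measurable
  also have "\<dots> = (\<integral>\<^sup>+x. (\<integral>\<^sup>+s. H ((x, 0) + s *\<^sub>R w) * indicator J x * indicator {0<..\<delta>} s \<partial>lborel) \<partial>lborel)"
    by (rule lborel_pair.Fubini'[symmetric]) measurable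
  also have "\<dots> = (\<integral>\<^sup>+x. (\<integral>\<^sup>+s. H ((x, 0) + s *\<^sub>R w) * indicator ?Q ((x, 0) + s *\<^sub>R w) \<partial>lborel) \<partial>lborel)"
    using w2 by (intro nn_integral_cong) (auto simp: indicator_def)
  also have "\<dots> = ennreal (1 / \<bar>snd w\<bar>) * (\<integral>\<^sup>+z. H z * indicator ?Q z \<partial>lborel)"
    by (rule nn_integral_slanted[where H = "\<lambda>z. H z * indicator ?Q z", OF _ w2]) measurable
  finally show ?thesis .
qed

lemma slanted_le:
  fixes H :: "real \<times> real \<Rightarrow> ennreal"
  assumes "H \<in> borel_measurable borel" "J \<in> sets borel" and w2: "snd w \<noteq> 0"
    and sub: "\<And>x s. x \<in> J \<Longrightarrow> 0 < s \<Longrightarrow> s \<le> \<delta> \<Longrightarrow> (x, 0) + s *\<^sub>R w \<in> \<Omega>"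
  shows "(\<integral>\<^sup>+s\<in>{0<..\<delta>}. (\<integral>\<^sup>+x\<in>J. H ((x, 0) + s *\<^sub>R w) \<partial>lborel) \<partial>lborel)
    \<le> ennreal (1 / \<bar>snd w\<bar>) * (\<integral>\<^sup>+z\<in>\<Omega>. H z \<partial>lborel)"
proof -
  have "z \<in> \<Omega>" if "fst z - snd z / snd w * fst w \<in> J" "snd z / snd w \<in> {0<..\<delta>}" for z
    using sub[OF that(1), of "snd z / snd w"] that(2) w2 by (cases z; cases w) auto
  then show ?thesis
    unfolding slanted_eq[OF assms(1-3)]
    by (intro mult_left_mono nn_integral_mono) (auto simp: indicator_def)
qed

lemma A_le:
  assumes "J \<in> sets borel" "snd w \<noteq> 0"
    and "\<And>x s. x \<in> J \<Longrightarrow> 0 < s \<Longrightarrow> s \<le> \<delta> \<Longrightarrow> (x, 0) + s *\<^sub>R w \<in> \<Omega>"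
  shows "A J \<delta> \<le> ennreal (1 / \<bar>snd w\<bar>) * L2sq \<Omega> (grad \<phi>)"
  unfolding A_swap[OF assms(1)] E_def L2sq_def
  by (rule slanted_le[OF _ assms]) measurable

text \<open>Go down from \<open>(x, 0)\<close> to level \<open>s\<close>, apply the one-dimensional Poincare inequality there, compare
  the mean at level \<open>s\<close> with the mean at level \<open>0\<close>, and average over \<open>s\<close>.\<close>

lemma cell_estimate:
  assumes "c < d"
  shows "L2sq {c..d} (f 0) \<le> ennreal (8 / (d - c) * (LINT x:{c..d}|lborel. f 0 x)\<^sup>2)
    + ennreal (14 * (d - c)) * A {c..d} (d - c)"
proof -
  \<comment> \<open>The depth of the strip equals the width of the cell, so comparing levels and the
    one-dimensional Poincare inequality both cost a multiple of \<delta> times the energy.\<close>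
  define \<delta> where "\<delta> = d - c"
  have \<delta>: "0 < \<delta>" using assms by (simp add: \<delta>_def)
  define m where "m s = (LINT x:{c..d}|lborel. f s x)" for s
  define e where "e s = (\<integral>\<^sup>+x\<in>{c..d}. E x s \<partial>lborel)" for s
  have cont: "continuous_on UNIV (f s)" for s
    unfolding f_def[abs_def]
    by (intro continuous_on_compose2[OF smooth_fun_continuous(1)[OF smooth]] continuous_intros) auto
  have poincare: "L2sq {c..d} (f s) \<le> ennreal (2 / \<delta> * (m s)\<^sup>2) + ennreal (2 * \<delta>\<^sup>2) * e s" for s
  proof -
    define g' where "g' x = fst (grad \<phi> ((x, 0) + s *\<^sub>R w))" for x
    have "(f s has_real_derivative g' x) (at x)" for x
      using smooth_fun_line_derivative[OF smooth, of "s *\<^sub>R w" "(1, 0)" x]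
      by (simp add: f_def[abs_def] g'_def add.commute inner_prod_def)
    moreover have "continuous_on UNIV g'"
      unfolding g'_def[abs_def]
      by (intro continuous_intros continuous_on_compose2[OF smooth_fun_continuous(2)[OF smooth]]) auto
    ultimately have "L2sq {c..d} (f s) \<le> ennreal (2 / (d - c) * (LINT t:{c..d}|lborel. f s t)\<^sup>2)
        + ennreal (2 * (d - c)\<^sup>2) * L2sq {c..d} g'"
      by (rule poincare_interval[OF assms])
    also have "L2sq {c..d} g' \<le> e s"
    proof -
      have "(norm (fst z))\<^sup>2 \<le> (norm z)\<^sup>2" for z :: "real \<times> real"
        by (cases z) (simp add: norm_Pair)
      then show ?thesis unfolding L2sq_def e_def E_def g'_def
        by (intro nn_integral_mono mult_right_mono ennreal_leI) auto
    qed
    finally show ?thesis by (simp add: m_def \<delta>_def mult_left_mono add_left_mono)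
  qed
  have means: "ennreal ((m s)\<^sup>2) \<le> ennreal (2 * (m 0)\<^sup>2) + ennreal (2 * \<delta>\<^sup>2) * A {c..d} \<delta>" if s: "0 < s" "s \<le> \<delta>" for s
  proof -
    have "m s - m 0 = (LINT x:{c..d}|lborel. f s x - f 0 x)"
      unfolding m_def
      by (intro set_integral_diff(2)[symmetric] borel_integrable_atLeastAtMost' continuous_on_subset[OF cont]) auto
    then have "ennreal ((m s - m 0)\<^sup>2) \<le> ennreal \<delta> * L2sq {c..d} (\<lambda>x. f s x - f 0 x)"
      using integral_sq_le_L2sq[of c d "\<lambda>x. f s x - f 0 x"] assms
      by (auto simp: \<delta>_def intro!: continuous_intros cont)
    also have "L2sq {c..d} (\<lambda>x. f s x - f 0 x) \<le> (\<integral>\<^sup>+x. ennreal \<delta> * ((\<integral>\<^sup>+t\<in>{0<..\<delta>}. E x t \<partial>lborel) * indicator {c..d} x) \<partial>lborel)"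
      unfolding L2sq_def using increment[OF s] by (intro nn_integral_mono) (auto simp: indicator_def)
    also have "\<dots> = ennreal \<delta> * A {c..d} \<delta>"
      unfolding A_def by (rule nn_integral_cmult) measurable
    finally have *: "ennreal ((m s - m 0)\<^sup>2) \<le> ennreal (\<delta>\<^sup>2) * A {c..d} \<delta>"
      using \<delta> by (simp add: mult_left_mono power2_eq_square ennreal_mult mult.assoc)
    have "ennreal ((m s)\<^sup>2) \<le> ennreal (2 * (m 0)\<^sup>2) + 2 * ennreal ((m s - m 0)\<^sup>2)"
      using ennreal_leI[OF sq_le_two_sq[of "m s" "m 0"]] by (simp add: ennreal_mult' ennreal_plus)
    also have "\<dots> \<le> ennreal (2 * (m 0)\<^sup>2) + 2 * (ennreal (\<delta>\<^sup>2) * A {c..d} \<delta>)"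
      by (intro add_left_mono mult_left_mono *) auto
    finally show ?thesis by (simp add: ennreal_mult' mult.assoc)
  qed
  have slice: "L2sq {c..d} (f s) \<le> ennreal (4 / \<delta> * (m 0)\<^sup>2) + ennreal (4 * \<delta>) * A {c..d} \<delta> + ennreal (2 * \<delta>\<^sup>2) * e s"
    if s: "0 < s" "s \<le> \<delta>" for s
  proof -
    have "ennreal (2 / \<delta> * (m s)\<^sup>2) = ennreal (2 / \<delta>) * ennreal ((m s)\<^sup>2)"
      by (subst ennreal_mult'[symmetric]) (use \<delta> in simp_all)
    also have "\<dots> \<le> ennreal (2 / \<delta>) * (ennreal (2 * (m 0)\<^sup>2) + ennreal (2 * \<delta>\<^sup>2) * A {c..d} \<delta>)"
      by (intro mult_left_mono means[OF s]) auto
    also have "\<dots> = ennreal (2 / \<delta> * (2 * (m 0)\<^sup>2)) + ennreal (2 / \<delta> * (2 * \<delta>\<^sup>2)) * A {c..d} \<delta>"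
      using \<delta> by (simp add: distrib_left mult.assoc[symmetric] ennreal_mult'[symmetric] del: times_divide_eq_left)
    also have "2 / \<delta> * (2 * (m 0)\<^sup>2) = 4 / \<delta> * (m 0)\<^sup>2" by simp
    also have "2 / \<delta> * (2 * \<delta>\<^sup>2) = 4 * \<delta>" using \<delta> by (simp add: power2_eq_square)
    finally show ?thesis using order_trans[OF poincare[of s] add_right_mono] by blast
  qed
  have [measurable]: "e \<in> borel_measurable borel" unfolding e_def[abs_def] by measurable
  have "(\<integral>\<^sup>+s\<in>{0<..\<delta>}. L2sq {c..d} (f s) \<partial>lborel)
      \<le> (\<integral>\<^sup>+s. (ennreal (4 / \<delta> * (m 0)\<^sup>2) + ennreal (4 * \<delta>) * A {c..d} \<delta>) * indicator {0<..\<delta>} s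
          + ennreal (2 * \<delta>\<^sup>2) * (e s * indicator {0<..\<delta>} s) \<partial>lborel)"
    using slice by (intro nn_integral_mono) (auto simp: indicator_def)
  also have "\<dots> = (ennreal (4 / \<delta> * (m 0)\<^sup>2) + ennreal (4 * \<delta>) * A {c..d} \<delta>) * ennreal \<delta>
      + ennreal (2 * \<delta>\<^sup>2) * (\<integral>\<^sup>+s\<in>{0<..\<delta>}. e s \<partial>lborel)"
    using \<delta> by (subst nn_integral_add) (simp_all add: nn_integral_cmult nn_integral_cmult_indicator)
  also have "(\<integral>\<^sup>+s\<in>{0<..\<delta>}. e s \<partial>lborel) = A {c..d} \<delta>"
    unfolding e_def by (rule A_swap[symmetric]) simp
  finally have strip: "(\<integral>\<^sup>+s\<in>{0<..\<delta>}. L2sq {c..d} (f s) \<partial>lborel)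
      \<le> (ennreal (4 / \<delta> * (m 0)\<^sup>2) + ennreal (4 * \<delta>) * A {c..d} \<delta>) * ennreal \<delta> + ennreal (2 * \<delta>\<^sup>2) * A {c..d} \<delta>" .
  have "ennreal \<delta> * L2sq {c..d} (f 0)
      \<le> 2 * (\<integral>\<^sup>+s\<in>{0<..\<delta>}. L2sq {c..d} (f s) \<partial>lborel) + ennreal (2 * \<delta>\<^sup>2) * A {c..d} \<delta>"
    by (rule strip_sq_le(1)[OF _ \<delta>]) simp
  also have "\<dots> \<le> 2 * ((ennreal (4 / \<delta> * (m 0)\<^sup>2) + ennreal (4 * \<delta>) * A {c..d} \<delta>) * ennreal \<delta> + ennreal (2 * \<delta>\<^sup>2) * A {c..d} \<delta>)
      + ennreal (2 * \<delta>\<^sup>2) * A {c..d} \<delta>"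
    by (rule add_right_mono, rule mult_left_mono[OF strip]) simp
  also have "\<dots> = ennreal \<delta> * (ennreal (8 / \<delta> * (m 0)\<^sup>2) + ennreal (14 * \<delta>) * A {c..d} \<delta>)"
  proof -
    \<comment> \<open>The factor 14 is 8 from comparing means between levels, 4 from the Poincare
      inequality on the levels and 2 from comparing level 0 with level \<open>s\<close>.\<close>
    have "2 * ((a + 4 * u * X) * u + 2 * u\<^sup>2 * X) + 2 * u\<^sup>2 * X = u * (2 * a + 14 * u * X)" for a u X :: ennreal
    proof -
      have "8 * y + 4 * y + 2 * y = 14 * y" for y :: ennreal by (simp flip: distrib_right)
      from this[of "u * (u * X)"] show ?thesis
        by (simp add: distrib_left distrib_right power2_eq_square mult.assoc mult.left_commute mult.commute add.assoc)
    qed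
    from this[of "ennreal (4 / \<delta> * (m 0)\<^sup>2)" "ennreal \<delta>" "A {c..d} \<delta>"]
    have "2 * ((ennreal (4 / \<delta> * (m 0)\<^sup>2) + ennreal (4 * \<delta>) * A {c..d} \<delta>) * ennreal \<delta> + ennreal (2 * \<delta>\<^sup>2) * A {c..d} \<delta>)
      + ennreal (2 * \<delta>\<^sup>2) * A {c..d} \<delta>
      = ennreal \<delta> * (2 * ennreal (4 / \<delta> * (m 0)\<^sup>2) + ennreal (14 * \<delta>) * A {c..d} \<delta>)"
      using \<delta> by (simp add: ennreal_mult' ennreal_power)
    also have "2 * ennreal (4 / \<delta> * (m 0)\<^sup>2) = ennreal (8 / \<delta> * (m 0)\<^sup>2)"
      using ennreal_mult'[of 2 "4 / \<delta> * (m 0)\<^sup>2"] by simp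
    finally show ?thesis .
  qed
  finally have "L2sq {c..d} (f 0) \<le> ennreal (8 / \<delta> * (m 0)\<^sup>2) + ennreal (14 * \<delta>) * A {c..d} \<delta>"
    using \<delta> by (subst (asm) ennreal_mult_le_mult_iff) auto
  then show ?thesis by (simp add: \<delta>_def m_def)
qed

end

section \<open>Poincare, trace and compactness estimates on the domain\<close>

lemma orthonormal_expansion_plane:
  fixes e n v :: "real \<times> real"
  assumes "norm e = 1" "norm n = 1" "e \<bullet> n = 0"
  shows "v = (v \<bullet> e) *\<^sub>R e + (v \<bullet> n) *\<^sub>R n"
proof -
  obtain a b c d x y where [simp]: "e = (a, b)" "n = (c, d)" "v = (x, y)" by (cases e, cases n, cases v)
  have eq: "a * a + b * b = 1" "c * c + d * d = 1" "a * c + b * d = 0"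
    using assms by (auto simp: norm_eq_1)
  \<comment> \<open>By Lagrange's identity the determinant of an orthonormal pair is 1 or -1, so
    \<open>n\<close> is a quarter turn of \<open>e\<close> up to sign.\<close>
  define D where "D = a * d - b * c"
  have "D * D = (a * a + b * b) * (c * c + d * d) - (a * c + b * d) * (a * c + b * d)"
    by (simp add: D_def algebra_simps)
  then have D: "D * D = 1" by (simp add: eq)
  have "c = c * (a * a + b * b) - a * (a * c + b * d)" "d = d * (a * a + b * b) - b * (a * c + b * d)"
    by (simp_all add: eq)
  then have cd: "c = - b * D" "d = a * D" by (simp_all add: D_def algebra_simps)
  have "c * c = b * b * (D * D)" "d * d = a * a * (D * D)" "c * d = - (a * b * (D * D))"
    by (simp_all add: cd)
  then have cc: "c * c = b * b" "d * d = a * a" "c * d = - (a * b)" by (simp_all add: D)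
  have "(x * a + y * b) * a + (x * c + y * d) * c = x * (a * a + c * c) + y * (a * b + c * d)"
    "(x * a + y * b) * b + (x * c + y * d) * d = x * (a * b + c * d) + y * (b * b + d * d)"
    by (simp_all add: algebra_simps)
  then show ?thesis using eq(1) by (simp add: cc add.commute)
qed

text \<open>Moving in the graph direction \<open>- n\<close> turns the weak inequality
  \<open>t \<le> \<phi> s\<close>, which holds on the closure by continuity of \<phi>, into the
  strict one that characterises \<Omega>. One direction and one length serve all nearby points of
  the closure, boundary points included.\<close>

lemma lipschitz_boundary_segment_property:
  assumes lip: "lipschitz_boundary \<Omega>" and p: "p \<in> frontier \<Omega>"
  shows "\<exists>w \<rho> \<tau>. norm w = 1 \<and> 0 < \<rho> \<and> 0 < \<tau> \<and>
    (\<forall>x\<in>closure \<Omega>. norm (x - p) < \<rho> \<longrightarrow> (\<forall>s. 0 < s \<and> s \<le> \<tau> \<longrightarrow> x + s *\<^sub>R w \<in> \<Omega>))"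
proof -
  obtain e n r h L \<phi> where en: "norm e = 1" "norm n = 1" "e \<bullet> n = 0" and rh: "0 < r" "0 < h"
    and \<phi>: "L-lipschitz_on {-r<..<r} \<phi>"
    and iff: "\<And>s t. \<bar>s\<bar> < r \<Longrightarrow> \<bar>t\<bar> < h \<Longrightarrow> p + s *\<^sub>R e + t *\<^sub>R n \<in> \<Omega> \<longleftrightarrow> t < \<phi> s"
    using lip p unfolding lipschitz_boundary_def by metis
  have expand: "p + ((x - p) \<bullet> e) *\<^sub>R e + ((x - p) \<bullet> n) *\<^sub>R n = x" for x
    using orthonormal_expansion_plane[OF en, of "x - p"] by (simp add: add.assoc)
  have coord: "\<bar>(x - p) \<bullet> e\<bar> \<le> norm (x - p)" "\<bar>(x - p) \<bullet> n\<bar> \<le> norm (x - p)" for x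
    using Cauchy_Schwarz_ineq2[of "x - p" e] Cauchy_Schwarz_ineq2[of "x - p" n] en by simp_all
  \<comment> \<open>Half of \<open>h\<close> for the position of \<open>x\<close> and half for the
    shift keep the shifted point inside the chart.\<close>
  define \<rho> where "\<rho> = min r (h / 2)"
  have "x + s *\<^sub>R (- n) \<in> \<Omega>" if x: "x \<in> closure \<Omega>" "norm (x - p) < \<rho>" and s: "0 < s" "s \<le> h / 2" for x s
  proof -
    define \<sigma> where "\<sigma> = (x - p) \<bullet> e"
    define \<theta> where "\<theta> = (x - p) \<bullet> n"
    have st: "\<bar>\<sigma>\<bar> < r" "\<bar>\<theta>\<bar> < h / 2" using coord[of x] x(2) by (auto simp: \<sigma>_def \<theta>_def \<rho>_def)
    obtain y where y: "\<And>k. y k \<in> \<Omega>" "y \<longlonglongrightarrow> x" using x(1) unfolding closure_sequential by blast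
    have lim: "(\<lambda>k. norm (y k - p)) \<longlonglongrightarrow> norm (x - p)" by (intro tendsto_intros y)
    have le: "\<forall>\<^sub>F k in sequentially. (y k - p) \<bullet> n \<le> \<phi> ((y k - p) \<bullet> e)"
      using order_tendstoD(2)[OF lim x(2)]
    proof eventually_elim
      fix k assume "norm (y k - p) < \<rho>"
      then have "\<bar>(y k - p) \<bullet> e\<bar> < r" "\<bar>(y k - p) \<bullet> n\<bar> < h"
        using coord[of "y k"] rh by (auto simp: \<rho>_def)
      from iff[OF this] show "(y k - p) \<bullet> n \<le> \<phi> ((y k - p) \<bullet> e)"
        using y(1)[of k] by (simp add: expand)
    qed
    have "continuous_on {-r<..<r} \<phi>" using \<phi> by (rule lipschitz_on_continuous_on)
    then have "isCont \<phi> \<sigma>" using st(1) by (simp add: continuous_on_eq_continuous_at abs_less_iff)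
    then have "(\<lambda>k. \<phi> ((y k - p) \<bullet> e)) \<longlonglongrightarrow> \<phi> \<sigma>"
      unfolding \<sigma>_def by (rule isCont_tendsto_compose) (intro tendsto_intros y)
    moreover have "(\<lambda>k. (y k - p) \<bullet> n) \<longlonglongrightarrow> \<theta>"
      unfolding \<theta>_def by (intro tendsto_intros y)
    ultimately have "\<theta> \<le> \<phi> \<sigma>" by (rule tendsto_le[OF sequentially_bot _ _ le])
    then have "p + \<sigma> *\<^sub>R e + (\<theta> - s) *\<^sub>R n \<in> \<Omega>"
      using st s by (subst iff) auto
    moreover have "p + \<sigma> *\<^sub>R e + (\<theta> - s) *\<^sub>R n = x + s *\<^sub>R (- n)"
      using expand[of x] by (simp add: \<sigma>_def \<theta>_def algebra_simps)
    ultimately show ?thesis by simp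
  qed
  then show ?thesis
    using en rh by (intro exI[of _ "- n"] exI[of _ \<rho>] exI[of _ "h / 2"]) (auto simp: \<rho>_def)
qed

context smooth_slanted
begin

lemma A_Icc_add:
  assumes "a \<le> b" "b \<le> c"
  shows "A {a..b} \<delta> + A {b..c} \<delta> = A {a..c} \<delta>"
proof -
  have "A {a..b} \<delta> + A {b..c} \<delta> = A {a<..b} \<delta> + A {b<..c} \<delta>"
    unfolding A_def nn_integral_Icc_eq_Ioc ..
  also have "\<dots> = (\<integral>\<^sup>+x. (\<integral>\<^sup>+t\<in>{0<..\<delta>}. E x t \<partial>lborel) * indicator {a<..b} x
      + (\<integral>\<^sup>+t\<in>{0<..\<delta>}. E x t \<partial>lborel) * indicator {b<..c} x \<partial>lborel)"
    unfolding A_def by (rule nn_integral_add[symmetric]) measurable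
  also have "\<dots> = A {a<..c} \<delta>"
    unfolding A_def using assms by (intro nn_integral_cong) (auto simp: indicator_def)
  also have "\<dots> = A {a..c} \<delta>"
    unfolding A_def nn_integral_Icc_eq_Ioc ..
  finally show ?thesis .
qed

text \<open>All cells use the same depth \<delta>, so their energies add up to that of one strip and
  no factor \<open>N\<close> appears.\<close>

lemma cells_estimate:
  assumes \<delta>: "0 < \<delta>"
  shows "L2sq {c..c + real N * \<delta>} (f 0)
    \<le> ennreal (8 / \<delta>) * (\<Sum>i<N. ennreal ((LINT x:{c + real i * \<delta>..c + real (Suc i) * \<delta>}|lborel. f 0 x)\<^sup>2))
      + ennreal (14 * \<delta>) * A {c..c + real N * \<delta>} \<delta>"
proof (induction N)
  case 0
  have "AE x in lborel. x \<noteq> c" by (rule AE_lborel_singleton)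
  then have "L2sq {c..c} (f 0) = (\<integral>\<^sup>+x. 0 \<partial>(lborel :: real measure))"
    unfolding L2sq_def by (intro nn_integral_cong_AE) (auto simp: indicator_def elim: eventually_mono)
  then show ?case by simp
next
  case (Suc N)
  define b where "b = c + real N * \<delta>"
  define d where "d = c + real (Suc N) * \<delta>"
  have bd: "d - b = \<delta>" "c \<le> b" "b \<le> d" "b < d" using \<delta> by (auto simp: b_def d_def algebra_simps)
  have "L2sq {c..d} (f 0) = L2sq ({c..b} \<union> {b..d}) (f 0)"
    using bd by (simp add: ivl_disj_un_two_touch)
  also have "\<dots> \<le> L2sq {c..b} (f 0) + L2sq {b..d} (f 0)"
    by (rule L2sq_Un) auto
  also have "\<dots> \<le> (ennreal (8 / \<delta>) * (\<Sum>i<N. ennreal ((LINT x:{c + real i * \<delta>..c + real (Suc i) * \<delta>}|lborel. f 0 x)\<^sup>2))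
      + ennreal (14 * \<delta>) * A {c..b} \<delta>)
      + (ennreal (8 / \<delta> * (LINT x:{b..d}|lborel. f 0 x)\<^sup>2) + ennreal (14 * \<delta>) * A {b..d} \<delta>)"
    using cell_estimate[OF bd(4)] bd(1) Suc.IH[folded b_def] by (intro add_mono) auto
  also have "ennreal (8 / \<delta> * (LINT x:{b..d}|lborel. f 0 x)\<^sup>2) = ennreal (8 / \<delta>) * ennreal ((LINT x:{b..d}|lborel. f 0 x)\<^sup>2)"
    by (rule ennreal_mult') (use \<delta> in auto)
  also have "(ennreal (8 / \<delta>) * (\<Sum>i<N. ennreal ((LINT x:{c + real i * \<delta>..c + real (Suc i) * \<delta>}|lborel. f 0 x)\<^sup>2))
      + ennreal (14 * \<delta>) * A {c..b} \<delta>)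
      + (ennreal (8 / \<delta>) * ennreal ((LINT x:{b..d}|lborel. f 0 x)\<^sup>2) + ennreal (14 * \<delta>) * A {b..d} \<delta>)
     = ennreal (8 / \<delta>) * (\<Sum>i<Suc N. ennreal ((LINT x:{c + real i * \<delta>..c + real (Suc i) * \<delta>}|lborel. f 0 x)\<^sup>2))
      + ennreal (14 * \<delta>) * A {c..d} \<delta>"
    unfolding A_Icc_add[OF bd(2,3), symmetric] sum.lessThan_Suc b_def[symmetric] d_def[symmetric]
    by (simp only: distrib_left ac_simps)
  finally show ?case unfolding d_def .
qed

end

section \<open>Geometry at the free boundary; trace and compactness inequalities\<close>

locale sloshing_domain =
  fixes \<Omega> B :: "(real \<times> real) set" and F :: "real set" and l :: real
  assumes admissible: "admissible_domain \<Omega> F B"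
    and l_pos: "0 < l" and F_lower: "{0<..<l} \<subseteq> F" and F_upper: "F \<subseteq> {0..l}"
    and john: "john_condition \<Omega> F"
begin

lemma domain: "open \<Omega>" "connected \<Omega>" "\<Omega> \<noteq> {}" "bounded \<Omega>" "lipschitz_boundary \<Omega>"
    "frontier \<Omega> = F \<times> {0} \<union> B" "B \<subseteq> {x. snd x < 0}"
  using admissible by (auto simp: admissible_domain_def)

lemma domain_borel [measurable]: "\<Omega> \<in> sets borel"
  using domain(1) by simp

text \<open>The frontier is closed, so it contains both end points; they cannot belong to
  \<open>B\<close>, which lies strictly below the axis.\<close>

lemma F_eq: "F = {0..l}"
proof -
  have "(x, 0) \<in> frontier \<Omega>" if x: "x \<in> {0..l}" for x
  proof -
    have "(x, 0::real) \<in> closure ((\<lambda>t. (t, 0)) ` {0<..<l})"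
    proof -
      have "(\<lambda>t. (t, 0::real)) ` closure {0<..<l} \<subseteq> closure ((\<lambda>t. (t, 0)) ` {0<..<l})"
        by (rule image_closure_subset) (auto intro!: continuous_intros closure_subset[THEN subsetD])
      then show ?thesis using x l_pos by auto
    qed
    moreover have "(\<lambda>t. (t, 0::real)) ` {0<..<l} \<subseteq> frontier \<Omega>" using F_lower domain(6) by auto
    ultimately show ?thesis
      using closure_minimal[OF _ frontier_closed] by blast
  qed
  then have "{0..l} \<subseteq> F" using domain(6,7) by fastforce
  then show ?thesis using F_upper by auto
qed

lemma domain_subset: "x \<in> \<Omega> \<Longrightarrow> 0 \<le> fst x \<and> fst x \<le> l \<and> snd x < 0"
  using john F_upper by (cases x) (force simp: john_condition_def)

lemma free_part_in_frontier: "x \<in> {0..l} \<Longrightarrow> (x, 0) \<in> frontier \<Omega>"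
  using domain(6) F_eq by auto

text \<open>The direction has to point strictly down, because by the John condition every point of
  \<Omega> has negative second coordinate. This transversality makes the slanted coordinates
  nondegenerate.\<close>

lemma free_part_segment:
  assumes "x \<in> {0..l}"
  obtains w \<rho> \<tau> where "norm w = 1" "0 < \<rho>" "0 < \<tau>" "snd w < 0"
    "\<And>y s. y \<in> {0..l} \<Longrightarrow> \<bar>y - x\<bar> < \<rho> \<Longrightarrow> 0 < s \<Longrightarrow> s \<le> \<tau> \<Longrightarrow> (y, 0) + s *\<^sub>R w \<in> \<Omega>"
proof -
  obtain w \<rho> \<tau> where w: "norm w = 1" "0 < \<rho>" "0 < \<tau>"
    and seg: "\<And>y s. y \<in> closure \<Omega> \<Longrightarrow> norm (y - (x, 0)) < \<rho> \<Longrightarrow> 0 < s \<Longrightarrow> s \<le> \<tau> \<Longrightarrow> y + s *\<^sub>R w \<in> \<Omega>"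
    using lipschitz_boundary_segment_property[OF domain(5) free_part_in_frontier[OF assms]] by blast
  have cl: "(y, 0) \<in> closure \<Omega>" if "y \<in> {0..l}" for y
    using free_part_in_frontier[OF that] by (simp add: frontier_def)
  have seg': "(y, 0) + s *\<^sub>R w \<in> \<Omega>" if "y \<in> {0..l}" "\<bar>y - x\<bar> < \<rho>" "0 < s" "s \<le> \<tau>" for y s
    using seg[OF cl[OF that(1)] _ that(3,4)] that(2) by (simp add: norm_Pair)
  have "snd ((x, 0) + \<tau> *\<^sub>R w) < 0"
    using domain_subset[OF seg'[OF assms, of \<tau>]] w by simp
  then have "snd w < 0" using w(3) by (simp add: mult_less_0_iff)
  then show ?thesis using that w seg' by blast
qed

text \<open>Averaging over a strip of depth \<delta> costs energy of order \<delta> and mass of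
  order 1/\<delta>, so a thin strip makes the gradient weight arbitrarily small. Bisection passes
  from short intervals, each with its own direction \<open>w\<close>, to all of
  \<open>F\<close>.\<close>

lemma trace_estimate:
  assumes \<epsilon>: "0 < \<epsilon>"
  shows "\<exists>C\<ge>0. \<forall>\<phi>. smooth_fun \<phi> \<longrightarrow>
    L2sq F (\<lambda>x. \<phi> (x, 0)) \<le> ennreal \<epsilon> * L2sq \<Omega> (grad \<phi>) + ennreal C * L2sq \<Omega> \<phi>"
proof -
  \<comment> \<open>Every \<epsilon> is quantified inside \<open>P\<close>, since joining two
    intervals uses the estimate on each with \<epsilon>/2.\<close>
  define P where "P c d \<longleftrightarrow> (0 \<le> c \<longrightarrow> d \<le> l \<longrightarrow> (\<forall>\<epsilon>>0. \<exists>C\<ge>0. \<forall>\<phi>. smooth_fun \<phi> \<longrightarrow>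
    L2sq {c..d} (\<lambda>x. \<phi> (x, 0)) \<le> ennreal \<epsilon> * L2sq \<Omega> (grad \<phi>) + ennreal C * L2sq \<Omega> \<phi>))" for c d
  have "P 0 l"
  proof (rule Bolzano)
    show "0 \<le> l" using l_pos by simp
  next
    fix a b c assume P: "P a b" "P b c" and abc: "a \<le> b" "b \<le> c"
    show "P a c"
      unfolding P_def
    proof (intro impI allI)
      fix \<epsilon> :: real assume ac: "0 \<le> a" "c \<le> l" and \<epsilon>: "0 < \<epsilon>"
      have "\<exists>C\<ge>0. \<forall>\<phi>. smooth_fun \<phi> \<longrightarrow>
          L2sq {a..b} (\<lambda>x. \<phi> (x, 0)) \<le> ennreal (\<epsilon> / 2) * L2sq \<Omega> (grad \<phi>) + ennreal C * L2sq \<Omega> \<phi>"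
        "\<exists>C\<ge>0. \<forall>\<phi>. smooth_fun \<phi> \<longrightarrow>
          L2sq {b..c} (\<lambda>x. \<phi> (x, 0)) \<le> ennreal (\<epsilon> / 2) * L2sq \<Omega> (grad \<phi>) + ennreal C * L2sq \<Omega> \<phi>"
        using P abc ac \<epsilon> unfolding P_def by auto
      then obtain C1 C2 where C: "0 \<le> C1" "0 \<le> C2" "\<And>\<phi>. smooth_fun \<phi> \<Longrightarrow>
          L2sq {a..b} (\<lambda>x. \<phi> (x, 0)) \<le> ennreal (\<epsilon> / 2) * L2sq \<Omega> (grad \<phi>) + ennreal C1 * L2sq \<Omega> \<phi>"
        "\<And>\<phi>. smooth_fun \<phi> \<Longrightarrow>
          L2sq {b..c} (\<lambda>x. \<phi> (x, 0)) \<le> ennreal (\<epsilon> / 2) * L2sq \<Omega> (grad \<phi>) + ennreal C2 * L2sq \<Omega> \<phi>"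
        by blast
      have "L2sq {a..c} (\<lambda>x. \<phi> (x, 0)) \<le> ennreal \<epsilon> * L2sq \<Omega> (grad \<phi>) + ennreal (C1 + C2) * L2sq \<Omega> \<phi>"
        if \<phi>: "smooth_fun \<phi>" for \<phi>
      proof -
        note [measurable] = smooth_fun_borel[OF \<phi>]
        have "L2sq {a..c} (\<lambda>x. \<phi> (x, 0)) = L2sq ({a..b} \<union> {b..c}) (\<lambda>x. \<phi> (x, 0))"
          using abc by (simp add: ivl_disj_un_two_touch)
        also have "\<dots> \<le> L2sq {a..b} (\<lambda>x. \<phi> (x, 0)) + L2sq {b..c} (\<lambda>x. \<phi> (x, 0))"
          by (rule L2sq_Un) auto
        also have "\<dots> \<le> (ennreal (\<epsilon> / 2) * L2sq \<Omega> (grad \<phi>) + ennreal C1 * L2sq \<Omega> \<phi>)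
            + (ennreal (\<epsilon> / 2) * L2sq \<Omega> (grad \<phi>) + ennreal C2 * L2sq \<Omega> \<phi>)"
          by (intro add_mono C \<phi>)
        also have "\<dots> = (ennreal (\<epsilon> / 2) + ennreal (\<epsilon> / 2)) * L2sq \<Omega> (grad \<phi>) + (ennreal C1 + ennreal C2) * L2sq \<Omega> \<phi>"
          by (simp only: distrib_right add_ac)
        also have "ennreal (\<epsilon> / 2) + ennreal (\<epsilon> / 2) = ennreal \<epsilon>"
          using \<epsilon> by (subst ennreal_plus[symmetric]) auto
        also have "ennreal C1 + ennreal C2 = ennreal (C1 + C2)"
          using C by simp
        finally show ?thesis .
      qed
      then show "\<exists>C\<ge>0. \<forall>\<phi>. smooth_fun \<phi> \<longrightarrow>
          L2sq {a..c} (\<lambda>x. \<phi> (x, 0)) \<le> ennreal \<epsilon> * L2sq \<Omega> (grad \<phi>) + ennreal C * L2sq \<Omega> \<phi>"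
        using C by (intro exI[of _ "C1 + C2"]) auto
    qed
  next
    fix x assume "0 \<le> x" "x \<le> l"
    then have x: "x \<in> {0..l}" by simp
    obtain w \<rho> \<tau> where w: "norm w = 1" "0 < \<rho>" "0 < \<tau>" "snd w < 0"
      and seg: "\<And>y s. y \<in> {0..l} \<Longrightarrow> \<bar>y - x\<bar> < \<rho> \<Longrightarrow> 0 < s \<Longrightarrow> s \<le> \<tau> \<Longrightarrow> (y, 0) + s *\<^sub>R w \<in> \<Omega>"
      using free_part_segment[OF x] by metis
    have "P a b" if ab: "a \<le> x" "x \<le> b" "b - a < \<rho>" for a b
      unfolding P_def
    proof (intro impI allI)
      fix \<epsilon> :: real assume ab': "0 \<le> a" "b \<le> l" and \<epsilon>: "0 < \<epsilon>"
      \<comment> \<open>Depth at most \<tau> keeps the strip in \<Omega>; the second bound absorbs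
        the factor \<open>2 / |snd w|\<close> in front of the energy.\<close>
      define \<delta> where "\<delta> = min \<tau> (\<epsilon> * \<bar>snd w\<bar> / 2)"
      have \<delta>: "0 < \<delta>" "\<delta> \<le> \<tau>" "2 * \<delta> / \<bar>snd w\<bar> \<le> \<epsilon>"
        using w \<epsilon> by (auto simp: \<delta>_def field_simps min_def mult_pos_neg)
      have sub: "(y, 0) + s *\<^sub>R w \<in> \<Omega>" if "y \<in> {a..b}" "0 < s" "s \<le> \<delta>" for y s
        using that ab ab' \<delta> by (intro seg) auto
      have "L2sq {a..b} (\<lambda>x. \<phi> (x, 0)) \<le> ennreal \<epsilon> * L2sq \<Omega> (grad \<phi>) + ennreal (2 / (\<delta> * \<bar>snd w\<bar>)) * L2sq \<Omega> \<phi>"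
        if \<phi>: "smooth_fun \<phi>" for \<phi>
      proof -
        interpret smooth_slanted \<phi> w by standard (use \<phi> w in auto)
        have "ennreal \<delta> * L2sq {a..b} (f 0) \<le> 2 * (\<integral>\<^sup>+s\<in>{0<..\<delta>}. L2sq {a..b} (f s) \<partial>lborel) + ennreal (2 * \<delta>\<^sup>2) * A {a..b} \<delta>"
          by (rule strip_sq_le(1)[OF _ \<delta>(1)]) simp
        also have "\<dots> \<le> 2 * (ennreal (1 / \<bar>snd w\<bar>) * L2sq \<Omega> \<phi>) + ennreal (2 * \<delta>\<^sup>2) * (ennreal (1 / \<bar>snd w\<bar>) * L2sq \<Omega> (grad \<phi>))"
        proof (intro add_mono mult_left_mono)
          show "(\<integral>\<^sup>+s\<in>{0<..\<delta>}. L2sq {a..b} (f s) \<partial>lborel) \<le> ennreal (1 / \<bar>snd w\<bar>) * L2sq \<Omega> \<phi>"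
            unfolding L2sq_def f_def by (rule slanted_le) (use sub w in auto)
          show "A {a..b} \<delta> \<le> ennreal (1 / \<bar>snd w\<bar>) * L2sq \<Omega> (grad \<phi>)"
            by (rule A_le) (use sub w in auto)
        qed auto
        also have "\<dots> = ennreal \<delta> * (ennreal (2 * \<delta> / \<bar>snd w\<bar>) * L2sq \<Omega> (grad \<phi>) + ennreal (2 / (\<delta> * \<bar>snd w\<bar>)) * L2sq \<Omega> \<phi>)"
        proof -
          have eq1: "2 * ennreal (1 / \<bar>snd w\<bar>) = ennreal \<delta> * ennreal (2 / (\<delta> * \<bar>snd w\<bar>))"
            using \<delta>(1) w(4) ennreal_mult'[of 2 "1 / \<bar>snd w\<bar>"] by (simp add: ennreal_mult'[symmetric])
          have eq2: "ennreal (2 * \<delta>\<^sup>2) * ennreal (1 / \<bar>snd w\<bar>) = ennreal \<delta> * ennreal (2 * \<delta> / \<bar>snd w\<bar>)"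
            using \<delta>(1) by (simp add: ennreal_mult'[symmetric] power2_eq_square ac_simps)
          show ?thesis
            unfolding mult.assoc[symmetric] eq1 eq2 by (simp only: distrib_left mult.assoc add.commute)
        qed
        finally have "L2sq {a..b} (f 0) \<le> ennreal (2 * \<delta> / \<bar>snd w\<bar>) * L2sq \<Omega> (grad \<phi>) + ennreal (2 / (\<delta> * \<bar>snd w\<bar>)) * L2sq \<Omega> \<phi>"
          using \<delta>(1) by (subst (asm) ennreal_mult_le_mult_iff) auto
        also have "\<dots> \<le> ennreal \<epsilon> * L2sq \<Omega> (grad \<phi>) + ennreal (2 / (\<delta> * \<bar>snd w\<bar>)) * L2sq \<Omega> \<phi>"
          by (intro add_right_mono mult_right_mono ennreal_leI \<delta>(3)) auto
        finally show ?thesis by (simp add: f_0)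
      qed
      then show "\<exists>C\<ge>0. \<forall>\<phi>. smooth_fun \<phi> \<longrightarrow>
          L2sq {a..b} (\<lambda>x. \<phi> (x, 0)) \<le> ennreal \<epsilon> * L2sq \<Omega> (grad \<phi>) + ennreal C * L2sq \<Omega> \<phi>"
        using \<delta>(1) by (intro exI[of _ "2 / (\<delta> * \<bar>snd w\<bar>)"]) auto
    qed
    then show "\<exists>d>0. \<forall>a b. a \<le> x \<and> x \<le> b \<and> b - a < d \<longrightarrow> P a b"
      using w(2) by blast
  qed
  then show ?thesis unfolding P_def F_eq using \<epsilon> l_pos by auto
qed

text \<open>Compactness of the trace in quantitative form: up to a small multiple of the energy, the
  boundary norm is controlled by finitely many linear functionals, the integrals over short cells.
  \<open>K\<close> and \<open>Q\<close> depend on \<epsilon> but not on the function.\<close>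

lemma compactness_estimate:
  assumes \<epsilon>: "0 < \<epsilon>"
  shows "\<exists>K\<ge>0. \<exists>Q. finite Q \<and> (\<forall>(c, d)\<in>Q. 0 \<le> c \<and> c \<le> d \<and> d \<le> l) \<and> (\<forall>\<phi>. smooth_fun \<phi> \<longrightarrow>
    L2sq F (\<lambda>x. \<phi> (x, 0)) \<le> ennreal \<epsilon> * L2sq \<Omega> (grad \<phi>)
      + ennreal K * (\<Sum>(c, d)\<in>Q. ennreal ((LINT x:{c..d}|lborel. \<phi> (x, 0))\<^sup>2)))"
proof -
  define G where "G Q \<phi> = (\<Sum>(c, d)\<in>Q. ennreal ((LINT x:{c..d}|lborel. \<phi> (x, 0::real))\<^sup>2))"
    for Q :: "(real \<times> real) set" and \<phi> :: "real \<times> real \<Rightarrow> real"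
  have G_mono: "G Q \<phi> \<le> G Q' \<phi>" if "Q \<subseteq> Q'" "finite Q'" for Q Q' \<phi>
    unfolding G_def using that by (intro sum_mono2) auto
  define P where "P c d \<longleftrightarrow> (0 \<le> c \<longrightarrow> d \<le> l \<longrightarrow> (\<forall>\<epsilon>>0. \<exists>K\<ge>0. \<exists>Q. finite Q \<and>
    (\<forall>(c, d)\<in>Q. 0 \<le> c \<and> c \<le> d \<and> d \<le> l) \<and> (\<forall>\<phi>. smooth_fun \<phi> \<longrightarrow>
    L2sq {c..d} (\<lambda>x. \<phi> (x, 0)) \<le> ennreal \<epsilon> * L2sq \<Omega> (grad \<phi>) + ennreal K * G Q \<phi>)))" for c d
  have "P 0 l"
  proof (rule Bolzano)
    show "0 \<le> l" using l_pos by simp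
  next
    fix a b c assume P: "P a b" "P b c" and abc: "a \<le> b" "b \<le> c"
    show "P a c"
      unfolding P_def
    proof (intro impI allI)
      fix \<epsilon> :: real assume ac: "0 \<le> a" "c \<le> l" and \<epsilon>: "0 < \<epsilon>"
      have ab: "b \<le> l" "0 \<le> b" "0 < \<epsilon> / 2" using abc ac \<epsilon> by auto
      obtain K1 Q1 where 1: "0 \<le> K1" "finite Q1" "\<forall>(c, d)\<in>Q1. 0 \<le> c \<and> c \<le> d \<and> d \<le> l"
        "\<And>\<phi>. smooth_fun \<phi> \<Longrightarrow> L2sq {a..b} (\<lambda>x. \<phi> (x, 0)) \<le> ennreal (\<epsilon> / 2) * L2sq \<Omega> (grad \<phi>) + ennreal K1 * G Q1 \<phi>"
        using P(1)[unfolded P_def, rule_format, OF ac(1) ab(1,3)] by blast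
      obtain K2 Q2 where 2: "0 \<le> K2" "finite Q2" "\<forall>(c, d)\<in>Q2. 0 \<le> c \<and> c \<le> d \<and> d \<le> l"
        "\<And>\<phi>. smooth_fun \<phi> \<Longrightarrow> L2sq {b..c} (\<lambda>x. \<phi> (x, 0)) \<le> ennreal (\<epsilon> / 2) * L2sq \<Omega> (grad \<phi>) + ennreal K2 * G Q2 \<phi>"
        using P(2)[unfolded P_def, rule_format, OF ab(2) ac(2) ab(3)] by blast
      have "L2sq {a..c} (\<lambda>x. \<phi> (x, 0)) \<le> ennreal \<epsilon> * L2sq \<Omega> (grad \<phi>) + ennreal (K1 + K2) * G (Q1 \<union> Q2) \<phi>"
        if \<phi>: "smooth_fun \<phi>" for \<phi>
      proof -
        note [measurable] = smooth_fun_borel[OF \<phi>]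
        have "L2sq {a..c} (\<lambda>x. \<phi> (x, 0)) = L2sq ({a..b} \<union> {b..c}) (\<lambda>x. \<phi> (x, 0))"
          using abc by (simp add: ivl_disj_un_two_touch)
        also have "\<dots> \<le> L2sq {a..b} (\<lambda>x. \<phi> (x, 0)) + L2sq {b..c} (\<lambda>x. \<phi> (x, 0))"
          by (rule L2sq_Un) auto
        also have "\<dots> \<le> (ennreal (\<epsilon> / 2) * L2sq \<Omega> (grad \<phi>) + ennreal K1 * G Q1 \<phi>)
            + (ennreal (\<epsilon> / 2) * L2sq \<Omega> (grad \<phi>) + ennreal K2 * G Q2 \<phi>)"
          by (intro add_mono 1 2 \<phi>)
        also have "\<dots> \<le> (ennreal (\<epsilon> / 2) * L2sq \<Omega> (grad \<phi>) + ennreal K1 * G (Q1 \<union> Q2) \<phi>)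
            + (ennreal (\<epsilon> / 2) * L2sq \<Omega> (grad \<phi>) + ennreal K2 * G (Q1 \<union> Q2) \<phi>)"
          using 1 2 by (intro add_mono order_refl mult_left_mono G_mono) auto
        also have "\<dots> = (ennreal (\<epsilon> / 2) + ennreal (\<epsilon> / 2)) * L2sq \<Omega> (grad \<phi>) + (ennreal K1 + ennreal K2) * G (Q1 \<union> Q2) \<phi>"
          by (simp only: distrib_right add_ac)
        also have "ennreal (\<epsilon> / 2) + ennreal (\<epsilon> / 2) = ennreal \<epsilon>"
          using \<epsilon> by (subst ennreal_plus[symmetric]) auto
        also have "ennreal K1 + ennreal K2 = ennreal (K1 + K2)"
          using 1 2 by simp
        finally show ?thesis .
      qed
      then show "\<exists>K\<ge>0. \<exists>Q. finite Q \<and> (\<forall>(c, d)\<in>Q. 0 \<le> c \<and> c \<le> d \<and> d \<le> l) \<and> (\<forall>\<phi>. smooth_fun \<phi> \<longrightarrow>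
          L2sq {a..c} (\<lambda>x. \<phi> (x, 0)) \<le> ennreal \<epsilon> * L2sq \<Omega> (grad \<phi>) + ennreal K * G Q \<phi>)"
        using 1 2 by (intro exI[of _ "K1 + K2"] conjI exI[of _ "Q1 \<union> Q2"]) auto
    qed
  next
    fix x assume "0 \<le> x" "x \<le> l"
    then have x: "x \<in> {0..l}" by simp
    obtain w \<rho> \<tau> where w: "norm w = 1" "0 < \<rho>" "0 < \<tau>" "snd w < 0"
      and seg: "\<And>y s. y \<in> {0..l} \<Longrightarrow> \<bar>y - x\<bar> < \<rho> \<Longrightarrow> 0 < s \<Longrightarrow> s \<le> \<tau> \<Longrightarrow> (y, 0) + s *\<^sub>R w \<in> \<Omega>"
      using free_part_segment[OF x] by metis
    have "P a b" if ab: "a \<le> x" "x \<le> b" "b - a < \<rho>" for a b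
      unfolding P_def
    proof (intro impI allI)
      fix \<epsilon> :: real assume ab': "0 \<le> a" "b \<le> l" and \<epsilon>: "0 < \<epsilon>"
      \<comment> \<open>The 14 is the energy constant of the cell estimate.\<close>
      define \<eta> where "\<eta> = min \<tau> (\<epsilon> * \<bar>snd w\<bar> / 14)"
      have \<eta>: "0 < \<eta>" using w \<epsilon> by (auto simp: \<eta>_def mult_pos_neg)
      show "\<exists>K\<ge>0. \<exists>Q. finite Q \<and> (\<forall>(c, d)\<in>Q. 0 \<le> c \<and> c \<le> d \<and> d \<le> l) \<and> (\<forall>\<phi>. smooth_fun \<phi> \<longrightarrow>
          L2sq {a..b} (\<lambda>x. \<phi> (x, 0)) \<le> ennreal \<epsilon> * L2sq \<Omega> (grad \<phi>) + ennreal K * G Q \<phi>)"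
      proof -
        obtain N :: nat where N: "(b - a) / \<eta> < real N" using reals_Archimedean2 by blast
        \<comment> \<open>Equal cells of width at most \<eta>. Bisection also offers the degenerate
          interval \<open>a = b\<close>, which is covered by zero cells.\<close>
        define \<delta> where "\<delta> = (if a = b then \<eta> else (b - a) / real N)"
        define M where "M = (if a = b then 0 else N)"
        have ab_le: "a \<le> b" using ab by simp
        have N0: "0 < N" using N \<eta> ab_le by (cases N) (auto simp: field_simps)
        have \<delta>0: "0 < \<delta>" using ab_le \<eta> N0 by (auto simp: \<delta>_def)
        have b_eq: "b = a + real M * \<delta>" using N0 by (auto simp: M_def \<delta>_def)
        have "(b - a) / real N \<le> \<eta>" using N N0 \<eta> by (simp add: field_simps)
        then have "\<delta> \<le> \<eta>" by (simp add: \<delta>_def)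
        then have \<delta>: "\<delta> \<le> \<tau>" "14 * \<delta> / \<bar>snd w\<bar> \<le> \<epsilon>"
          using w(4) by (auto simp: \<eta>_def field_simps)
        have sub: "(y, 0) + s *\<^sub>R w \<in> \<Omega>" if "y \<in> {a..b}" "0 < s" "s \<le> \<delta>" for y s
          using that ab ab' \<delta> by (intro seg) auto
        define Q where "Q = (\<lambda>i. (a + real i * \<delta>, a + real (Suc i) * \<delta>)) ` {..<M}"
        have inj: "inj_on (\<lambda>i. (a + real i * \<delta>, a + real (Suc i) * \<delta>)) {..<M}"
          using \<delta>0 by (auto simp: inj_on_def)
        have "0 \<le> c \<and> c \<le> d \<and> d \<le> l" if cd: "(c, d) \<in> Q" for c d
        proof -
          obtain i where i: "i < M" "c = a + real i * \<delta>" "d = a + real (Suc i) * \<delta>"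
            using cd unfolding Q_def by blast
          have "real (Suc i) * \<delta> \<le> real M * \<delta>" using i(1) \<delta>0 by (intro mult_right_mono) auto
          then show ?thesis using ab' \<delta>0 i(2,3) b_eq by (auto simp: distrib_right)
        qed
        moreover have "L2sq {a..b} (\<lambda>x. \<phi> (x, 0)) \<le> ennreal \<epsilon> * L2sq \<Omega> (grad \<phi>) + ennreal (8 / \<delta>) * G Q \<phi>"
          if \<phi>: "smooth_fun \<phi>" for \<phi>
        proof -
          interpret smooth_slanted \<phi> w by standard (use \<phi> w in auto)
          have "L2sq {a..b} (f 0) \<le> ennreal (8 / \<delta>) * G Q \<phi> + ennreal (14 * \<delta>) * A {a..b} \<delta>"
            using cells_estimate[OF \<delta>0, of a M] unfolding b_eq[symmetric] G_def Q_def
            by (simp add: sum.reindex[OF inj] f_0 del: of_nat_Suc)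
          also have "\<dots> \<le> ennreal (8 / \<delta>) * G Q \<phi> + ennreal (14 * \<delta>) * (ennreal (1 / \<bar>snd w\<bar>) * L2sq \<Omega> (grad \<phi>))"
            by (intro add_left_mono mult_left_mono A_le) (use sub w in auto)
          also have "ennreal (14 * \<delta>) * (ennreal (1 / \<bar>snd w\<bar>) * L2sq \<Omega> (grad \<phi>)) = ennreal (14 * \<delta> / \<bar>snd w\<bar>) * L2sq \<Omega> (grad \<phi>)"
            using \<delta>0 by (simp add: mult.assoc[symmetric] ennreal_mult'[symmetric])
          also have "ennreal (8 / \<delta>) * G Q \<phi> + ennreal (14 * \<delta> / \<bar>snd w\<bar>) * L2sq \<Omega> (grad \<phi>)
              \<le> ennreal (8 / \<delta>) * G Q \<phi> + ennreal \<epsilon> * L2sq \<Omega> (grad \<phi>)"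
            by (intro add_left_mono mult_right_mono ennreal_leI \<delta>(2)) auto
          finally show ?thesis by (simp add: f_0 add.commute)
        qed
        moreover have "finite Q" by (simp add: Q_def)
        ultimately show ?thesis
          using \<delta>0 by (intro exI[of _ "8 / \<delta>"] conjI exI[of _ Q]) auto
      qed
    qed
    then show "\<exists>d>0. \<forall>a b. a \<le> x \<and> x \<le> b \<and> b - a < d \<longrightarrow> P a b"
      using w(2) by blast
  qed
  then show ?thesis unfolding P_def F_eq G_def using \<epsilon> l_pos by auto
qed

end

section \<open>Poincare inequality by propagation along segments\<close>

context sloshing_domain
begin

text \<open>The right-hand side always refers to all of \<Omega> and \<open>F\<close>, so the
  property can be handed from one set to another at the price of a larger constant.\<close>

definition controlled :: "(real \<times> real) set \<Rightarrow> bool" where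
  "controlled S \<longleftrightarrow> (\<exists>C\<ge>0. \<forall>\<phi>. smooth_fun \<phi> \<longrightarrow>
    L2sq S \<phi> \<le> ennreal C * (L2sq \<Omega> (grad \<phi>) + L2sq F (\<lambda>x. \<phi> (x, 0))))"

lemma controlled_subset: "controlled T \<Longrightarrow> S \<subseteq> T \<Longrightarrow> controlled S"
  unfolding controlled_def by (meson L2sq_mono order_trans)

lemma controlled_Un:
  assumes "controlled S" "controlled T" and [measurable]: "S \<in> sets borel" "T \<in> sets borel"
  shows "controlled (S \<union> T)"
proof -
  obtain C1 C2 where C: "0 \<le> C1" "0 \<le> C2"
    "\<And>\<phi>. smooth_fun \<phi> \<Longrightarrow> L2sq S \<phi> \<le> ennreal C1 * (L2sq \<Omega> (grad \<phi>) + L2sq F (\<lambda>x. \<phi> (x, 0)))"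
    "\<And>\<phi>. smooth_fun \<phi> \<Longrightarrow> L2sq T \<phi> \<le> ennreal C2 * (L2sq \<Omega> (grad \<phi>) + L2sq F (\<lambda>x. \<phi> (x, 0)))"
    using assms(1,2) unfolding controlled_def by blast
  have "L2sq (S \<union> T) \<phi> \<le> ennreal (C1 + C2) * (L2sq \<Omega> (grad \<phi>) + L2sq F (\<lambda>x. \<phi> (x, 0)))"
    if \<phi>: "smooth_fun \<phi>" for \<phi>
  proof -
    note [measurable] = smooth_fun_borel[OF \<phi>]
    have "L2sq (S \<union> T) \<phi> \<le> L2sq S \<phi> + L2sq T \<phi>" by (rule L2sq_Un) auto
    also have "\<dots> \<le> ennreal C1 * (L2sq \<Omega> (grad \<phi>) + L2sq F (\<lambda>x. \<phi> (x, 0)))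
        + ennreal C2 * (L2sq \<Omega> (grad \<phi>) + L2sq F (\<lambda>x. \<phi> (x, 0)))"
      by (intro add_mono C \<phi>)
    also have "\<dots> = ennreal (C1 + C2) * (L2sq \<Omega> (grad \<phi>) + L2sq F (\<lambda>x. \<phi> (x, 0)))"
      using C by (simp only: distrib_right[symmetric] ennreal_plus)
    finally show ?thesis .
  qed
  then show ?thesis unfolding controlled_def using C by (intro exI[of _ "C1 + C2"]) auto
qed

text \<open>The value at \<open>x\<close> is the value at \<open>x + v\<close> up to an increment
  along a segment in \<Omega>, and that increment is bounded by the energy alone.\<close>

lemma controlled_translate:
  assumes "controlled T" and [measurable]: "S \<in> sets borel" "T \<in> sets borel"
    and sub: "\<And>x t. x \<in> S \<Longrightarrow> 0 < t \<Longrightarrow> t \<le> 1 \<Longrightarrow> x + t *\<^sub>R v \<in> \<Omega>"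
    and ST: "\<And>x. x \<in> S \<Longrightarrow> x + v \<in> T"
  shows "controlled S"
proof -
  obtain C where C: "0 \<le> C"
    "\<And>\<phi>. smooth_fun \<phi> \<Longrightarrow> L2sq T \<phi> \<le> ennreal C * (L2sq \<Omega> (grad \<phi>) + L2sq F (\<lambda>x. \<phi> (x, 0)))"
    using assms(1) unfolding controlled_def by blast
  have "L2sq S \<phi> \<le> ennreal (2 * C + 2 * (norm v)\<^sup>2) * (L2sq \<Omega> (grad \<phi>) + L2sq F (\<lambda>x. \<phi> (x, 0)))"
    if \<phi>: "smooth_fun \<phi>" for \<phi>
  proof -
    note [measurable] = smooth_fun_borel[OF \<phi>]
    let ?X = "L2sq \<Omega> (grad \<phi>) + L2sq F (\<lambda>x. \<phi> (x, 0))"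
    have "L2sq S \<phi> \<le> (\<integral>\<^sup>+x. 2 * (ennreal ((norm (\<phi> (x + v)))\<^sup>2) * indicator T (x + v))
        + 2 * (ennreal ((norm (\<phi> (x + v) - \<phi> x))\<^sup>2) * indicator S x) \<partial>lborel)"
      unfolding L2sq_def
    proof (rule nn_integral_mono)
      fix x
      have "(\<phi> x)\<^sup>2 \<le> 2 * (\<phi> (x + v))\<^sup>2 + 2 * (\<phi> (x + v) - \<phi> x)\<^sup>2"
        using sq_le_two_sq[of "\<phi> x" "\<phi> (x + v)"] by (simp add: power2_commute)
      from ennreal_leI[OF this]
      have "ennreal ((\<phi> x)\<^sup>2) \<le> 2 * ennreal ((\<phi> (x + v))\<^sup>2) + 2 * ennreal ((\<phi> (x + v) - \<phi> x)\<^sup>2)"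
        by (simp add: ennreal_mult' ennreal_plus)
      then show "ennreal ((norm (\<phi> x))\<^sup>2) * indicator S x
          \<le> 2 * (ennreal ((norm (\<phi> (x + v)))\<^sup>2) * indicator T (x + v))
            + 2 * (ennreal ((norm (\<phi> (x + v) - \<phi> x))\<^sup>2) * indicator S x)"
        using ST[of x] by (simp add: indicator_def)
    qed
    also have "\<dots> = 2 * (\<integral>\<^sup>+x. ennreal ((norm (\<phi> (x + v)))\<^sup>2) * indicator T (x + v) \<partial>lborel)
        + 2 * L2sq S (\<lambda>x. \<phi> (x + v) - \<phi> x)"
      unfolding L2sq_def by (subst nn_integral_add) (simp_all add: nn_integral_cmult)
    also have "(\<integral>\<^sup>+x. ennreal ((norm (\<phi> (x + v)))\<^sup>2) * indicator T (x + v) \<partial>lborel) = L2sq T \<phi>"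
      unfolding L2sq_def
      by (rule nn_integral_lborel_translate[where f = "\<lambda>x. ennreal ((norm (\<phi> x))\<^sup>2) * indicator T x"]) measurable
    also have "2 * L2sq T \<phi> + 2 * L2sq S (\<lambda>x. \<phi> (x + v) - \<phi> x)
        \<le> 2 * (ennreal C * ?X) + 2 * (ennreal ((norm v)\<^sup>2) * ?X)"
    proof (intro add_mono mult_left_mono C \<phi>)
      have "L2sq S (\<lambda>x. \<phi> (x + v) - \<phi> x) \<le> ennreal ((norm v)\<^sup>2) * L2sq \<Omega> (grad \<phi>)"
        by (rule translate_increment_L2sq_le[OF \<phi>]) (use sub in auto)
      also have "\<dots> \<le> ennreal ((norm v)\<^sup>2) * ?X" by (intro mult_left_mono) auto
      finally show "L2sq S (\<lambda>x. \<phi> (x + v) - \<phi> x) \<le> ennreal ((norm v)\<^sup>2) * ?X" .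
    qed auto
    also have "\<dots> = ennreal (2 * C + 2 * (norm v)\<^sup>2) * ?X"
      using C(1) by (simp only: distrib_right mult.assoc ennreal_plus ennreal_mult' ennreal_numeral
          mult_nonneg_nonneg zero_le_numeral zero_le_power2)
    finally show ?thesis .
  qed
  then show ?thesis
    unfolding controlled_def using C(1) by (intro exI[of _ "2 * C + 2 * (norm v)\<^sup>2"]) auto
qed

text \<open>A finite subcover and finite unions. Intersecting with \<open>W\<close> serves boundary
  points, near which only the part inside \<Omega> is controlled.\<close>

lemma controlled_compact:
  assumes "compact K" and W: "W \<in> sets borel"
    and cover: "\<And>x. x \<in> K \<Longrightarrow> \<exists>U. open U \<and> x \<in> U \<and> controlled (U \<inter> W)"
  shows "\<exists>U. open U \<and> K \<subseteq> U \<and> controlled (U \<inter> W)"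
proof -
  obtain U where U: "\<And>x. x \<in> K \<Longrightarrow> open (U x) \<and> x \<in> U x \<and> controlled (U x \<inter> W)"
    using cover by metis
  obtain D where D: "D \<subseteq> K" "finite D" "K \<subseteq> (\<Union>x\<in>D. U x)"
    using compactE_image[OF \<open>compact K\<close>, of K U] U by blast
  have "controlled ((\<Union>x\<in>D. U x) \<inter> W)"
    using D(2,1)
  proof (induction D rule: finite_induct)
    case empty
    show ?case by (auto simp: controlled_def L2sq_def)
  next
    case (insert x D)
    have "controlled ((U x \<inter> W) \<union> ((\<Union>x\<in>D. U x) \<inter> W))"
      using insert U W by (intro controlled_Un sets.Int borel_open[OF open_UN]) auto
    moreover have "(U x \<inter> W) \<union> ((\<Union>x\<in>D. U x) \<inter> W) = (\<Union>x\<in>insert x D. U x) \<inter> W" by auto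
    ultimately show ?case by simp
  qed
  moreover have "open (\<Union>x\<in>D. U x)" using U D(1) by blast
  ultimately show ?thesis using D(3) by blast
qed

text \<open>Seed of the propagation: below the middle of \<open>F\<close>, interior values are
  bounded by the trace and the energy.\<close>

lemma controlled_open_exists:
  "\<exists>z U. z \<in> \<Omega> \<and> open U \<and> z \<in> U \<and> controlled U"
proof -
  have mid: "l / 2 \<in> {0..l}" using l_pos by simp
  obtain w \<rho> \<tau> where w: "norm w = 1" "0 < \<rho>" "0 < \<tau>" "snd w < 0"
    and seg: "\<And>y s. y \<in> {0..l} \<Longrightarrow> \<bar>y - l / 2\<bar> < \<rho> \<Longrightarrow> 0 < s \<Longrightarrow> s \<le> \<tau> \<Longrightarrow> (y, 0) + s *\<^sub>R w \<in> \<Omega>"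
    using free_part_segment[OF mid] by metis
  define r where "r = min \<rho> (l / 2)"
  have r: "0 < r" "r \<le> \<rho>" "r \<le> l / 2" using w l_pos by (auto simp: r_def)
  define J where "J = {l / 2 - r<..<l / 2 + r}"
  have JF: "J \<subseteq> F" using r by (auto simp: J_def F_eq)
  have sub: "(y, 0) + s *\<^sub>R w \<in> \<Omega>" if "y \<in> J" "0 < s" "s \<le> \<tau>" for y s
    using that r by (intro seg) (auto simp: J_def)
  \<comment> \<open>\<open>Q\<close> is the half-open region of the slanted integral formula;
    \<open>U\<close> is its open counterpart, which serves as a neighbourhood.\<close>
  define Q where "Q = {z :: real \<times> real. fst z - snd z / snd w * fst w \<in> J \<and> snd z / snd w \<in> {0<..\<tau>}}"
  define U where "U = {z :: real \<times> real. fst z - snd z / snd w * fst w \<in> J \<and> snd z / snd w \<in> {0<..<\<tau>}}"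
  have "L2sq Q \<phi> \<le> ennreal (\<bar>snd w\<bar> * (2 * \<tau>) + 2 * \<tau>\<^sup>2) * (L2sq \<Omega> (grad \<phi>) + L2sq F (\<lambda>x. \<phi> (x, 0)))"
    if \<phi>: "smooth_fun \<phi>" for \<phi>
  proof -
    interpret smooth_slanted \<phi> w by standard (use \<phi> w in auto)
    let ?X = "L2sq \<Omega> (grad \<phi>) + L2sq F (\<lambda>x. \<phi> (x, 0))"
    have "(\<integral>\<^sup>+s\<in>{0<..\<tau>}. L2sq J (f s) \<partial>lborel) = ennreal (1 / \<bar>snd w\<bar>) * L2sq Q \<phi>"
      unfolding L2sq_def f_def Q_def by (rule slanted_eq) (use w in \<open>auto simp: J_def\<close>)
    then have "ennreal \<bar>snd w\<bar> * (\<integral>\<^sup>+s\<in>{0<..\<tau>}. L2sq J (f s) \<partial>lborel) = L2sq Q \<phi>"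
      using w(4) by (simp add: mult.assoc[symmetric] ennreal_mult'[symmetric])
    then have "L2sq Q \<phi> = ennreal \<bar>snd w\<bar> * (\<integral>\<^sup>+s\<in>{0<..\<tau>}. L2sq J (f s) \<partial>lborel)" ..
    also have "\<dots> \<le> ennreal \<bar>snd w\<bar> * (ennreal (2 * \<tau>) * L2sq J (f 0) + ennreal (2 * \<tau>\<^sup>2) * A J \<tau>)"
      by (rule mult_left_mono[OF strip_sq_le(2)[OF _ w(3)]]) (auto simp: J_def)
    also have "\<dots> \<le> ennreal \<bar>snd w\<bar> * (ennreal (2 * \<tau>) * ?X + ennreal (2 * \<tau>\<^sup>2) * (ennreal (1 / \<bar>snd w\<bar>) * ?X))"
    proof (intro mult_left_mono add_mono)
      show "L2sq J (f 0) \<le> ?X"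
        unfolding f_0 using L2sq_mono[OF JF, of "\<lambda>x. \<phi> (x, 0)"] by (rule order_trans) simp
      have "A J \<tau> \<le> ennreal (1 / \<bar>snd w\<bar>) * L2sq \<Omega> (grad \<phi>)"
        by (rule A_le) (use sub w in \<open>auto simp: J_def\<close>)
      also have "\<dots> \<le> ennreal (1 / \<bar>snd w\<bar>) * ?X" by (intro mult_left_mono) auto
      finally show "A J \<tau> \<le> ennreal (1 / \<bar>snd w\<bar>) * ?X" .
    qed auto
    also have "\<dots> = (ennreal (\<bar>snd w\<bar> * (2 * \<tau>)) + ennreal (\<bar>snd w\<bar> * (2 * \<tau>\<^sup>2 * (1 / \<bar>snd w\<bar>)))) * ?X"
      using w(3) by (simp only: distrib_left[of "ennreal \<bar>snd w\<bar>"] distrib_right[of _ _ ?X]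
          mult.assoc ennreal_mult' abs_ge_zero mult_nonneg_nonneg zero_le_numeral zero_le_power2)
    also have "\<bar>snd w\<bar> * (2 * \<tau>\<^sup>2 * (1 / \<bar>snd w\<bar>)) = 2 * \<tau>\<^sup>2" using w(4) by simp
    also have "ennreal (\<bar>snd w\<bar> * (2 * \<tau>)) + ennreal (2 * \<tau>\<^sup>2) = ennreal (\<bar>snd w\<bar> * (2 * \<tau>) + 2 * \<tau>\<^sup>2)"
      using w(3) by (intro ennreal_plus[symmetric]) auto
    finally show ?thesis .
  qed
  moreover have "0 \<le> \<bar>snd w\<bar> * (2 * \<tau>) + 2 * \<tau>\<^sup>2"
    using w(3) by (intro add_nonneg_nonneg mult_nonneg_nonneg) auto
  ultimately have "controlled Q" unfolding controlled_def by blast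
  then have "controlled U" by (rule controlled_subset) (auto simp: U_def Q_def)
  moreover have "open U"
  proof -
    have "U = (\<lambda>z. fst z - snd z / snd w * fst w) -` J \<inter> (\<lambda>z. snd z / snd w) -` {0<..<\<tau>}"
      by (auto simp: U_def)
    then show ?thesis
      using w(4) by (auto simp: J_def intro!: open_Int open_vimage continuous_intros)
  qed
  moreover have "(l / 2, 0) + (\<tau> / 2) *\<^sub>R w \<in> U" using w r by (auto simp: U_def J_def)
  moreover have "(l / 2, 0) + (\<tau> / 2) *\<^sub>R w \<in> \<Omega>"
    using w r by (intro sub) (auto simp: J_def)
  ultimately show ?thesis by blast
qed

text \<open>Being the centre of a controlled ball is a locally constant property: inside a ball
  contained in \<Omega>, a small ball around one point can be translated to any other along segments
  that stay in the convex big ball. Connectedness does the rest.\<close>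

lemma controlled_ball:
  assumes "z \<in> \<Omega>"
  shows "\<exists>r>0. controlled (ball z r)"
proof -
  obtain a U where a: "a \<in> \<Omega>" "open U" "a \<in> U" "controlled U" using controlled_open_exists by blast
  show ?thesis
  proof (rule connected_induction_simple[OF domain(2), where P = "\<lambda>z. \<exists>r>0. controlled (ball z r)"])
    show "\<exists>r>0. controlled (ball a r)"
      using a openE[of U a] controlled_subset by metis
    show "a \<in> \<Omega>" "z \<in> \<Omega>" by fact+
    fix c assume "c \<in> \<Omega>"
    then obtain R where R: "0 < R" "ball c R \<subseteq> \<Omega>" using domain(1) openE by blast
    have "\<exists>r>0. controlled (ball y r)"
      if x: "x \<in> ball c R" and y: "y \<in> ball c R" and cx: "\<exists>r>0. controlled (ball x r)" for x y
    proof -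
      obtain r where r: "0 < r" "controlled (ball x r)" using cx by blast
      \<comment> \<open>Small enough for the balls around \<open>x\<close> and \<open>y\<close> to
        stay in \<open>ball c R\<close> and for the translate to fall into
        \<open>ball x r\<close>.\<close>
      define r' where "r' = min r (min (R - dist c x) (R - dist c y))"
      have r': "0 < r'" "r' \<le> r" "r' \<le> R - dist c x" "r' \<le> R - dist c y"
        using r x y by (auto simp: r'_def)
      have "controlled (ball y r')"
      proof (rule controlled_translate[OF r(2), where v = "x - y"])
        fix u assume u: "u \<in> ball y r'"
        have ux: "dist x (u + (x - y)) = dist y u" by (simp add: dist_norm algebra_simps)
        show "u + (x - y) \<in> ball x r" using u r'(2) ux by simp
        have "dist c u < R" using dist_triangle[of c u y] u r'(4) by simp
        moreover have "dist c (u + (x - y)) < R"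
          using dist_triangle[of c "u + (x - y)" x] ux u r'(3) by simp
        ultimately have uR: "u \<in> ball c R" "u + (x - y) \<in> ball c R" by auto
        fix t :: real assume t: "0 < t" "t \<le> 1"
        have "(1 - t) *\<^sub>R u + t *\<^sub>R (u + (x - y)) \<in> ball c R"
          by (rule convexD[OF convex_ball uR]) (use t in auto)
        moreover have "(1 - t) *\<^sub>R u + t *\<^sub>R (u + (x - y)) = u + t *\<^sub>R (x - y)"
          by (simp add: algebra_simps)
        ultimately show "u + t *\<^sub>R (x - y) \<in> \<Omega>" using R(2) by auto
      qed auto
      then show ?thesis using r'(1) by blast
    qed
    then have step: "\<forall>x\<in>ball c R. \<forall>y\<in>ball c R. (\<exists>r>0. controlled (ball x r)) \<longrightarrow> (\<exists>r>0. controlled (ball y r))"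
      by (intro ballI impI)
    have "openin (top_of_set \<Omega>) (ball c R)" using R(2) by (simp add: open_subset)
    with step R(1) show "\<exists>T. openin (top_of_set \<Omega>) T \<and> c \<in> T \<and>
        (\<forall>x\<in>T. \<forall>y\<in>T. (\<exists>r>0. controlled (ball x r)) \<longrightarrow> (\<exists>r>0. controlled (ball y r)))"
      by (intro exI[of _ "ball c R"] conjI) simp_all
  qed
qed

text \<open>Interior points have controlled balls. Near a boundary point, the shift by
  \<open>\<tau> *\<^sub>R w\<close> sends the closure into a compact subset of \<Omega>, which has a
  controlled neighbourhood, and translation brings the estimate back up to the boundary. Compactness
  of the closure leaves finitely many constants.\<close>

theorem poincare_estimate:
  "\<exists>C\<ge>0. \<forall>\<phi>. smooth_fun \<phi> \<longrightarrow>
    L2sq \<Omega> \<phi> \<le> ennreal C * (L2sq \<Omega> (grad \<phi>) + L2sq F (\<lambda>x. \<phi> (x, 0)))"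
proof -
  have "\<exists>U. open U \<and> x \<in> U \<and> controlled (U \<inter> \<Omega>)" if x: "x \<in> closure \<Omega>" for x
  proof (cases "x \<in> \<Omega>")
    case True
    then obtain r where "0 < r" "controlled (ball x r)" using controlled_ball by blast
    then show ?thesis by (intro exI[of _ "ball x r"]) (auto intro: controlled_subset)
  next
    case False
    then have "x \<in> frontier \<Omega>" using x domain(1) by (simp add: frontier_def interior_open)
    then obtain w \<rho> \<tau> where w: "norm w = 1" "0 < \<rho>" "0 < \<tau>"
      and seg: "\<And>y s. y \<in> closure \<Omega> \<Longrightarrow> norm (y - x) < \<rho> \<Longrightarrow> 0 < s \<Longrightarrow> s \<le> \<tau> \<Longrightarrow> y + s *\<^sub>R w \<in> \<Omega>"
      using lipschitz_boundary_segment_property[OF domain(5)] by metis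
    \<comment> \<open>The closed ball of half the radius makes \<open>K\<close> compact while the
      segment property still holds on it.\<close>
    define K where "K = (\<lambda>y. y + \<tau> *\<^sub>R w) ` (closure \<Omega> \<inter> cball x (\<rho> / 2))"
    have "compact K" unfolding K_def
      using domain(4) by (intro compact_continuous_image continuous_intros closed_Int_compact) auto
    moreover have "\<exists>U. open U \<and> y \<in> U \<and> controlled (U \<inter> UNIV)" if "y \<in> K" for y
    proof -
      have "y \<in> \<Omega>" using that w by (auto simp: K_def dist_norm norm_minus_commute intro!: seg)
      then obtain r where "0 < r" "controlled (ball y r)" using controlled_ball by blast
      then show ?thesis by (intro exI[of _ "ball y r"]) auto
    qed
    ultimately obtain T where T: "open T" "K \<subseteq> T" "controlled (T \<inter> UNIV)"
      using controlled_compact[of K UNIV] by auto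
    have "controlled (ball x (\<rho> / 2) \<inter> \<Omega>)"
    proof (rule controlled_translate[where T = T and v = "\<tau> *\<^sub>R w"])
      show "controlled T" using T by simp
      show "T \<in> sets borel" using T by simp
      fix u assume u: "u \<in> ball x (\<rho> / 2) \<inter> \<Omega>"
      then have uc: "u \<in> closure \<Omega>" "norm (u - x) < \<rho>"
        using closure_subset[of \<Omega>] w by (auto simp: dist_norm norm_minus_commute)
      show "u + \<tau> *\<^sub>R w \<in> T" using T(2) u uc by (auto simp: K_def)
      fix t :: real assume t: "0 < t" "t \<le> 1"
      show "u + t *\<^sub>R \<tau> *\<^sub>R w \<in> \<Omega>"
        using seg[OF uc, of "t * \<tau>"] t w by (simp add: mult_le_cancel_right1)
    qed auto
    then show ?thesis using w by (intro exI[of _ "ball x (\<rho> / 2)"]) auto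
  qed
  moreover have "compact (closure \<Omega>)" using domain(4) by simp
  ultimately obtain U where "closure \<Omega> \<subseteq> U" "controlled (U \<inter> \<Omega>)"
    using controlled_compact[OF _ domain_borel] by blast
  then have "controlled \<Omega>"
    using closure_subset[of \<Omega>] by (meson controlled_subset Int_greatest order_refl order_trans)
  then show ?thesis by (simp add: controlled_def)
qed

end

section \<open>The form domain\<close>

lemma psd_form_pullback:
  assumes "psd_form W q" "subspace T" "\<And>x. x \<in> T \<Longrightarrow> f x \<in> W"
    and "\<And>x y. f (x + y) = f x + f y" "\<And>c x. f (c *\<^sub>R x) = c *\<^sub>R f x"
  shows "psd_form T (\<lambda>x y. q (f x) (f y))"
proof -
  interpret psd_form W q by fact
  show ?thesis by standard (use assms sym nonneg in \<open>auto simp: add_left scale_left\<close>)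
qed

lemma psd_form_add:
  assumes "psd_form T p" "psd_form T q"
  shows "psd_form T (\<lambda>x y. p x y + q x y)"
proof -
  interpret p: psd_form T p by fact
  interpret q: psd_form T q by fact
  show ?thesis
    by standard (simp_all add: p.subspace p.add_left q.add_left p.scale_left q.scale_left
      p.nonneg q.nonneg algebra_simps p.sym q.sym)
qed

lemma psd_form_subspace:
  assumes "psd_form T q" "subspace V" "V \<subseteq> T"
  shows "psd_form V q"
  using psd_form_pullback[OF assms(1,2), of id] assms(3) by auto

lemma (in psd_form) sum_le:
  assumes "x \<in> V" "y \<in> V"
  shows "a (x + y) (x + y) \<le> 2 * a x x + 2 * a y y"
  using parallelogram[OF assms] nonneg[OF mem_intros(2)[OF assms]] by simp

lemma (in psd_form) diff_le:
  assumes "x \<in> V" "y \<in> V"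
  shows "a (x - y) (x - y) \<le> 2 * a x x + 2 * a y y"
  using parallelogram[OF assms] nonneg[OF mem_intros(1)[OF assms]] by simp

section \<open>Smooth functions and weak gradients\<close>

lemma smooth_fun_add:
  assumes "smooth_fun \<phi>" "smooth_fun \<psi>"
  shows "smooth_fun (\<phi> + \<psi>)" "grad (\<phi> + \<psi>) = grad \<phi> + grad \<psi>"
proof -
  obtain P where P: "P 0 0 = \<phi>"
    "\<And>i j x. (P i j has_derivative (\<lambda>v. P (Suc i) j x * fst v + P i (Suc j) x * snd v)) (at x)"
    using assms(1) unfolding smooth_fun_def by blast
  obtain Q where Q: "Q 0 0 = \<psi>"
    "\<And>i j x. (Q i j has_derivative (\<lambda>v. Q (Suc i) j x * fst v + Q i (Suc j) x * snd v)) (at x)"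
    using assms(2) unfolding smooth_fun_def by blast
  have D: "((\<lambda>x. P i j x + Q i j x) has_derivative (\<lambda>v. (P (Suc i) j x + Q (Suc i) j x) * fst v
      + (P i (Suc j) x + Q i (Suc j) x) * snd v)) (at x)" for i j x
    using has_derivative_add[OF P(2)[of i j x] Q(2)[of i j x]] by (simp add: algebra_simps)
  show "smooth_fun (\<phi> + \<psi>)"
    unfolding smooth_fun_def
    by (intro exI[of _ "\<lambda>i j x. P i j x + Q i j x"] conjI allI D) (simp add: P(1) Q(1) plus_fun_def)
  have "grad \<phi> x = (P 1 0 x, P 0 1 x)" "grad \<psi> x = (Q 1 0 x, Q 0 1 x)" for x
    using P(2)[of 0 0 x] Q(2)[of 0 0 x] by (auto intro!: grad_eqI simp: P(1) Q(1))
  moreover have "grad (\<phi> + \<psi>) x = (P 1 0 x + Q 1 0 x, P 0 1 x + Q 0 1 x)" for x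
    using D[of 0 0 x] by (intro grad_eqI) (simp add: P(1) Q(1) plus_fun_def)
  ultimately show "grad (\<phi> + \<psi>) = grad \<phi> + grad \<psi>" by (simp add: fun_eq_iff)
qed

lemma smooth_fun_scaleR:
  assumes "smooth_fun \<phi>"
  shows "smooth_fun (c *\<^sub>R \<phi>)" "grad (c *\<^sub>R \<phi>) = c *\<^sub>R grad \<phi>"
proof -
  obtain P where P: "P 0 0 = \<phi>"
    "\<And>i j x. (P i j has_derivative (\<lambda>v. P (Suc i) j x * fst v + P i (Suc j) x * snd v)) (at x)"
    using assms(1) unfolding smooth_fun_def by blast
  have D: "((\<lambda>x. c * P i j x) has_derivative (\<lambda>v. (c * P (Suc i) j x) * fst v
      + (c * P i (Suc j) x) * snd v)) (at x)" for i j x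
    using has_derivative_mult_right[OF P(2)[of i j x], of c] by (simp add: algebra_simps)
  show "smooth_fun (c *\<^sub>R \<phi>)"
    unfolding smooth_fun_def
    by (intro exI[of _ "\<lambda>i j x. c * P i j x"] conjI allI D) (simp add: P(1) scaleR_fun_def)
  have "grad \<phi> x = (P 1 0 x, P 0 1 x)" for x
    using P(2)[of 0 0 x] by (auto intro!: grad_eqI simp: P(1))
  moreover have "grad (c *\<^sub>R \<phi>) x = (c * P 1 0 x, c * P 0 1 x)" for x
    using D[of 0 0 x] by (intro grad_eqI) (simp add: P(1) scaleR_fun_def)
  ultimately show "grad (c *\<^sub>R \<phi>) = c *\<^sub>R grad \<phi>" by (simp add: fun_eq_iff)
qed

lemma L2_scaleR_integrable:
  fixes u :: "'a::euclidean_space \<Rightarrow> real" and G :: "'a \<Rightarrow> 'b::euclidean_space"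
  assumes "L2_on S u" "L2_on S G"
  shows "set_integrable lborel S (\<lambda>x. u x *\<^sub>R G x)"
proof -
  let ?u = "\<lambda>x. indicator S x *\<^sub>R u x" and ?G = "\<lambda>x. indicator S x *\<^sub>R G x"
  have [measurable]: "?u \<in> borel_measurable lborel" "?G \<in> borel_measurable lborel"
    using assms by (simp_all only: L2_on_def set_borel_measurable_def)
  have eq: "indicator S x *\<^sub>R (u x *\<^sub>R G x) = ?u x *\<^sub>R ?G x" for x by (simp add: indicator_def)
  have int: "integrable lborel (\<lambda>x. indicator S x *\<^sub>R (norm (u x))\<^sup>2 + indicator S x *\<^sub>R (norm (G x))\<^sup>2)"
    using assms by (intro Bochner_Integration.integrable_add) (simp_all only: L2_on_def set_integrable_def)
  have bound: "norm (c *\<^sub>R v) \<le> (norm c)\<^sup>2 + (norm v)\<^sup>2" for c :: real and v :: 'b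
    using sum_squares_bound[of "\<bar>c\<bar>" "norm v"] mult_nonneg_nonneg[OF abs_ge_zero norm_ge_zero, of c v]
    unfolding norm_scaleR real_norm_def by linarith
  show ?thesis
    unfolding set_integrable_def eq
  proof (rule Bochner_Integration.integrable_bound[OF int])
    show "(\<lambda>x. ?u x *\<^sub>R ?G x) \<in> borel_measurable lborel" by measurable
    show "AE x in lborel. norm (?u x *\<^sub>R ?G x)
        \<le> norm (indicator S x *\<^sub>R (norm (u x))\<^sup>2 + indicator S x *\<^sub>R (norm (G x))\<^sup>2)"
      using bound by (intro AE_I2) (auto simp: indicator_def)
  qed
qed

definition test_fun :: "(real \<times> real) set \<Rightarrow> (real \<times> real \<Rightarrow> real) \<Rightarrow> bool" where
  "test_fun \<Omega> \<psi> \<longleftrightarrow> smooth_fun \<psi> \<and> compact (closure {x. \<psi> x \<noteq> 0}) \<and> closure {x. \<psi> x \<noteq> 0} \<subseteq> \<Omega>"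

lemma test_fun_L2:
  assumes "bounded \<Omega>" "\<Omega> \<in> sets borel" "test_fun \<Omega> \<psi>"
  shows "L2_on \<Omega> \<psi>" "L2_on \<Omega> (grad \<psi>)" "L2_on \<Omega> (\<lambda>x. grad \<psi> x \<bullet> e)" "L2_on \<Omega> (\<lambda>x. \<psi> x *\<^sub>R e)"
  using assms smooth_fun_continuous[of \<psi>]
  by (auto simp: test_fun_def intro!: L2_on_continuous continuous_intros)

text \<open>Pairing with a constant vector \<open>e\<close> turns the vector identity into scalar
  products of square integrable functions, which pass to limits.\<close>

lemma is_weak_gradient_iff:
  assumes \<Omega>: "bounded \<Omega>" "\<Omega> \<in> sets borel" and u: "L2_on \<Omega> u" and G: "L2_on \<Omega> G"
  shows "is_weak_gradient \<Omega> u G \<longleftrightarrow>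
    (\<forall>\<psi> e. test_fun \<Omega> \<psi> \<longrightarrow> L2_inner \<Omega> u (\<lambda>x. grad \<psi> x \<bullet> e) = - L2_inner \<Omega> G (\<lambda>x. \<psi> x *\<^sub>R e))"
proof -
  have inner: "L2_inner \<Omega> u (\<lambda>x. grad \<psi> x \<bullet> e) = (LINT x:\<Omega>|lborel. u x *\<^sub>R grad \<psi> x) \<bullet> e"
    "L2_inner \<Omega> G (\<lambda>x. \<psi> x *\<^sub>R e) = (LINT x:\<Omega>|lborel. \<psi> x *\<^sub>R G x) \<bullet> e"
    if \<psi>: "test_fun \<Omega> \<psi>" for \<psi> e
  proof -
    have int: "set_integrable lborel \<Omega> (\<lambda>x. u x *\<^sub>R grad \<psi> x)" "set_integrable lborel \<Omega> (\<lambda>x. \<psi> x *\<^sub>R G x)"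
      using test_fun_L2[OF \<Omega> \<psi>] u G by (auto intro: L2_scaleR_integrable)
    show "L2_inner \<Omega> u (\<lambda>x. grad \<psi> x \<bullet> e) = (LINT x:\<Omega>|lborel. u x *\<^sub>R grad \<psi> x) \<bullet> e"
      using integral_inner_left[of e lborel "\<lambda>x. indicator \<Omega> x *\<^sub>R (u x *\<^sub>R grad \<psi> x)"] int(1)
      by (simp add: L2_inner_def set_lebesgue_integral_def set_integrable_def mult.assoc)
    show "L2_inner \<Omega> G (\<lambda>x. \<psi> x *\<^sub>R e) = (LINT x:\<Omega>|lborel. \<psi> x *\<^sub>R G x) \<bullet> e"
      using integral_inner_left[of e lborel "\<lambda>x. indicator \<Omega> x *\<^sub>R (\<psi> x *\<^sub>R G x)"] int(2)
      by (simp add: L2_inner_def set_lebesgue_integral_def set_integrable_def mult.assoc)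
  qed
  have eq: "(\<forall>e. p \<bullet> e = - (q \<bullet> e)) \<longleftrightarrow> p = - q" for p q :: "real \<times> real"
    by (metis inner_minus_left vector_eq_rdot)
  have "(LINT x:\<Omega>|lborel. u x *\<^sub>R grad \<psi> x) = - (LINT x:\<Omega>|lborel. \<psi> x *\<^sub>R G x) \<longleftrightarrow>
      (\<forall>e. L2_inner \<Omega> u (\<lambda>x. grad \<psi> x \<bullet> e) = - L2_inner \<Omega> G (\<lambda>x. \<psi> x *\<^sub>R e))"
    if "test_fun \<Omega> \<psi>" for \<psi>
    unfolding inner[OF that] eq ..
  then show ?thesis
    unfolding is_weak_gradient_def test_fun_def[symmetric] by blast
qed

lemma integrable_compact_support:
  fixes h :: "'a::euclidean_space \<Rightarrow> real"
  assumes "continuous_on UNIV h" "\<And>x. R < norm x \<Longrightarrow> h x = 0"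
  shows "integrable lborel h"
proof -
  have "integrable lborel (\<lambda>x. indicator (cball 0 R) x *\<^sub>R h x)"
    by (rule borel_integrable_compact) (auto intro: continuous_on_subset[OF assms(1)])
  also have "(\<lambda>x. indicator (cball 0 R) x *\<^sub>R h x) = h"
    using assms(2) by (auto simp: indicator_def fun_eq_iff not_le)
  finally show ?thesis .
qed

text \<open>Integrals of difference quotients vanish by translation invariance, and the quotients
  converge boundedly with supports in one ball. This gives integration by parts in any direction
  \<open>e\<close> without choosing coordinates.\<close>

lemma integral_directional_derivative_zero:
  fixes h :: "'a::euclidean_space \<Rightarrow> real"
  assumes deriv: "\<And>x t. ((\<lambda>t. h (x + t *\<^sub>R e)) has_real_derivative k (x + t *\<^sub>R e)) (at t)"
    and cont: "continuous_on UNIV h" "continuous_on UNIV k"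
    and supp: "\<And>x. R < norm x \<Longrightarrow> h x = 0" "\<And>x. R < norm x \<Longrightarrow> k x = 0"
  shows "(LINT x|lborel. k x) = 0"
proof -
  \<comment> \<open>The step lengths 1/(n + 1) are at most 1, so every \<open>d n\<close> vanishes
    outside the ball of radius \<open>R + norm e\<close>.\<close>
  define d where "d n x = real (Suc n) * (h (x + (1 / real (Suc n)) *\<^sub>R e) - h x)" for n x
  obtain M where M: "\<And>x. norm (k x) \<le> M"
  proof -
    have "compact (k ` cball 0 R)"
      by (intro compact_continuous_image continuous_on_subset[OF cont(2)]) auto
    then obtain M where "\<forall>y\<in>k ` cball 0 R. norm y \<le> M" using compact_imp_bounded bounded_iff by metis
    then have "norm (k x) \<le> max 0 M" for x
      using supp(2)[of x] by (cases "R < norm x") (auto simp: le_max_iff_disj)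
    then show ?thesis by (rule that)
  qed
  have mvt: "\<exists>t. 0 < t \<and> t < 1 \<and> d n x = k (x + t *\<^sub>R e)" for n x
  proof -
    have "\<exists>t. 0 < t \<and> t < 1 / real (Suc n) \<and>
        h (x + (1 / real (Suc n)) *\<^sub>R e) - h (x + 0 *\<^sub>R e) = (1 / real (Suc n) - 0) * k (x + t *\<^sub>R e)"
      by (rule MVT2[where f = "\<lambda>t. h (x + t *\<^sub>R e)"]) (simp, rule deriv)
    then obtain t where t: "0 < t" "t < 1 / real (Suc n)" "h (x + (1 / real (Suc n)) *\<^sub>R e) - h x = 1 / real (Suc n) * k (x + t *\<^sub>R e)"
      by auto
    have "1 / real (Suc n) \<le> 1" by simp
    then have "t < 1" using t(2) by linarith
    moreover have "d n x = k (x + t *\<^sub>R e)" unfolding d_def t(3) by simp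
    ultimately show ?thesis using t(1) by blast
  qed
  have "(\<lambda>n. LINT x|lborel. d n x) \<longlonglongrightarrow> (LINT x|lborel. k x)"
  proof (rule integral_dominated_convergence[where w = "\<lambda>x. M * indicator (cball 0 (R + norm e)) x"])
    show "k \<in> borel_measurable lborel" using borel_measurable_continuous_onI[OF cont(2)] by simp
    have "continuous_on UNIV (d n)" for n
      unfolding d_def[abs_def]
      by (intro continuous_intros continuous_on_compose2[OF cont(1)] cont(1)) auto
    from borel_measurable_continuous_onI[OF this] show "d n \<in> borel_measurable lborel" for n
      by simp
    show "integrable lborel (\<lambda>x. M * indicator (cball 0 (R + norm e)) x :: real)"
      using emeasure_bounded_finite[OF bounded_cball, of 0 "R + norm e"]
      by (intro integrable_mult_right integrable_real_indicator) simp_all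
    show "AE x in lborel. (\<lambda>n. d n x) \<longlonglongrightarrow> k x"
    proof (rule AE_I2)
      fix x
      have "((\<lambda>t. (h (x + (0 + t) *\<^sub>R e) - h (x + 0 *\<^sub>R e)) / t) \<longlongrightarrow> k (x + 0 *\<^sub>R e)) (at 0)"
        using deriv[of x 0] unfolding DERIV_def by simp
      moreover have "filterlim (\<lambda>n. 1 / real (Suc n)) (at 0) sequentially"
        unfolding filterlim_at using LIMSEQ_Suc[OF lim_1_over_n] by (auto intro!: always_eventually)
      ultimately have "(\<lambda>n. (h (x + (0 + 1 / real (Suc n)) *\<^sub>R e) - h (x + 0 *\<^sub>R e)) / (1 / real (Suc n))) \<longlonglongrightarrow> k (x + 0 *\<^sub>R e)"
        by (rule filterlim_compose)
      then show "(\<lambda>n. d n x) \<longlonglongrightarrow> k x" by (simp add: d_def mult.commute)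
    qed
    show "AE x in lborel. norm (d n x) \<le> M * indicator (cball 0 (R + norm e)) x" for n
    proof (rule AE_I2)
      fix x
      obtain t where t: "0 < t" "t < 1" "d n x = k (x + t *\<^sub>R e)" using mvt by blast
      show "norm (d n x) \<le> M * indicator (cball 0 (R + norm e)) x"
      proof (cases "norm x \<le> R + norm e")
        case True
        then show ?thesis using M[of "x + t *\<^sub>R e"] t(3) by simp
      next
        case False
        have "norm x \<le> norm (x + t *\<^sub>R e) + norm (t *\<^sub>R e)"
          using norm_triangle_ineq4[of "x + t *\<^sub>R e" "t *\<^sub>R e"] by simp
        moreover have "norm (t *\<^sub>R e) \<le> norm e" using t by (simp add: mult_left_le_one_le)
        ultimately have "R < norm (x + t *\<^sub>R e)" using False by linarith
        then show ?thesis using supp(2) t(3) False by simp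
      qed
    qed
  qed
  moreover have "(LINT x|lborel. d n x) = 0" for n
  proof -
    define c where "c = (1 / real (Suc n)) *\<^sub>R e"
    have int: "integrable lborel h" by (rule integrable_compact_support[OF cont(1) supp(1)])
    have "integrable (distr lborel borel ((+) c)) h"
      using int by (simp add: lborel_distr_plus)
    then have int': "integrable lborel (\<lambda>x. h (c + x))"
      by (subst (asm) integrable_distr_eq) (auto intro: borel_measurable_continuous_onI[OF cont(1)])
    have "(LINT x|lborel. h x) = (LINT x|distr lborel borel ((+) c). h x)"
      by (simp add: lborel_distr_plus)
    also have "\<dots> = (LINT x|lborel. h (c + x))"
      by (rule integral_distr) (auto intro: borel_measurable_continuous_onI[OF cont(1)])
    finally have "(LINT x|lborel. h (c + x) - h x) = 0" using int int' by simp
    then show ?thesis unfolding d_def c_def[symmetric] by (simp add: add.commute)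
  qed
  ultimately show ?thesis by (simp add: LIMSEQ_const_iff)
qed

lemma smooth_fun_weak_gradient:
  assumes \<Omega>: "bounded \<Omega>" "\<Omega> \<in> sets borel" and \<phi>: "smooth_fun \<phi>"
  shows "is_weak_gradient \<Omega> \<phi> (grad \<phi>)"
proof -
  note cont = smooth_fun_continuous[OF \<phi>]
  have L2: "L2_on \<Omega> \<phi>" "L2_on \<Omega> (grad \<phi>)" using L2_on_continuous[OF \<Omega>] cont by auto
  have "L2_inner \<Omega> \<phi> (\<lambda>x. grad \<psi> x \<bullet> e) = - L2_inner \<Omega> (grad \<phi>) (\<lambda>x. \<psi> x *\<^sub>R e)"
    if \<psi>: "test_fun \<Omega> \<psi>" for \<psi> e
  proof -
    have \<psi>': "smooth_fun \<psi>" "compact (closure {x. \<psi> x \<noteq> 0})" "closure {x. \<psi> x \<noteq> 0} \<subseteq> \<Omega>"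
      using \<psi> by (auto simp: test_fun_def)
    note cont\<psi> = smooth_fun_continuous[OF \<psi>'(1)]
    define S where "S = closure {x. \<psi> x \<noteq> 0}"
    have zero: "\<psi> x = 0" "grad \<psi> x = 0" if "x \<notin> S" for x
    proof -
      show "\<psi> x = 0" using that closure_subset[of "{x. \<psi> x \<noteq> 0}"] by (auto simp: S_def)
      \<comment> \<open>The gradient at a point depends on a whole neighbourhood; off the closed
        support such a neighbourhood of zeros exists.\<close>
      have op: "open (- S)" unfolding S_def by (intro open_Compl closed_closure)
      have "(\<psi> has_derivative (\<lambda>v. 0 * fst v + 0 * snd v)) (at x)"
      proof (rule has_derivative_transform_within_open[OF _ op])
        show "((\<lambda>_. 0) has_derivative (\<lambda>v. 0 * fst v + 0 * snd v)) (at x)" by simp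
        show "x \<in> - S" using that by simp
        show "0 = \<psi> y" if "y \<in> - S" for y
          using that closure_subset[of "{x. \<psi> x \<noteq> 0}"] by (auto simp: S_def)
      qed
      then show "grad \<psi> x = 0" by (simp add: grad_eqI zero_prod_def)
    qed
    obtain R where R: "\<And>x. x \<in> S \<Longrightarrow> norm x \<le> R"
      using compact_imp_bounded[OF \<psi>'(2)] unfolding S_def bounded_iff by blast
    \<comment> \<open>The derivative of the product of \<phi> and \<psi> in direction
      \<open>e\<close>. It is zero outside \<Omega>, so the vanishing of its integral is the
      identity sought.\<close>
    define k where "k x = \<phi> x * (grad \<psi> x \<bullet> e) + grad \<phi> x \<bullet> (\<psi> x *\<^sub>R e)" for x
    have "(LINT x|lborel. k x) = 0"
    proof (rule integral_directional_derivative_zero[where h = "\<lambda>x. \<phi> x * \<psi> x" and R = R])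
      show "((\<lambda>t. \<phi> (x + t *\<^sub>R e) * \<psi> (x + t *\<^sub>R e)) has_real_derivative k (x + t *\<^sub>R e)) (at t)" for x t
        using DERIV_mult[OF smooth_fun_line_derivative[OF \<phi>, of x e t] smooth_fun_line_derivative[OF \<psi>'(1), of x e t]]
        by (simp add: k_def algebra_simps)
      show "continuous_on UNIV (\<lambda>x. \<phi> x * \<psi> x)" by (intro continuous_intros cont cont\<psi>)
      show "continuous_on UNIV k" unfolding k_def[abs_def] by (intro continuous_intros cont cont\<psi>)
      fix x :: "real \<times> real" assume "R < norm x"
      then have "x \<notin> S" using R[of x] by auto
      then show "\<phi> x * \<psi> x = 0" "k x = 0" by (simp_all add: zero k_def)
    qed
    moreover have "k x = indicator \<Omega> x *\<^sub>R k x" for x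
    proof (cases "x \<in> \<Omega>")
      case False
      then have "x \<notin> S" using \<psi>'(3) by (auto simp: S_def)
      then show ?thesis by (simp add: zero k_def)
    qed simp
    ultimately have "(LINT x:\<Omega>|lborel. \<phi> x * (grad \<psi> x \<bullet> e) + grad \<phi> x \<bullet> (\<psi> x *\<^sub>R e)) = 0"
      unfolding set_lebesgue_integral_def k_def[symmetric] by presburger
    then show ?thesis
      using L2_inner_integrable[OF L2(1) test_fun_L2(3)[OF \<Omega> \<psi>, of e]]
        L2_inner_integrable[OF L2(2) test_fun_L2(4)[OF \<Omega> \<psi>, of e]]
      by (simp add: L2_inner_def)
  qed
  then show ?thesis by (simp add: is_weak_gradient_iff[OF \<Omega> L2])
qed

text \<open>A Sobolev function is represented by the triple of the function, its weak gradient and its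
  trace, so that \<open>V\<close> below is the closure of the smooth triples \<open>lift \<phi>\<close>.\<close>

type_synonym sobolev_triple =
  "(real \<times> real \<Rightarrow> real) \<times> (real \<times> real \<Rightarrow> real \<times> real) \<times> (real \<Rightarrow> real)"

definition lift :: "(real \<times> real \<Rightarrow> real) \<Rightarrow> sobolev_triple" where
  "lift \<phi> = (\<phi>, grad \<phi>, \<lambda>x. \<phi> (x, 0))"

lemma lift_add: "smooth_fun \<phi> \<Longrightarrow> smooth_fun \<psi> \<Longrightarrow> lift (\<phi> + \<psi>) = lift \<phi> + lift \<psi>"
  by (simp add: lift_def smooth_fun_add fun_eq_iff)

lemma lift_scaleR: "smooth_fun \<phi> \<Longrightarrow> lift (c *\<^sub>R \<phi>) = c *\<^sub>R lift \<phi>"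
  by (simp add: lift_def smooth_fun_scaleR fun_eq_iff)

section \<open>Triples, the four forms and closedness of the form domain\<close>

context sloshing_domain
begin

definition mass :: "sobolev_triple \<Rightarrow> sobolev_triple \<Rightarrow> real" where
  "mass v w = L2_inner \<Omega> (fst v) (fst w)"

definition dirichlet :: "sobolev_triple \<Rightarrow> sobolev_triple \<Rightarrow> real" where
  "dirichlet v w = L2_inner \<Omega> (fst (snd v)) (fst (snd w))"

definition boundary :: "sobolev_triple \<Rightarrow> sobolev_triple \<Rightarrow> real" where
  "boundary v w = L2_inner F (snd (snd v)) (snd (snd w))"

definition full :: "sobolev_triple \<Rightarrow> sobolev_triple \<Rightarrow> real" where
  "full v w = mass v w + (dirichlet v w + boundary v w)"

text \<open>The ambient space: square integrable components without any relation between them, which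
  accommodates both limits of sequences and auxiliary test triples.\<close>

definition T :: "sobolev_triple set" where
  "T = {v. L2_on \<Omega> (fst v) \<and> L2_on \<Omega> (fst (snd v)) \<and> L2_on F (snd (snd v))}"

definition V :: "sobolev_triple set" where
  "V = {v. H1_with_gradient \<Omega> (fst v) (fst (snd v)) \<and> is_trace \<Omega> F (fst v) (fst (snd v)) (snd (snd v))}"

lemma subspace_T: "subspace T"
  by (auto simp: subspace_def T_def L2_on_zero L2_on_add L2_on_scaleR)

lemma psd_T: "psd_form T mass" "psd_form T dirichlet" "psd_form T boundary"
  unfolding mass_def[abs_def] dirichlet_def[abs_def] boundary_def[abs_def]
  by (rule psd_form_pullback[OF L2.psd_form_axioms subspace_T]; simp add: T_def)+

lemma psd_T_full: "psd_form T full"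
  unfolding full_def[abs_def] by (intro psd_form_add psd_T)

sublocale mass: psd_form T mass by (rule psd_T)
sublocale dirichlet: psd_form T dirichlet by (rule psd_T)
sublocale boundary: psd_form T boundary by (rule psd_T)
sublocale full: psd_form T full by (rule psd_T_full)

lemma F_borel_bounded: "bounded F" "F \<in> sets borel"
  by (simp_all add: F_eq)

lemma full_tendsto_0_iff:
  assumes "\<And>n. v n \<in> T"
  shows "(\<lambda>n. full (v n) (v n)) \<longlonglongrightarrow> 0 \<longleftrightarrow> (\<lambda>n. mass (v n) (v n)) \<longlonglongrightarrow> 0 \<and>
    (\<lambda>n. dirichlet (v n) (v n)) \<longlonglongrightarrow> 0 \<and> (\<lambda>n. boundary (v n) (v n)) \<longlonglongrightarrow> 0"
proof
  assume lim: "(\<lambda>n. full (v n) (v n)) \<longlonglongrightarrow> 0"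
  have pos: "0 \<le> mass (v n) (v n)" "0 \<le> dirichlet (v n) (v n)" "0 \<le> boundary (v n) (v n)" for n
    using assms mass.nonneg dirichlet.nonneg boundary.nonneg by auto
  show "(\<lambda>n. mass (v n) (v n)) \<longlonglongrightarrow> 0 \<and>
      (\<lambda>n. dirichlet (v n) (v n)) \<longlonglongrightarrow> 0 \<and> (\<lambda>n. boundary (v n) (v n)) \<longlonglongrightarrow> 0"
    by (intro conjI tendsto_sandwich[OF _ _ tendsto_const lim] always_eventually allI)
       (use pos in \<open>simp_all add: full_def\<close>)
next
  assume "(\<lambda>n. mass (v n) (v n)) \<longlonglongrightarrow> 0 \<and>
      (\<lambda>n. dirichlet (v n) (v n)) \<longlonglongrightarrow> 0 \<and> (\<lambda>n. boundary (v n) (v n)) \<longlonglongrightarrow> 0"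
  then have "(\<lambda>n. mass (v n) (v n) + (dirichlet (v n) (v n) + boundary (v n) (v n))) \<longlonglongrightarrow> 0 + (0 + 0)"
    by (intro tendsto_add) auto
  then show "(\<lambda>n. full (v n) (v n)) \<longlonglongrightarrow> 0" by (simp add: full_def)
qed

lemma lift_in_T:
  assumes "smooth_fun \<phi>" shows "lift \<phi> \<in> T"
proof -
  have "L2_on F (\<lambda>x. \<phi> (x, 0))"
    using smooth_fun_continuous(1)[OF assms]
    by (intro L2_on_continuous F_borel_bounded) (auto intro!: continuous_on_compose2[of UNIV \<phi>] continuous_intros)
  then show ?thesis
    using smooth_fun_continuous[OF assms] domain(4) domain_borel
    by (auto simp: T_def lift_def intro!: L2_on_continuous)
qed

text \<open>The three limits in the definition of a trace say together that smooth triples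
  approximate \<open>v\<close> in the single form \<open>full\<close>, which makes closure arguments
  available.\<close>

lemma V_iff:
  "v \<in> V \<longleftrightarrow> v \<in> T \<and> is_weak_gradient \<Omega> (fst v) (fst (snd v)) \<and>
    (\<exists>\<phi>. (\<forall>n. smooth_fun (\<phi> n)) \<and> (\<lambda>n. full (lift (\<phi> n) - v) (lift (\<phi> n) - v)) \<longlonglongrightarrow> 0)"
proof -
  have lim: "(\<lambda>n. full (lift (\<phi> n) - v) (lift (\<phi> n) - v)) \<longlonglongrightarrow> 0 \<longleftrightarrow>
      (\<lambda>n. LINT x:\<Omega>|lborel. (\<phi> n x - fst v x)\<^sup>2) \<longlonglongrightarrow> 0 \<and>
      (\<lambda>n. LINT x:\<Omega>|lborel. (norm (grad (\<phi> n) x - fst (snd v) x))\<^sup>2) \<longlonglongrightarrow> 0 \<and>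
      (\<lambda>n. LINT s:F|lborel. (\<phi> n (s, 0) - snd (snd v) s)\<^sup>2) \<longlonglongrightarrow> 0"
    if "v \<in> T" "\<And>n. smooth_fun (\<phi> n)" for \<phi>
    using that lift_in_T
    by (subst full_tendsto_0_iff)
       (auto simp: full.mem_intros mass_def dirichlet_def boundary_def lift_def L2_inner_self)
  show ?thesis
    unfolding V_def H1_with_gradient_def is_trace_def mem_Collect_eq
    using lim by (auto simp: T_def)
qed

lemma V_subset_T: "V \<subseteq> T" using V_iff by blast

text \<open>With the test function placed in one slot of a triple, the weak gradient identity is
  linear in \<open>v\<close> and continuous for \<open>mass\<close> and \<open>dirichlet\<close>, so
  it survives limits.\<close>

lemma weak_gradient_iff:
  assumes "v \<in> T"
  shows "is_weak_gradient \<Omega> (fst v) (fst (snd v)) \<longleftrightarrow>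
    (\<forall>\<psi> e. test_fun \<Omega> \<psi> \<longrightarrow> mass v (\<lambda>x. grad \<psi> x \<bullet> e, 0, 0) = - dirichlet v (0, \<lambda>x. \<psi> x *\<^sub>R e, 0))"
  unfolding mass_def dirichlet_def
  by (subst is_weak_gradient_iff) (use assms domain in \<open>auto simp: T_def\<close>)

lemma test_triples:
  assumes "test_fun \<Omega> \<psi>"
  shows "(\<lambda>x. grad \<psi> x \<bullet> e, 0, 0) \<in> T" "(0, \<lambda>x. \<psi> x *\<^sub>R e, 0) \<in> T"
  using test_fun_L2[OF domain(4) domain_borel assms] by (auto simp: T_def L2_on_zero)

lemma lift_in_V:
  assumes "smooth_fun \<phi>" shows "lift \<phi> \<in> V"
  unfolding V_iff
proof (intro conjI exI[of _ "\<lambda>_. \<phi>"] allI)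
  show "lift \<phi> \<in> T" by (rule lift_in_T[OF assms])
  show "is_weak_gradient \<Omega> (fst (lift \<phi>)) (fst (snd (lift \<phi>)))"
    using smooth_fun_weak_gradient[OF domain(4) domain_borel assms] by (simp add: lift_def)
  have "full 0 0 = 0" by (rule full.zero_left) (rule full.mem_intros)
  then show "(\<lambda>n. full (lift \<phi> - lift \<phi>) (lift \<phi> - lift \<phi>)) \<longlonglongrightarrow> 0" by simp
qed (rule assms)

text \<open>A diagonal choice: smooth triples within 1/(n + 1) of \<open>v n\<close> converge to the
  same limit.\<close>

lemma V_closed:
  assumes v: "\<And>n. v n \<in> V" and w: "w \<in> T" and lim: "(\<lambda>n. full (v n - w) (v n - w)) \<longlonglongrightarrow> 0"
  shows "w \<in> V"
proof -
  have vT: "v n \<in> T" for n using v V_subset_T by auto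
  have "v n - w \<in> T" for n using vT w full.mem_intros by blast
  note lims = lim[unfolded full_tendsto_0_iff[OF this]]
  have weak: "is_weak_gradient \<Omega> (fst w) (fst (snd w))"
    unfolding weak_gradient_iff[OF w]
  proof (intro allI impI)
    fix \<psi> e assume \<psi>: "test_fun \<Omega> \<psi>"
    have "(\<lambda>n. mass (v n) (\<lambda>x. grad \<psi> x \<bullet> e, 0, 0)) \<longlonglongrightarrow> mass w (\<lambda>x. grad \<psi> x \<bullet> e, 0, 0)"
      by (intro mass.tendsto_left vT w test_triples[OF \<psi>] lims[THEN conjunct1])
    moreover have "(\<lambda>n. - dirichlet (v n) (0, \<lambda>x. \<psi> x *\<^sub>R e, 0)) \<longlonglongrightarrow> - dirichlet w (0, \<lambda>x. \<psi> x *\<^sub>R e, 0)"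
      by (intro tendsto_minus dirichlet.tendsto_left vT w test_triples[OF \<psi>] lims[THEN conjunct2, THEN conjunct1])
    moreover have "mass (v n) (\<lambda>x. grad \<psi> x \<bullet> e, 0, 0) = - dirichlet (v n) (0, \<lambda>x. \<psi> x *\<^sub>R e, 0)" for n
      using v[of n] \<psi> weak_gradient_iff[OF vT] unfolding V_iff by blast
    ultimately show "mass w (\<lambda>x. grad \<psi> x \<bullet> e, 0, 0) = - dirichlet w (0, \<lambda>x. \<psi> x *\<^sub>R e, 0)"
      by (simp only:) (rule LIMSEQ_unique)
  qed
  have "\<exists>\<phi>. smooth_fun \<phi> \<and> full (lift \<phi> - v n) (lift \<phi> - v n) < 1 / real (Suc n)" for n
  proof -
    obtain \<phi> where \<phi>: "\<And>k. smooth_fun (\<phi> k)" "(\<lambda>k. full (lift (\<phi> k) - v n) (lift (\<phi> k) - v n)) \<longlonglongrightarrow> 0"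
      using v[of n] unfolding V_iff by blast
    have "\<forall>\<^sub>F k in sequentially. full (lift (\<phi> k) - v n) (lift (\<phi> k) - v n) < 1 / real (Suc n)"
      by (rule order_tendstoD(2)[OF \<phi>(2)]) simp
    then show ?thesis using \<phi>(1) eventually_happens'[OF sequentially_bot] by blast
  qed
  then obtain \<phi> where \<phi>: "\<And>n. smooth_fun (\<phi> n)" "\<And>n. full (lift (\<phi> n) - v n) (lift (\<phi> n) - v n) < 1 / real (Suc n)"
    by metis
  have dT: "lift (\<phi> n) - v n \<in> T" "v n - w \<in> T" for n
    using lift_in_T[OF \<phi>(1)] vT w full.mem_intros by blast+
  have "(\<lambda>n. full (lift (\<phi> n) - w) (lift (\<phi> n) - w)) \<longlonglongrightarrow> 0"
  proof (rule tendsto_sandwich[OF _ _ tendsto_const])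
    show "\<forall>\<^sub>F n in sequentially. 0 \<le> full (lift (\<phi> n) - w) (lift (\<phi> n) - w)"
      using lift_in_T[OF \<phi>(1)] w full.mem_intros by (intro always_eventually allI full.nonneg) blast
    have "full (lift (\<phi> n) - w) (lift (\<phi> n) - w) \<le> 2 * (1 / real (Suc n)) + 2 * full (v n - w) (v n - w)" for n
      using full.sum_le[OF dT, of n n] \<phi>(2)[of n] by simp
    then show "\<forall>\<^sub>F n in sequentially. full (lift (\<phi> n) - w) (lift (\<phi> n) - w) \<le> 2 * (1 / real (Suc n)) + 2 * full (v n - w) (v n - w)"
      by simp
    have "(\<lambda>n. 2 * (1 / real (Suc n)) + 2 * full (v n - w) (v n - w)) \<longlonglongrightarrow> 2 * 0 + 2 * 0"
      by (intro tendsto_intros lim LIMSEQ_Suc[OF lim_1_over_n])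
    then show "(\<lambda>n. 2 * (1 / real (Suc n)) + 2 * full (v n - w) (v n - w)) \<longlonglongrightarrow> 0" by simp
  qed
  then show ?thesis unfolding V_iff using w weak \<phi>(1) by blast
qed

lemma subspace_V: "subspace V"
  unfolding subspace_def
proof (intro conjI ballI allI)
  have sm0: "smooth_fun (\<lambda>x. 0)" unfolding smooth_fun_def by (intro exI[of _ "\<lambda>i j x. 0"]) auto
  have "lift (0 *\<^sub>R (\<lambda>x. 0)) \<in> V" by (intro lift_in_V smooth_fun_scaleR sm0)
  moreover have "lift (0 *\<^sub>R (\<lambda>x. 0)) = 0" by (subst lift_scaleR[OF sm0]) (rule scaleR_zero_left)
  ultimately show "0 \<in> V" by metis
  fix v assume v: "v \<in> V"
  then obtain \<phi> where vT: "v \<in> T" and vw: "is_weak_gradient \<Omega> (fst v) (fst (snd v))"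
    and \<phi>: "\<And>n. smooth_fun (\<phi> n)" "(\<lambda>n. full (lift (\<phi> n) - v) (lift (\<phi> n) - v)) \<longlonglongrightarrow> 0"
    unfolding V_iff by blast
  {
    fix w assume w: "w \<in> V"
    then obtain \<psi> where wT: "w \<in> T"
      and \<psi>: "\<And>n. smooth_fun (\<psi> n)" "(\<lambda>n. full (lift (\<psi> n) - w) (lift (\<psi> n) - w)) \<longlonglongrightarrow> 0"
      unfolding V_iff by blast
    show "v + w \<in> V"
    proof (rule V_closed[where v = "\<lambda>n. lift (\<phi> n + \<psi> n)"])
      show "lift (\<phi> n + \<psi> n) \<in> V" for n by (intro lift_in_V smooth_fun_add \<phi> \<psi>)
      show "v + w \<in> T" using vT wT full.mem_intros by blast
      have dT: "lift (\<phi> n) - v \<in> T" "lift (\<psi> n) - w \<in> T" for n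
        using lift_in_T[OF \<phi>(1)] lift_in_T[OF \<psi>(1)] vT wT full.mem_intros by blast+
      have eq: "lift (\<phi> n + \<psi> n) - (v + w) = (lift (\<phi> n) - v) + (lift (\<psi> n) - w)" for n
        by (simp add: lift_add \<phi> \<psi>)
      show "(\<lambda>n. full (lift (\<phi> n + \<psi> n) - (v + w)) (lift (\<phi> n + \<psi> n) - (v + w))) \<longlonglongrightarrow> 0"
        unfolding eq
      proof (rule tendsto_sandwich[OF _ _ tendsto_const])
        show "\<forall>\<^sub>F n in sequentially. 0 \<le> full ((lift (\<phi> n) - v) + (lift (\<psi> n) - w)) ((lift (\<phi> n) - v) + (lift (\<psi> n) - w))"
          by (intro always_eventually allI full.nonneg full.mem_intros(1) dT)
        show "\<forall>\<^sub>F n in sequentially. full ((lift (\<phi> n) - v) + (lift (\<psi> n) - w)) ((lift (\<phi> n) - v) + (lift (\<psi> n) - w))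
            \<le> 2 * full (lift (\<phi> n) - v) (lift (\<phi> n) - v) + 2 * full (lift (\<psi> n) - w) (lift (\<psi> n) - w)"
          using dT by (intro always_eventually allI full.sum_le)
        have "(\<lambda>n. 2 * full (lift (\<phi> n) - v) (lift (\<phi> n) - v) + 2 * full (lift (\<psi> n) - w) (lift (\<psi> n) - w)) \<longlonglongrightarrow> 2 * 0 + 2 * 0"
          by (intro tendsto_intros \<phi> \<psi>)
        then show "(\<lambda>n. 2 * full (lift (\<phi> n) - v) (lift (\<phi> n) - v) + 2 * full (lift (\<psi> n) - w) (lift (\<psi> n) - w)) \<longlonglongrightarrow> 0"
          by simp
      qed
    qed
  }
  fix c :: real
  show "c *\<^sub>R v \<in> V"
  proof (rule V_closed[where v = "\<lambda>n. lift (c *\<^sub>R \<phi> n)"])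
    show "lift (c *\<^sub>R \<phi> n) \<in> V" for n by (intro lift_in_V smooth_fun_scaleR \<phi>)
    show "c *\<^sub>R v \<in> T" using vT full.mem_intros by blast
    have dT: "lift (\<phi> n) - v \<in> T" for n using lift_in_T[OF \<phi>(1)] vT full.mem_intros by blast
    have eq: "lift (c *\<^sub>R \<phi> n) - c *\<^sub>R v = c *\<^sub>R (lift (\<phi> n) - v)" for n
      by (simp add: lift_scaleR \<phi> scaleR_diff_right)
    have "full (c *\<^sub>R (lift (\<phi> n) - v)) (c *\<^sub>R (lift (\<phi> n) - v)) = c\<^sup>2 * full (lift (\<phi> n) - v) (lift (\<phi> n) - v)" for n
      using full.scale_left[OF dT full.mem_intros(3)[OF dT], of c n c n] full.scale_right[OF dT dT, of n c n]
      by (simp add: power2_eq_square)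
    then show "(\<lambda>n. full (lift (c *\<^sub>R \<phi> n) - c *\<^sub>R v) (lift (c *\<^sub>R \<phi> n) - c *\<^sub>R v)) \<longlonglongrightarrow> 0"
      unfolding eq using tendsto_mult_right_zero[OF \<phi>(2), of "c\<^sup>2"] by simp
  qed
qed

end

lemma ennreal_linear_combination_leD:
  assumes "ennreal m \<le> ennreal a * ennreal d + ennreal c * ennreal b" "0 \<le> a" "0 \<le> d" "0 \<le> c" "0 \<le> b"
  shows "m \<le> a * d + c * b"
proof -
  have "ennreal m \<le> ennreal (a * d + c * b)"
    using assms by (simp add: ennreal_mult)
  moreover have "0 \<le> a * d + c * b" using assms by simp
  ultimately show ?thesis by (simp only: ennreal_le_iff)
qed

section \<open>Extension of the estimates to the form domain; completeness and compactness\<close>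

context sloshing_domain
begin

lemma L2sq_lift:
  assumes "smooth_fun \<phi>"
  shows "L2sq \<Omega> \<phi> = ennreal (mass (lift \<phi>) (lift \<phi>))"
    "L2sq \<Omega> (grad \<phi>) = ennreal (dirichlet (lift \<phi>) (lift \<phi>))"
    "L2sq F (\<lambda>x. \<phi> (x, 0)) = ennreal (boundary (lift \<phi>) (lift \<phi>))"
  using lift_in_T[OF assms]
  by (simp_all add: T_def lift_def mass_def dirichlet_def boundary_def L2sq_eq_L2_inner)

text \<open>An inequality between these quantities that holds for smooth triples survives the limit;
  every estimate on \<open>V\<close> below is obtained in this way.\<close>

lemma V_approximation:
  assumes "v \<in> V"
  obtains \<phi> where "\<And>n. smooth_fun (\<phi> n)"
    "(\<lambda>n. mass (lift (\<phi> n)) (lift (\<phi> n))) \<longlonglongrightarrow> mass v v"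
    "(\<lambda>n. dirichlet (lift (\<phi> n)) (lift (\<phi> n))) \<longlonglongrightarrow> dirichlet v v"
    "(\<lambda>n. boundary (lift (\<phi> n)) (lift (\<phi> n))) \<longlonglongrightarrow> boundary v v"
    "\<And>w. w \<in> T \<Longrightarrow> (\<lambda>n. boundary (lift (\<phi> n)) w) \<longlonglongrightarrow> boundary v w"
proof -
  obtain \<phi> where v: "v \<in> T" and \<phi>: "\<And>n. smooth_fun (\<phi> n)"
    and lim: "(\<lambda>n. full (lift (\<phi> n) - v) (lift (\<phi> n) - v)) \<longlonglongrightarrow> 0"
    using assms unfolding V_iff by blast
  have lT: "lift (\<phi> n) \<in> T" "lift (\<phi> n) - v \<in> T" for n using lift_in_T[OF \<phi>] v full.mem_intros by blast+
  note lims = lim[unfolded full_tendsto_0_iff[OF lT(2)]]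
  show ?thesis
    by (rule that[of \<phi>]) (intro \<phi> lT v mass.tendsto_square dirichlet.tendsto_square
      boundary.tendsto_square boundary.tendsto_left
      lims[THEN conjunct1] lims[THEN conjunct2, THEN conjunct1] lims[THEN conjunct2, THEN conjunct2]; assumption?)+
qed

lemma T_nonneg: "v \<in> T \<Longrightarrow> 0 \<le> mass v v" "v \<in> T \<Longrightarrow> 0 \<le> dirichlet v v" "v \<in> T \<Longrightarrow> 0 \<le> boundary v v"
  using mass.nonneg dirichlet.nonneg boundary.nonneg by auto

lemma mass_le:
  "\<exists>C\<ge>0. \<forall>v\<in>V. mass v v \<le> C * (dirichlet v v + boundary v v)"
proof -
  obtain C where C: "0 \<le> C" and est: "\<And>\<phi>. smooth_fun \<phi> \<Longrightarrow>
      L2sq \<Omega> \<phi> \<le> ennreal C * (L2sq \<Omega> (grad \<phi>) + L2sq F (\<lambda>x. \<phi> (x, 0)))"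
    using poincare_estimate by blast
  have smooth: "mass (lift \<phi>) (lift \<phi>) \<le> C * (dirichlet (lift \<phi>) (lift \<phi>) + boundary (lift \<phi>) (lift \<phi>))"
    if "smooth_fun \<phi>" for \<phi>
    using ennreal_linear_combination_leD[OF est[OF that, unfolded L2sq_lift[OF that] distrib_left]]
      C T_nonneg[OF lift_in_T[OF that]] by (simp add: distrib_left)
  have "mass v v \<le> C * (dirichlet v v + boundary v v)" if v: "v \<in> V" for v
  proof -
    obtain \<phi> where \<phi>: "\<And>n. smooth_fun (\<phi> n)"
      "(\<lambda>n. mass (lift (\<phi> n)) (lift (\<phi> n))) \<longlonglongrightarrow> mass v v"
      "(\<lambda>n. dirichlet (lift (\<phi> n)) (lift (\<phi> n))) \<longlonglongrightarrow> dirichlet v v"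
      "(\<lambda>n. boundary (lift (\<phi> n)) (lift (\<phi> n))) \<longlonglongrightarrow> boundary v v"
      "\<And>w. w \<in> T \<Longrightarrow> (\<lambda>n. boundary (lift (\<phi> n)) w) \<longlonglongrightarrow> boundary v w"
      by (rule V_approximation[OF v]) (rule that)
    show ?thesis
      by (rule LIMSEQ_le[OF \<phi>(2) tendsto_mult_left[OF tendsto_add[OF \<phi>(3,4)]]]) (use smooth \<phi>(1) in blast)
  qed
  then show ?thesis using C by blast
qed

lemma boundary_le_mass:
  assumes "0 < \<epsilon>"
  shows "\<exists>C\<ge>0. \<forall>v\<in>V. boundary v v \<le> \<epsilon> * dirichlet v v + C * mass v v"
proof -
  obtain C where C: "0 \<le> C" and est: "\<And>\<phi>. smooth_fun \<phi> \<Longrightarrow>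
      L2sq F (\<lambda>x. \<phi> (x, 0)) \<le> ennreal \<epsilon> * L2sq \<Omega> (grad \<phi>) + ennreal C * L2sq \<Omega> \<phi>"
    using trace_estimate[OF assms] by blast
  have smooth: "boundary (lift \<phi>) (lift \<phi>) \<le> \<epsilon> * dirichlet (lift \<phi>) (lift \<phi>) + C * mass (lift \<phi>) (lift \<phi>)"
    if "smooth_fun \<phi>" for \<phi>
    using ennreal_linear_combination_leD[OF est[OF that, unfolded L2sq_lift[OF that]]]
      C assms T_nonneg[OF lift_in_T[OF that]] by simp
  have "boundary v v \<le> \<epsilon> * dirichlet v v + C * mass v v" if v: "v \<in> V" for v
  proof -
    obtain \<phi> where \<phi>: "\<And>n. smooth_fun (\<phi> n)"
      "(\<lambda>n. mass (lift (\<phi> n)) (lift (\<phi> n))) \<longlonglongrightarrow> mass v v"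
      "(\<lambda>n. dirichlet (lift (\<phi> n)) (lift (\<phi> n))) \<longlonglongrightarrow> dirichlet v v"
      "(\<lambda>n. boundary (lift (\<phi> n)) (lift (\<phi> n))) \<longlonglongrightarrow> boundary v v"
      "\<And>w. w \<in> T \<Longrightarrow> (\<lambda>n. boundary (lift (\<phi> n)) w) \<longlonglongrightarrow> boundary v w"
      by (rule V_approximation[OF v]) (rule that)
    show ?thesis
      by (rule LIMSEQ_le[OF \<phi>(4) tendsto_add[OF tendsto_mult_left[OF \<phi>(3)] tendsto_mult_left[OF \<phi>(2)]]])
        (use smooth \<phi>(1) in blast)
  qed
  then show ?thesis using C by blast
qed

text \<open>The integral over the interval, not divided by its length. Written as a pairing with a
  fixed triple, it is visibly linear and continuous for the boundary form.\<close>

definition mean :: "real \<times> real \<Rightarrow> sobolev_triple \<Rightarrow> real" where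
  "mean p v = boundary v (0, 0, indicator {fst p..snd p})"

definition admissible_interval :: "real \<times> real \<Rightarrow> bool" where
  "admissible_interval p \<longleftrightarrow> 0 \<le> fst p \<and> fst p \<le> snd p \<and> snd p \<le> l"

lemma indicator_triple_in_T: "(0, 0, indicator {c..d}) \<in> T"
proof -
  have eq: "(norm (indicator {c..d} x :: real))\<^sup>2 = indicator {c..d} x" for x
    by (simp add: indicator_def)
  have "set_integrable lborel F (\<lambda>x. indicator {c..d} x :: real)"
    unfolding set_integrable_def real_scaleR_def indicator_inter_arith[symmetric]
    by (rule integrable_real_indicator) (auto simp: F_eq Int_atLeastAtMost emeasure_lborel_Icc_eq)
  then have "L2_on F (indicator {c..d} :: real \<Rightarrow> real)"
    using F_borel_bounded(2) unfolding L2_on_def eq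
    by (simp add: set_borel_measurable_def)
  then show ?thesis by (simp add: T_def L2_on_zero)
qed

lemma mean_lift:
  assumes "admissible_interval p"
  shows "mean p (lift \<phi>) = (LINT x:{fst p..snd p}|lborel. \<phi> (x, 0))"
proof -
  have "indicator F x * (\<phi> (x, 0) * indicator {fst p..snd p} x) = indicator {fst p..snd p} x * \<phi> (x, 0)" for x
    using assms by (auto simp: indicator_def F_eq admissible_interval_def)
  then show ?thesis
    unfolding mean_def boundary_def lift_def L2_inner_def set_lebesgue_integral_def
      fst_conv snd_conv inner_real_def real_scaleR_def by presburger
qed

lemma mean_sq_le:
  assumes "v \<in> T" "admissible_interval p"
  shows "(mean p v)\<^sup>2 \<le> l * boundary v v"
proof -
  let ?w = "(0, 0, indicator {fst p..snd p}) :: sobolev_triple"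
  have cs: "(mean p v)\<^sup>2 \<le> boundary v v * boundary ?w ?w"
    unfolding mean_def by (rule boundary.cauchy_schwarz[OF assms(1) indicator_triple_in_T])
  have "boundary ?w ?w \<le> l"
  proof -
    have "indicator F x * (indicator {fst p..snd p} x * indicator {fst p..snd p} x) = (indicator {fst p..snd p} x :: real)" for x
      using assms(2) by (auto simp: indicator_def F_eq admissible_interval_def)
    then have "boundary ?w ?w = (LINT x|lborel. indicator {fst p..snd p} x)"
      unfolding boundary_def L2_inner_def set_lebesgue_integral_def
        fst_conv snd_conv inner_real_def real_scaleR_def by presburger
    then show ?thesis
      using assms(2) by (simp add: admissible_interval_def)
  qed
  from order_trans[OF cs mult_left_mono[OF this T_nonneg(3)[OF assms(1)]]]
  show ?thesis by (simp only: mult.commute)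
qed

lemma boundary_le_means:
  assumes "0 < \<epsilon>"
  shows "\<exists>K\<ge>0. \<exists>Q. finite Q \<and> (\<forall>p\<in>Q. admissible_interval p) \<and>
    (\<forall>v\<in>V. boundary v v \<le> \<epsilon> * dirichlet v v + K * (\<Sum>p\<in>Q. (mean p v)\<^sup>2))"
proof -
  obtain K Q where K: "0 \<le> K" and Q: "finite Q" "\<forall>(c, d)\<in>Q. 0 \<le> c \<and> c \<le> d \<and> d \<le> l"
    and est: "\<And>\<phi>. smooth_fun \<phi> \<Longrightarrow> L2sq F (\<lambda>x. \<phi> (x, 0)) \<le> ennreal \<epsilon> * L2sq \<Omega> (grad \<phi>)
      + ennreal K * (\<Sum>(c, d)\<in>Q. ennreal ((LINT x:{c..d}|lborel. \<phi> (x, 0))\<^sup>2))"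
    using compactness_estimate[OF assms] by blast
  have adm: "admissible_interval p" if "p \<in> Q" for p
    using Q(2) that by (auto simp: admissible_interval_def)
  have smooth: "boundary (lift \<phi>) (lift \<phi>) \<le> \<epsilon> * dirichlet (lift \<phi>) (lift \<phi>) + K * (\<Sum>p\<in>Q. (mean p (lift \<phi>))\<^sup>2)"
    if \<phi>: "smooth_fun \<phi>" for \<phi>
  proof -
    have eq1: "(\<Sum>(c, d)\<in>Q. ennreal ((LINT x:{c..d}|lborel. \<phi> (x, 0))\<^sup>2)) = (\<Sum>p\<in>Q. ennreal ((mean p (lift \<phi>))\<^sup>2))"
      by (intro sum.cong refl) (simp add: mean_lift[OF adm] split_beta)
    have eq2: "(\<Sum>p\<in>Q. ennreal ((mean p (lift \<phi>))\<^sup>2)) = ennreal (\<Sum>p\<in>Q. (mean p (lift \<phi>))\<^sup>2)"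
      by (rule sum_ennreal) simp
    show ?thesis
      using ennreal_linear_combination_leD[OF est[OF \<phi>, unfolded L2sq_lift[OF \<phi>] eq1 eq2]]
        K assms T_nonneg[OF lift_in_T[OF \<phi>]] sum_nonneg[of Q "\<lambda>p. (mean p (lift \<phi>))\<^sup>2"] by simp
  qed
  have "boundary v v \<le> \<epsilon> * dirichlet v v + K * (\<Sum>p\<in>Q. (mean p v)\<^sup>2)" if v: "v \<in> V" for v
  proof -
    obtain \<phi> where \<phi>: "\<And>n. smooth_fun (\<phi> n)"
      "(\<lambda>n. mass (lift (\<phi> n)) (lift (\<phi> n))) \<longlonglongrightarrow> mass v v"
      "(\<lambda>n. dirichlet (lift (\<phi> n)) (lift (\<phi> n))) \<longlonglongrightarrow> dirichlet v v"
      "(\<lambda>n. boundary (lift (\<phi> n)) (lift (\<phi> n))) \<longlonglongrightarrow> boundary v v"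
      "\<And>w. w \<in> T \<Longrightarrow> (\<lambda>n. boundary (lift (\<phi> n)) w) \<longlonglongrightarrow> boundary v w"
      by (rule V_approximation[OF v]) (rule that)
    have "(\<lambda>n. mean p (lift (\<phi> n))) \<longlonglongrightarrow> mean p v" for p
      unfolding mean_def by (rule \<phi>(5)[OF indicator_triple_in_T])
    then have "(\<lambda>n. \<epsilon> * dirichlet (lift (\<phi> n)) (lift (\<phi> n)) + K * (\<Sum>p\<in>Q. (mean p (lift (\<phi> n)))\<^sup>2))
        \<longlonglongrightarrow> \<epsilon> * dirichlet v v + K * (\<Sum>p\<in>Q. (mean p v)\<^sup>2)"
      by (intro tendsto_intros \<phi>(3))
    from LIMSEQ_le[OF \<phi>(4) this] show ?thesis using smooth \<phi>(1) by blast
  qed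
  then show ?thesis using K Q(1) adm by blast
qed

text \<open>The Poincare inequality makes \<open>mass\<close> Cauchy as well, so the three
  components converge separately in L2; closedness of \<open>V\<close> ties the limits together
  again.\<close>

lemma V_complete:
  assumes v: "\<And>n. v n \<in> V"
    and cauchy: "\<And>\<epsilon>. 0 < \<epsilon> \<Longrightarrow> \<exists>N. \<forall>m\<ge>N. \<forall>n\<ge>N.
      dirichlet (v m - v n) (v m - v n) + boundary (v m - v n) (v m - v n) < \<epsilon>"
  shows "\<exists>w\<in>V. (\<lambda>n. dirichlet (v n - w) (v n - w) + boundary (v n - w) (v n - w)) \<longlonglongrightarrow> 0"
proof -
  obtain C where C: "0 \<le> C" "\<And>v. v \<in> V \<Longrightarrow> mass v v \<le> C * (dirichlet v v + boundary v v)"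
    using mass_le by blast
  have vT: "v n \<in> T" for n using v V_subset_T by auto
  have dV: "v m - v n \<in> V" for m n using v subspace_diff[OF subspace_V] by blast
  then have dT: "v m - v n \<in> T" for m n using V_subset_T by auto
  have small: "\<exists>N. \<forall>m\<ge>N. \<forall>n\<ge>N. mass (v m - v n) (v m - v n) < \<epsilon> \<and>
      dirichlet (v m - v n) (v m - v n) < \<epsilon> \<and> boundary (v m - v n) (v m - v n) < \<epsilon>" if \<epsilon>: "0 < \<epsilon>" for \<epsilon>
  proof -
    obtain N where N: "\<And>m n. m \<ge> N \<Longrightarrow> n \<ge> N \<Longrightarrow>
        dirichlet (v m - v n) (v m - v n) + boundary (v m - v n) (v m - v n) < \<epsilon> / (C + 1)"
      using cauchy[of "\<epsilon> / (C + 1)"] \<epsilon> C(1) by auto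
    have "mass (v m - v n) (v m - v n) < \<epsilon> \<and>
      dirichlet (v m - v n) (v m - v n) < \<epsilon> \<and> boundary (v m - v n) (v m - v n) < \<epsilon>" if "m \<ge> N" "n \<ge> N" for m n
    proof -
      define X where "X = dirichlet (v m - v n) (v m - v n) + boundary (v m - v n) (v m - v n)"
      have X: "0 \<le> X" "(C + 1) * X < \<epsilon>"
        using N[OF that] C(1) T_nonneg[OF dT[of m n]] by (auto simp: X_def field_simps)
      have "0 \<le> C * X" using C(1) X(1) by simp
      then show ?thesis
        using X C(2)[OF dV[of m n]] T_nonneg[OF dT[of m n]] by (simp add: X_def[symmetric] distrib_right) (simp add: X_def)
    qed
    then show ?thesis by blast
  qed
  have "\<exists>g. L2_on \<Omega> g \<and> (\<lambda>n. L2_inner \<Omega> (fst (v n) - g) (fst (v n) - g)) \<longlonglongrightarrow> 0"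
    by (rule L2_complete) (use vT small in \<open>fastforce simp: T_def mass_def\<close>)+
  then obtain u where u: "L2_on \<Omega> u" "(\<lambda>n. L2_inner \<Omega> (fst (v n) - u) (fst (v n) - u)) \<longlonglongrightarrow> 0" by blast
  have "\<exists>g. L2_on \<Omega> g \<and> (\<lambda>n. L2_inner \<Omega> (fst (snd (v n)) - g) (fst (snd (v n)) - g)) \<longlonglongrightarrow> 0"
    by (rule L2_complete) (use vT small in \<open>fastforce simp: T_def dirichlet_def\<close>)+
  then obtain G where G: "L2_on \<Omega> G" "(\<lambda>n. L2_inner \<Omega> (fst (snd (v n)) - G) (fst (snd (v n)) - G)) \<longlonglongrightarrow> 0" by blast
  have "\<exists>g. L2_on F g \<and> (\<lambda>n. L2_inner F (snd (snd (v n)) - g) (snd (snd (v n)) - g)) \<longlonglongrightarrow> 0"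
    by (rule L2_complete) (use vT small in \<open>fastforce simp: T_def boundary_def\<close>)+
  then obtain g where g: "L2_on F g" "(\<lambda>n. L2_inner F (snd (snd (v n)) - g) (snd (snd (v n)) - g)) \<longlonglongrightarrow> 0" by blast
  define w where "w = (u, G, g)"
  have wT: "w \<in> T" using u g G by (simp add: w_def T_def)
  have vwT: "v n - w \<in> T" for n using vT wT full.mem_intros by blast
  have lims: "(\<lambda>n. mass (v n - w) (v n - w)) \<longlonglongrightarrow> 0" "(\<lambda>n. dirichlet (v n - w) (v n - w)) \<longlonglongrightarrow> 0"
    "(\<lambda>n. boundary (v n - w) (v n - w)) \<longlonglongrightarrow> 0"
    using u g G by (simp_all add: w_def mass_def dirichlet_def boundary_def)
  then have "w \<in> V" by (intro V_closed[OF v wT]) (simp add: full_tendsto_0_iff[OF vwT])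
  moreover have "(\<lambda>n. dirichlet (v n - w) (v n - w) + boundary (v n - w) (v n - w)) \<longlonglongrightarrow> 0"
    using tendsto_add[OF lims(2,3)] by simp
  ultimately show ?thesis by blast
qed

text \<open>For each weight 1/(j + 1) the boundary norm is controlled by finitely many means.
  Altogether these are countably many bounded functionals, so a diagonal subsequence makes all of
  them converge, and the small weight disposes of the bounded energies.\<close>

lemma V_compact:
  assumes v: "\<And>n. v n \<in> V" and M: "\<And>n. dirichlet (v n) (v n) + boundary (v n) (v n) \<le> M"
  shows "\<exists>r :: nat \<Rightarrow> nat. strict_mono r \<and> (\<forall>\<epsilon>>0. \<exists>N. \<forall>m\<ge>N. \<forall>n\<ge>N.
      boundary (v (r m) - v (r n)) (v (r m) - v (r n)) < \<epsilon>)"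
proof -
  have "\<exists>K Q. 0 \<le> K \<and> finite Q \<and> (\<forall>p\<in>Q. admissible_interval p) \<and>
      (\<forall>v\<in>V. boundary v v \<le> 1 / real (Suc j) * dirichlet v v + K * (\<Sum>p\<in>Q. (mean p v)\<^sup>2))" for j
    using boundary_le_means[OF divide_pos_pos[OF zero_less_one of_nat_0_less_iff[THEN iffD2, OF zero_less_Suc]], of j]
    by blast
  then obtain K Q where K: "\<And>j. 0 \<le> K j" and Q: "\<And>j. finite (Q j)" "\<And>j p. p \<in> Q j \<Longrightarrow> admissible_interval p"
    and est: "\<And>j v. v \<in> V \<Longrightarrow> boundary v v \<le> 1 / real (Suc j) * dirichlet v v + K j * (\<Sum>p\<in>Q j. (mean p v)\<^sup>2)"
    by metis
  have vT: "v n \<in> T" for n using v V_subset_T by auto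
  have M0: "0 \<le> M" using M[of 0] T_nonneg[OF vT[of 0]] by simp
  define S where "S = (\<Union>j. Q j)"
  have "countable S" unfolding S_def using Q(1) by (intro countable_UN) (auto intro: countable_finite)
  moreover have "norm (mean p (v n)) \<le> sqrt (l * M)" if "p \<in> S" for n p
  proof -
    have "admissible_interval p" using that Q(2) unfolding S_def by blast
    then have "(mean p (v n))\<^sup>2 \<le> l * boundary (v n) (v n)" by (rule mean_sq_le[OF vT])
    also have "\<dots> \<le> l * M" using M[of n] T_nonneg[OF vT[of n]] l_pos by (intro mult_left_mono) auto
    finally have "sqrt ((mean p (v n))\<^sup>2) \<le> sqrt (l * M)" by (rule real_sqrt_le_mono)
    then show ?thesis by simp
  qed
  ultimately obtain r :: "nat \<Rightarrow> nat" where r: "strict_mono r" "\<And>p. p \<in> S \<Longrightarrow> \<exists>L. (\<lambda>n. mean p (v (r n))) \<longlonglongrightarrow> L"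
    using function_convergent_subsequence[of S "\<lambda>n p. mean p (v n)" "sqrt (l * M)"] by metis
  have "\<exists>N. \<forall>m\<ge>N. \<forall>n\<ge>N. boundary (v (r m) - v (r n)) (v (r m) - v (r n)) < \<epsilon>" if \<epsilon>: "0 < \<epsilon>" for \<epsilon>
  proof -
    \<comment> \<open>The energy of a difference is at most 4M, so this \<open>j\<close> leaves
      \<epsilon>/2 for the means.\<close>
    obtain j where j: "4 * M / (\<epsilon> / 2) < real j" using reals_Archimedean2 by blast
    have jM: "1 / real (Suc j) * (4 * M) < \<epsilon> / 2"
    proof -
      have "4 * M / (\<epsilon> / 2) < real (Suc j)" using j by simp
      then show ?thesis using \<epsilon> by (simp add: field_simps)
    qed
    \<comment> \<open>Distributes the other \<epsilon>/2 over the means; the summands 1 guard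
      against \<open>K j = 0\<close> and an empty \<open>Q j\<close>.\<close>
    define \<eta> where "\<eta> = \<epsilon> / (2 * (K j + 1) * (real (card (Q j)) + 1))"
    have \<eta>: "0 < \<eta>" using \<epsilon> K[of j] by (simp add: \<eta>_def)
    have "\<exists>N. \<forall>m\<ge>N. \<forall>n\<ge>N. (mean p (v (r m)) - mean p (v (r n)))\<^sup>2 < \<eta>" if p: "p \<in> Q j" for p
    proof -
      have "Cauchy (\<lambda>n. mean p (v (r n)))"
        using r(2)[of p] p LIMSEQ_imp_Cauchy unfolding S_def by blast
      then obtain N where N: "\<And>m n. m \<ge> N \<Longrightarrow> n \<ge> N \<Longrightarrow> \<bar>mean p (v (r m)) - mean p (v (r n))\<bar> < sqrt \<eta>"
        using \<eta> unfolding Cauchy_def dist_real_def by (metis real_sqrt_gt_zero)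
      have "(mean p (v (r m)) - mean p (v (r n)))\<^sup>2 < \<eta>" if "m \<ge> N" "n \<ge> N" for m n
        using power_strict_mono[OF N[OF that], of 2] \<eta> by simp
      then show ?thesis by blast
    qed
    then obtain N where N: "\<And>p m n. p \<in> Q j \<Longrightarrow> m \<ge> N p \<Longrightarrow> n \<ge> N p \<Longrightarrow> (mean p (v (r m)) - mean p (v (r n)))\<^sup>2 < \<eta>"
      by metis
    have "boundary (v (r m) - v (r n)) (v (r m) - v (r n)) < \<epsilon>"
      if mn: "m \<ge> (\<Sum>p\<in>Q j. N p)" "n \<ge> (\<Sum>p\<in>Q j. N p)" for m n
    proof -
      let ?d = "v (r m) - v (r n)"
      have dV: "?d \<in> V" using v subspace_diff[OF subspace_V] by blast
      have "mean p ?d = mean p (v (r m)) - mean p (v (r n))" for p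
        unfolding mean_def by (rule boundary.diff_left[OF vT vT indicator_triple_in_T])
      moreover have "N p \<le> (\<Sum>p\<in>Q j. N p)" if "p \<in> Q j" for p
        using that Q(1) by (intro member_le_sum) auto
      ultimately have "(\<Sum>p\<in>Q j. (mean p ?d)\<^sup>2) \<le> (\<Sum>p\<in>Q j. \<eta>)"
        using N mn by (intro sum_mono) (smt (verit) le_trans)
      also have "\<dots> \<le> (real (card (Q j)) + 1) * \<eta>" using \<eta> by simp
      finally have "K j * (\<Sum>p\<in>Q j. (mean p ?d)\<^sup>2) \<le> (K j + 1) * ((real (card (Q j)) + 1) * \<eta>)"
        using K[of j] by (intro mult_mono) (auto intro: sum_nonneg)
      also have "\<dots> = \<epsilon> / 2"
      proof -
        have "(x * (y * (e / (2 * x * y)))) = e / 2" if "0 < x" "0 < y" for x y e :: real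
          using that by simp
        from this[of "K j + 1" "real (card (Q j)) + 1" \<epsilon>] show ?thesis using K[of j] by (simp add: \<eta>_def)
      qed
      finally have 1: "K j * (\<Sum>p\<in>Q j. (mean p ?d)\<^sup>2) \<le> \<epsilon> / 2" .
      have "dirichlet ?d ?d \<le> 4 * M"
        using dirichlet.diff_le[OF vT vT, of "r m" "r n"] M[of "r m"] M[of "r n"]
          T_nonneg[OF vT[of "r m"]] T_nonneg[OF vT[of "r n"]] by linarith
      then have "1 / real (Suc j) * dirichlet ?d ?d \<le> 1 / real (Suc j) * (4 * M)"
        by (intro mult_left_mono) auto
      then show ?thesis using est[OF dV, of j] 1 jM by linarith
    qed
    then show ?thesis by blast
  qed
  then show ?thesis using r(1) by blast
qed

sublocale forms: compact_form_pair V dirichlet boundary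
proof (intro compact_form_pair.intro compact_form_pair_axioms.intro)
  show "psd_form V dirichlet" "psd_form V boundary"
    using psd_T subspace_V V_subset_T by (blast intro: psd_form_subspace)+
qed (use V_complete V_compact in blast)+

end

section \<open>Trial functions\<close>

definition trial :: "real \<Rightarrow> real \<times> real \<Rightarrow> real" where
  "trial \<mu> = (\<lambda>(x, y). cos (\<mu> * x) * exp (\<mu> * y))"

lemma trial_smooth:
  "smooth_fun (trial \<mu>)"
  "grad (trial \<mu>) (x, y) = (- \<mu> * sin (\<mu> * x) * exp (\<mu> * y), \<mu> * cos (\<mu> * x) * exp (\<mu> * y))"
proof -
  \<comment> \<open>Each derivative of the cosine is a phase shift by \<open>pi / 2\<close>, which
    gives all mixed partial derivatives in one formula.\<close>
  define P where "P i j z = \<mu> ^ i * cos (\<mu> * fst z + real i * (pi / 2)) * (\<mu> ^ j * exp (\<mu> * snd z))" for i j and z :: "real \<times> real"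
  have shift: "cos (t + real (Suc i) * (pi / 2)) = - sin (t + real i * (pi / 2))" for t i
  proof -
    have "t + real (Suc i) * (pi / 2) = (t + real i * (pi / 2)) + pi / 2" by (simp add: algebra_simps)
    then show ?thesis by (simp only: cos_add cos_pi_half sin_pi_half mult_zero_right mult_1_right diff_0)
  qed
  have D: "(P i j has_derivative (\<lambda>v. P (Suc i) j z * fst v + P i (Suc j) z * snd v)) (at z)" for i j z
    unfolding P_def shift by (auto intro!: derivative_eq_intros simp: algebra_simps)
  have P0: "P 0 0 = trial \<mu>" by (auto simp: P_def trial_def)
  show "smooth_fun (trial \<mu>)"
    unfolding smooth_fun_def using D P0 by blast
  have "grad (trial \<mu>) (x, y) = (P 1 0 (x, y), P 0 1 (x, y))"
    using D[of 0 0 "(x, y)"] by (intro grad_eqI) (simp add: P0)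
  then show "grad (trial \<mu>) (x, y) = (- \<mu> * sin (\<mu> * x) * exp (\<mu> * y), \<mu> * cos (\<mu> * x) * exp (\<mu> * y))"
    using shift[of "\<mu> * x" 0] by (simp add: P_def)
qed

lemma integral_cos_frequency:
  assumes "0 < l" "m \<in> \<int>"
  shows "(LINT x:{0..l}|lborel. cos (pi * m / l * x)) = (if m = 0 then l else 0)"
proof (cases "m = 0")
  case True
  then show ?thesis using assms(1) by (simp add: set_lebesgue_integral_def)
next
  case False
  define a where "a = pi * m / l"
  have a: "a \<noteq> 0" "a * l = m * pi" using False assms(1) by (auto simp: a_def)
  have "(LINT x:{0..l}|lborel. cos (a * x)) = sin (a * l) / a - sin (a * 0) / a"
    unfolding set_lebesgue_integral_def
  proof (rule integral_FTC_Icc)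
    show "((\<lambda>x. sin (a * x) / a) has_vector_derivative cos (a * x)) (at x within {0..l})" for x
      unfolding has_real_derivative_iff_has_vector_derivative[symmetric]
      using a(1) by (auto intro!: derivative_eq_intros)
  qed (use assms(1) in \<open>auto intro!: continuous_intros\<close>)
  also have "\<dots> = 0" using assms(2) unfolding a(2) by (simp add: sin_times_pi_eq_0)
  finally show ?thesis using False by (simp add: a_def)
qed

lemma set_integral_double_sum:
  fixes g :: "nat \<Rightarrow> nat \<Rightarrow> real \<Rightarrow> real"
  assumes "\<And>i j. continuous_on UNIV (g i j)"
  shows "(LINT x:{a..b}|lborel. \<Sum>i\<le>k. \<Sum>j\<le>k. g i j x) = (\<Sum>i\<le>k. \<Sum>j\<le>k. LINT x:{a..b}|lborel. g i j x)"
proof -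
  have int: "integrable lborel (\<lambda>x. indicator {a..b} x *\<^sub>R g i j x)" for i j
    using borel_integrable_atLeastAtMost'[OF continuous_on_subset[OF assms subset_UNIV]]
    by (simp add: set_integrable_def)
  show ?thesis
    unfolding set_lebesgue_integral_def scaleR_sum_right
    by (simp only: Bochner_Integration.integral_sum Bochner_Integration.integrable_sum int)
qed

lemma square_sum_double:
  fixes a :: "nat \<Rightarrow> real"
  shows "(\<Sum>i\<le>k. a i)\<^sup>2 = (\<Sum>i\<le>k. \<Sum>j\<le>k. a i * a j)"
  by (simp add: power2_eq_square sum_product)

lemma double_sum_diagonal:
  fixes D :: "nat \<Rightarrow> nat \<Rightarrow> real"
  assumes "\<And>i j. i \<noteq> j \<Longrightarrow> D i j = 0"
  shows "(\<Sum>i\<le>k. \<Sum>j\<le>k. D i j) = (\<Sum>i\<le>k. D i i)"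
proof (rule sum.cong[OF refl])
  fix i assume "i \<in> {..k}"
  have "(\<Sum>j\<le>k. D i j) = (\<Sum>j\<le>k. if j = i then D i i else 0)"
    by (intro sum.cong refl) (use assms in auto)
  then show "(\<Sum>j\<le>k. D i j) = D i i" using \<open>i \<in> {..k}\<close> by simp
qed

lemma nn_integral_Icc_continuous:
  fixes g :: "real \<Rightarrow> real"
  assumes "continuous_on UNIV g" "\<And>x. 0 \<le> g x"
  shows "(\<integral>\<^sup>+x\<in>{a..b}. ennreal (g x) \<partial>lborel) = ennreal (LINT x:{a..b}|lborel. g x)"
proof -
  have "integrable lborel (\<lambda>x. indicator {a..b} x *\<^sub>R g x)"
    using borel_integrable_atLeastAtMost'[OF continuous_on_subset[OF assms(1) subset_UNIV]]
    by (simp add: set_integrable_def)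
  then have "(\<integral>\<^sup>+x. ennreal (indicator {a..b} x *\<^sub>R g x) \<partial>lborel) = ennreal (LINT x:{a..b}|lborel. g x)"
    unfolding set_lebesgue_integral_def using assms(2) by (intro nn_integral_eq_integral) auto
  moreover have "ennreal (indicator {a..b} x *\<^sub>R g x) = ennreal (g x) * indicator {a..b} x" for x
    by (simp add: indicator_def)
  ultimately show ?thesis by simp
qed

lemma smooth_fun_sum:
  fixes k :: nat
  assumes "\<And>j. smooth_fun (\<phi> j)"
  shows "smooth_fun (\<Sum>j\<le>k. c j *\<^sub>R \<phi> j)"
    "grad (\<Sum>j\<le>k. c j *\<^sub>R \<phi> j) = (\<Sum>j\<le>k. c j *\<^sub>R grad (\<phi> j))"
    "lift (\<Sum>j\<le>k. c j *\<^sub>R \<phi> j) = (\<Sum>j\<le>k. c j *\<^sub>R lift (\<phi> j))"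
proof -
  have "smooth_fun (\<Sum>j\<le>k. c j *\<^sub>R \<phi> j) \<and>
      grad (\<Sum>j\<le>k. c j *\<^sub>R \<phi> j) = (\<Sum>j\<le>k. c j *\<^sub>R grad (\<phi> j)) \<and>
      lift (\<Sum>j\<le>k. c j *\<^sub>R \<phi> j) = (\<Sum>j\<le>k. c j *\<^sub>R lift (\<phi> j))"
  proof (induction k)
    case 0
    show ?case
      by (simp only: atMost_0 sum.insert finite.emptyI empty_iff sum.empty add_0_right
          not_False_eq_True smooth_fun_scaleR lift_scaleR assms)
  next
    case (Suc k)
    then show ?case
      by (simp only: sum.atMost_Suc smooth_fun_add smooth_fun_scaleR lift_add lift_scaleR assms)
  qed
  then show "smooth_fun (\<Sum>j\<le>k. c j *\<^sub>R \<phi> j)"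
    "grad (\<Sum>j\<le>k. c j *\<^sub>R \<phi> j) = (\<Sum>j\<le>k. c j *\<^sub>R grad (\<phi> j))"
    "lift (\<Sum>j\<le>k. c j *\<^sub>R \<phi> j) = (\<Sum>j\<le>k. c j *\<^sub>R lift (\<phi> j))"
    by blast+
qed

lemma sum_fun_apply: "(\<Sum>j\<in>A. f j) x = (\<Sum>j\<in>A. f j x)"
  by (induction A rule: infinite_finite_induct) auto

section \<open>Boundary norm and energy of trial combinations\<close>

context sloshing_domain
begin

definition freq :: "nat \<Rightarrow> real" where
  "freq k = pi * real k / l"

text \<open>Squared L2 norm on the interval of the cosine with frequency \<open>freq j\<close>; the
  constant function is the exception.\<close>

definition trial_weight :: "nat \<Rightarrow> real" where
  "trial_weight j = (if j = 0 then l else l / 2)"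

text \<open>The product-to-sum formula leaves cosines whose frequencies are differences and sums of
  indices. A vanishing difference gives l/2; a vanishing sum, possible only for
  \<open>i = j = 0\<close>, gives another l/2.\<close>

lemma boundary_trial_sum:
  "boundary (\<Sum>j\<le>k. c j *\<^sub>R lift (trial (freq j))) (\<Sum>j\<le>k. c j *\<^sub>R lift (trial (freq j)))
    = (\<Sum>j\<le>k. (c j)\<^sup>2 * trial_weight j)"
proof -
  have comp: "snd (snd (\<Sum>j\<le>k. c j *\<^sub>R lift (trial (freq j)))) x = (\<Sum>j\<le>k. c j * cos (freq j * x))" for x
    by (simp add: snd_sum sum_fun_apply lift_def trial_def)
  have orth: "(LINT x:{0..l}|lborel. c i * cos (freq i * x) * (c j * cos (freq j * x)))
      = (if i = j then (c j)\<^sup>2 * trial_weight j else 0)" for i j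
  proof -
    have eq: "c i * cos (freq i * x) * (c j * cos (freq j * x))
        = c i * c j / 2 * (cos (pi * (real i - real j) / l * x) + cos (pi * (real i + real j) / l * x))" for x
      by (simp add: freq_def cos_times_cos algebra_simps diff_divide_distrib add_divide_distrib)
    have int: "set_integrable lborel {0..l} (\<lambda>x. cos (a * x))" for a :: real
      by (rule borel_integrable_atLeastAtMost') (intro continuous_intros)
    have "(LINT x:{0..l}|lborel. c i * cos (freq i * x) * (c j * cos (freq j * x)))
        = c i * c j / 2 * ((LINT x:{0..l}|lborel. cos (pi * (real i - real j) / l * x))
          + (LINT x:{0..l}|lborel. cos (pi * (real i + real j) / l * x)))"
      unfolding eq set_integral_mult_right set_integral_add(2)[OF int int] ..
    also have "\<dots> = (if i = j then (c j)\<^sup>2 * trial_weight j else 0)"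
      using l_pos by (subst (1 2) integral_cos_frequency) (auto simp: trial_weight_def power2_eq_square)
    finally show ?thesis .
  qed
  have "boundary (\<Sum>j\<le>k. c j *\<^sub>R lift (trial (freq j))) (\<Sum>j\<le>k. c j *\<^sub>R lift (trial (freq j)))
      = (LINT x:{0..l}|lborel. (\<Sum>i\<le>k. \<Sum>j\<le>k. c i * cos (freq i * x) * (c j * cos (freq j * x))))"
    unfolding boundary_def L2_inner_def comp inner_real_def power2_eq_square[symmetric] square_sum_double
    unfolding F_eq ..
  also have "\<dots> = (\<Sum>i\<le>k. \<Sum>j\<le>k. (if i = j then (c j)\<^sup>2 * trial_weight j else 0))"
    unfolding orth[symmetric] by (intro set_integral_double_sum continuous_intros)
  also have "\<dots> = (\<Sum>j\<le>k. (c j)\<^sup>2 * trial_weight j)"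
    by (subst double_sum_diagonal) auto
  finally show ?thesis .
qed

lemma freq_nonneg: "0 \<le> freq j"
  using l_pos by (simp add: freq_def)

text \<open>The John condition puts \<Omega> in a box below \<open>F\<close>, and extending the
  integral of the energy density to the box can only increase it. On each horizontal slice the sine
  and cosine parts of the gradient combine into cosines of difference frequencies, so distinct
  frequencies are orthogonal.\<close>

lemma dirichlet_trial_sum_le:
  "dirichlet (\<Sum>j\<le>k. c j *\<^sub>R lift (trial (freq j))) (\<Sum>j\<le>k. c j *\<^sub>R lift (trial (freq j)))
    \<le> (\<Sum>j\<le>k. (c j)\<^sup>2 * (freq j * (l / 2)))"
proof -
  define w where "w = (\<Sum>j\<le>k. c j *\<^sub>R trial (freq j))"
  have w: "smooth_fun w" "lift w = (\<Sum>j\<le>k. c j *\<^sub>R lift (trial (freq j)))"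
    "grad w = (\<Sum>j\<le>k. c j *\<^sub>R grad (trial (freq j)))"
    unfolding w_def by (rule smooth_fun_sum; rule trial_smooth)+
  obtain Y where Y: "0 \<le> Y" "\<Omega> \<subseteq> {0..l} \<times> {-Y..0}"
  proof -
    obtain Y where Y: "\<forall>z\<in>\<Omega>. norm z \<le> Y" using domain(4) bounded_iff by blast
    have "(x, y) \<in> {0..l} \<times> {- max 0 Y..0}" if xy: "(x, y) \<in> \<Omega>" for x y
    proof -
      have "norm (x, y) \<le> Y" using Y xy by blast
      then have "\<bar>y\<bar> \<le> Y" using norm_snd_le[where x = x and y = y] by simp
      then show ?thesis using domain_subset[OF xy] by auto
    qed
    then have "\<Omega> \<subseteq> {0..l} \<times> {- max 0 Y..0}" by auto
    then show ?thesis using that[of "max 0 Y"] by simp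
  qed
  \<comment> \<open>Energy of the box on the slice at height \<open>y\<close>. Its primitive in
    \<open>y\<close> has coefficients \<open>freq j * (l / 2)\<close>, because the exponent
    \<open>2 * freq j\<close> cancels one power of the frequency and a factor 2.\<close>
  define I where "I y = (\<Sum>j\<le>k. (c j)\<^sup>2 * ((freq j)\<^sup>2 * exp (2 * freq j * y)) * l)" for y
  define b where "b i y = c i * (freq i * exp (freq i * y))" for i y
  have normsq: "(norm (grad w (x, y)))\<^sup>2 = (\<Sum>i\<le>k. \<Sum>j\<le>k. b i y * b j y * cos (pi * (real i - real j) / l * x))" for x y
  proof -
    have "grad w (x, y) = (- (\<Sum>j\<le>k. b j y * sin (freq j * x)), \<Sum>j\<le>k. b j y * cos (freq j * x))"
      unfolding w(3) sum_fun_apply b_def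
      by (simp add: trial_smooth sum_prod sum_negf[symmetric] algebra_simps scaleR_prod_def prod_eq_iff fst_sum snd_sum)
    then have "(norm (grad w (x, y)))\<^sup>2 = (\<Sum>j\<le>k. b j y * sin (freq j * x))\<^sup>2 + (\<Sum>j\<le>k. b j y * cos (freq j * x))\<^sup>2"
      by (simp add: norm_Pair)
    also have "\<dots> = (\<Sum>i\<le>k. \<Sum>j\<le>k. b i y * b j y * cos (pi * (real i - real j) / l * x))"
      unfolding square_sum_double sum.distrib[symmetric]
    proof (intro sum.cong refl)
      fix i j
      have arg: "pi * (real i - real j) / l * x = freq i * x - freq j * x"
        by (simp add: freq_def algebra_simps diff_divide_distrib)
      show "b i y * sin (freq i * x) * (b j y * sin (freq j * x)) + b i y * cos (freq i * x) * (b j y * cos (freq j * x))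
          = b i y * b j y * cos (pi * (real i - real j) / l * x)"
        unfolding arg cos_diff by (simp add: algebra_simps)
    qed
    finally show ?thesis .
  qed
  have slice: "(LINT x:{0..l}|lborel. (norm (grad w (x, y)))\<^sup>2) = I y" for y
  proof -
    have "(LINT x:{0..l}|lborel. (norm (grad w (x, y)))\<^sup>2)
        = (\<Sum>i\<le>k. \<Sum>j\<le>k. LINT x:{0..l}|lborel. b i y * b j y * cos (pi * (real i - real j) / l * x))"
      unfolding normsq by (intro set_integral_double_sum continuous_intros)
    also have "\<dots> = (\<Sum>i\<le>k. \<Sum>j\<le>k. b i y * b j y * (if i = j then l else 0))"
      unfolding set_integral_mult_right
      by (intro sum.cong refl, subst integral_cos_frequency[OF l_pos]) auto
    also have "\<dots> = (\<Sum>i\<le>k. b i y * b i y * l)"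
      by (subst double_sum_diagonal) auto
    also have "\<dots> = I y"
      unfolding I_def b_def
      by (intro sum.cong refl) (simp add: power2_eq_square exp_add[symmetric] algebra_simps mult_exp_exp)
    finally show ?thesis .
  qed
  note [measurable] = smooth_fun_borel[OF w(1)]
  have [measurable]: "{0..l} \<times> {-Y..0} \<in> sets borel"
    by (intro borel_closed closed_Times) auto
  have "ennreal (dirichlet (lift w) (lift w)) = L2sq \<Omega> (grad w)"
    by (rule L2sq_lift(2)[OF w(1), symmetric])
  also have "\<dots> \<le> L2sq ({0..l} \<times> {-Y..0}) (grad w)" by (rule L2sq_mono[OF Y(2)])
  also have "\<dots> = (\<integral>\<^sup>+y. (\<integral>\<^sup>+x. ennreal ((norm (grad w (x, y)))\<^sup>2) * indicator ({0..l} \<times> {-Y..0}) (x, y) \<partial>lborel) \<partial>lborel)"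
    unfolding L2sq_def
    by (subst lborel_prod[symmetric], rule lborel_pair.nn_integral_snd[symmetric])
       (simp add: lborel_prod)
  also have "\<dots> = (\<integral>\<^sup>+y\<in>{-Y..0}. (\<integral>\<^sup>+x\<in>{0..l}. ennreal ((norm (grad w (x, y)))\<^sup>2) \<partial>lborel) \<partial>lborel)"
    by (intro nn_integral_cong) (auto simp: indicator_def)
  also have "\<dots> = (\<integral>\<^sup>+y\<in>{-Y..0}. ennreal (I y) \<partial>lborel)"
  proof -
    have "continuous_on UNIV (\<lambda>x. (norm (grad w (x, y)))\<^sup>2)" for y
      by (intro continuous_intros continuous_on_compose2[OF smooth_fun_continuous(2)[OF w(1)]]) auto
    then show ?thesis by (subst nn_integral_Icc_continuous) (auto simp: slice)
  qed
  also have "\<dots> = ennreal (LINT y:{-Y..0}|lborel. I y)"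
    using l_pos unfolding I_def[abs_def]
    by (intro nn_integral_Icc_continuous continuous_intros sum_nonneg) auto
  also have "(LINT y:{-Y..0}|lborel. I y)
      = (\<Sum>j\<le>k. (c j)\<^sup>2 * (freq j * (l / 2)) * exp (2 * freq j * 0)) - (\<Sum>j\<le>k. (c j)\<^sup>2 * (freq j * (l / 2)) * exp (2 * freq j * (- Y)))"
    unfolding set_lebesgue_integral_def
  proof (rule integral_FTC_Icc)
    show "- Y \<le> 0" using Y by simp
    show "continuous_on {- Y..0} I" unfolding I_def[abs_def] by (intro continuous_intros)
    show "((\<lambda>y. \<Sum>j\<le>k. (c j)\<^sup>2 * (freq j * (l / 2)) * exp (2 * freq j * y)) has_vector_derivative I y) (at y within {- Y..0})" for y
      unfolding has_real_derivative_iff_has_vector_derivative[symmetric] I_def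
      by (auto intro!: derivative_eq_intros sum.cong simp: power2_eq_square algebra_simps)
  qed
  finally have "dirichlet (lift w) (lift w) \<le> (\<Sum>j\<le>k. (c j)\<^sup>2 * (freq j * (l / 2))) - (\<Sum>j\<le>k. (c j)\<^sup>2 * (freq j * (l / 2)) * exp (2 * freq j * (- Y)))"
    (is "_ \<le> ?R")
  proof -
    \<comment> \<open>The right-hand side has to be nonnegative before a real inequality can be read
      off, since \<open>ennreal\<close> truncates negative numbers to 0.\<close>
    have "exp (2 * freq j * (- Y)) \<le> 1" for j using freq_nonneg[of j] Y(1) by simp
    then have "0 \<le> ?R"
      using freq_nonneg l_pos unfolding sum_subtractf[symmetric]
      by (intro sum_nonneg) (simp add: mult_left_le)
    moreover assume "ennreal (dirichlet (lift w) (lift w))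
      \<le> ennreal ((\<Sum>j\<le>k. (c j)\<^sup>2 * (freq j * (l / 2)) * exp (2 * freq j * 0)) - (\<Sum>j\<le>k. (c j)\<^sup>2 * (freq j * (l / 2)) * exp (2 * freq j * (- Y))))"
    ultimately show ?thesis by (simp add: ennreal_le_iff)
  qed
  also have "\<dots> \<le> (\<Sum>j\<le>k. (c j)\<^sup>2 * (freq j * (l / 2)))"
    using freq_nonneg l_pos by (simp add: sum_nonneg)
  finally show ?thesis unfolding w(2) .
qed

text \<open>Compared coefficient by coefficient: the frequencies increase with \<open>j\<close>, and
  \<open>trial_weight j\<close> is at least l/2.\<close>

lemma trial_rayleigh:
  "dirichlet (\<Sum>j\<le>k. c j *\<^sub>R lift (trial (freq j))) (\<Sum>j\<le>k. c j *\<^sub>R lift (trial (freq j)))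
    \<le> freq k * boundary (\<Sum>j\<le>k. c j *\<^sub>R lift (trial (freq j))) (\<Sum>j\<le>k. c j *\<^sub>R lift (trial (freq j)))"
proof -
  have "freq j * (l / 2) \<le> freq k * trial_weight j" if "j \<le> k" for j
  proof (rule mult_mono)
    show "freq j \<le> freq k" using that l_pos by (simp add: freq_def divide_right_mono)
  qed (use l_pos freq_nonneg in \<open>auto simp: trial_weight_def\<close>)
  then have "(\<Sum>j\<le>k. (c j)\<^sup>2 * (freq j * (l / 2))) \<le> (\<Sum>j\<le>k. (c j)\<^sup>2 * (freq k * trial_weight j))"
    by (intro sum_mono mult_left_mono) auto
  also have "\<dots> = freq k * (\<Sum>j\<le>k. (c j)\<^sup>2 * trial_weight j)"
    by (simp add: sum_distrib_left ac_simps)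
  finally show ?thesis
    unfolding boundary_trial_sum using dirichlet_trial_sum_le[of c k] by linarith
qed

lemma trial_definite:
  assumes "\<exists>j\<le>k. c j \<noteq> 0"
  shows "0 < boundary (\<Sum>j\<le>k. c j *\<^sub>R lift (trial (freq j))) (\<Sum>j\<le>k. c j *\<^sub>R lift (trial (freq j)))"
proof -
  obtain j where j: "j \<le> k" "c j \<noteq> 0" using assms by blast
  have w: "0 < trial_weight j" for j using l_pos by (simp add: trial_weight_def)
  show ?thesis
    unfolding boundary_trial_sum
    by (rule sum_pos2[of _ j]) (use j w mult_nonneg_nonneg[OF zero_le_power2 less_imp_le[OF w]] in auto)
qed

lemma eigenvectors_exist:
  "\<exists>e \<nu>. \<forall>i<N::nat. e i \<in> V \<and> \<nu> i \<le> freq i \<and> (\<forall>v\<in>V. dirichlet (e i) v = \<nu> i * boundary (e i) v) \<and>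
      (\<forall>j<N. boundary (e i) (e j) = (if i = j then 1 else 0))"
  by (rule forms.eigenvectors_below_trial_bounds[where \<phi> = "\<lambda>j. lift (trial (freq j))"])
     (intro lift_in_V trial_smooth trial_rayleigh trial_definite; assumption)+

end

section \<open>Riesz means\<close>

text \<open>Convexity of the power: the slope at the upper end point bounds the slope of the
  chord.\<close>

lemma powr_tangent_le:
  fixes p q \<gamma> :: real
  assumes "0 \<le> q" "q < p" "1 \<le> \<gamma>"
  shows "p powr \<gamma> - q powr \<gamma> \<le> \<gamma> * (p - q) * p powr (\<gamma> - 1)"
proof -
  \<comment> \<open>Differentiability is claimed on the open interval only, as \<open>q\<close> may
    be 0.\<close>
  have deriv: "((\<lambda>x. x powr \<gamma>) has_real_derivative \<gamma> * x powr (\<gamma> - 1)) (at x)" if "q < x" "x < p" for x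
    using that assms by (auto intro!: derivative_eq_intros)
  have "\<exists>d x. q < x \<and> x < p \<and> ((\<lambda>x. x powr \<gamma>) has_real_derivative d) (at x) \<and> p powr \<gamma> - q powr \<gamma> = (p - q) * d"
  proof (rule MVT[OF assms(2)])
    show "continuous_on {q..p} (\<lambda>x. x powr \<gamma>)"
      using assms by (intro continuous_on_powr') (auto intro!: continuous_intros)
    show "(\<lambda>x. x powr \<gamma>) differentiable (at x)" if "q < x" "x < p" for x
      using deriv[OF that] by (auto simp: real_differentiable_def)
  qed
  then obtain x d where x: "q < x" "x < p" "((\<lambda>x. x powr \<gamma>) has_real_derivative d) (at x)"
    "p powr \<gamma> - q powr \<gamma> = (p - q) * d" by blast
  have "d = \<gamma> * x powr (\<gamma> - 1)" by (rule DERIV_unique[OF x(3) deriv[OF x(1,2)]])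
  moreover have "x powr (\<gamma> - 1) \<le> p powr (\<gamma> - 1)"
    using x assms by (intro powr_mono2) auto
  then have "(p - q) * (\<gamma> * x powr (\<gamma> - 1)) \<le> (p - q) * (\<gamma> * p powr (\<gamma> - 1))"
    using assms by (intro mult_left_mono) auto
  ultimately show ?thesis using x(4) by (simp add: ac_simps)
qed

lemma trapezoid_powr:
  fixes p q \<gamma> :: real
  assumes q: "0 \<le> q" and qp: "q \<le> p" and \<gamma>: "1 \<le> \<gamma>"
  shows "(p powr (\<gamma> + 1) - q powr (\<gamma> + 1)) / (\<gamma> + 1) \<le> (p - q) * (p powr \<gamma> + q powr \<gamma>) / 2"
proof -
  \<comment> \<open>The error of the trapezoidal rule as a function of the right end point. Its
    derivative is half the gap in the tangent inequality, hence nonnegative.\<close>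
  define h where "h x = (x - q) * (x powr \<gamma> + q powr \<gamma>) / 2 - (x powr (\<gamma> + 1) - q powr (\<gamma> + 1)) / (\<gamma> + 1)" for x
  have "h q \<le> h p"
  proof (rule DERIV_nonneg_imp_increasing_open[OF qp])
    fix x assume x: "q < x" "x < p"
    have d0: "((\<lambda>x. x powr \<gamma>) has_real_derivative \<gamma> * x powr (\<gamma> - 1)) (at x)"
      using x q by (auto intro!: derivative_eq_intros)
    have d1: "((\<lambda>x. x powr (\<gamma> + 1)) has_real_derivative (\<gamma> + 1) * x powr \<gamma>) (at x)"
      using x q by (auto intro!: derivative_eq_intros)
    have "(h has_real_derivative
        ((x powr \<gamma> + q powr \<gamma>) + (x - q) * (\<gamma> * x powr (\<gamma> - 1))) / 2 - x powr \<gamma>) (at x)"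
      unfolding h_def[abs_def]
      by (rule DERIV_cong[OF DERIV_diff[OF
            DERIV_cdivide[OF DERIV_mult[OF DERIV_diff[OF DERIV_ident DERIV_const] DERIV_add[OF d0 DERIV_const]]]
            DERIV_cdivide[OF DERIV_diff[OF d1 DERIV_const]]]])
         (use \<gamma> in \<open>simp add: add.commute mult.commute\<close>)
    moreover have "0 \<le> ((x powr \<gamma> + q powr \<gamma>) + (x - q) * (\<gamma> * x powr (\<gamma> - 1))) / 2 - x powr \<gamma>"
      using powr_tangent_le[OF q x(1) \<gamma>] by (simp add: field_simps)
    ultimately show "\<exists>y. (h has_real_derivative y) (at x) \<and> 0 \<le> y" by blast
  next
    show "continuous_on {q..p} h"
      unfolding h_def[abs_def] using q \<gamma>
      by (intro continuous_intros continuous_on_powr') auto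
  qed
  then show ?thesis by (simp add: h_def)
qed

text \<open>The one-cell bound at the nodes \<open>z - h * i\<close>, truncated at 0, telescopes.
  The rule weights the node \<open>i = 0\<close> by \<open>h / 2\<close>, while the sum counts it
  fully; the surplus half is the term \<open>z powr \<gamma> / 2\<close>. The last node
  \<open>N\<close> is truncated to 0.\<close>

lemma trapezoid_riesz:
  fixes h z \<gamma> :: real
  assumes h: "0 < h" and z: "0 < z" and \<gamma>: "1 \<le> \<gamma>" and N: "z \<le> h * real N"
  shows "z powr (\<gamma> + 1) / (h * (\<gamma> + 1)) + z powr \<gamma> / 2 \<le> (\<Sum>i<N. max 0 (z - h * real i) powr \<gamma>)"
proof -
  define f where "f i = max 0 (z - h * real i) powr \<gamma>" for i
  define g where "g i = max 0 (z - h * real i) powr (\<gamma> + 1) / (\<gamma> + 1)" for i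
  have step: "g i - g (Suc i) \<le> h * (f i + f (Suc i)) / 2" for i
  proof -
    define p where "p = max 0 (z - h * real i)"
    define q where "q = max 0 (z - h * real (Suc i))"
    have "z - h * real (Suc i) \<le> z - h * real i" using h by simp
    then have pq: "0 \<le> q" "q \<le> p" unfolding p_def q_def by (auto intro: max.mono)
    \<comment> \<open>Truncation at 0 can shorten a cell but not lengthen it.\<close>
    have "p - q \<le> h" using h by (auto simp: p_def q_def max_def algebra_simps)
    then have "(p - q) * (p powr \<gamma> + q powr \<gamma>) / 2 \<le> h * (p powr \<gamma> + q powr \<gamma>) / 2"
      by (intro divide_right_mono mult_right_mono) auto
    then show ?thesis
      using trapezoid_powr[OF pq \<gamma>] by (simp add: g_def f_def p_def q_def diff_divide_distrib)
  qed
  have "g 0 - g n + h * f 0 / 2 \<le> h * (\<Sum>i<n. f i) + h * f n / 2" for n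
  proof (induction n)
    case (Suc n)
    then show ?case using step[of n] by (simp add: algebra_simps)
  qed simp
  from this[of N] have "g 0 + h * f 0 / 2 \<le> h * (\<Sum>i<N. f i)"
    using N by (simp add: g_def f_def)
  then have "(g 0 + h * f 0 / 2) / h \<le> (\<Sum>i<N. f i)"
    using h by (simp add: field_simps)
  moreover have "(g 0 + h * f 0 / 2) / h = z powr (\<gamma> + 1) / (h * (\<gamma> + 1)) + z powr \<gamma> / 2"
    using h z by (simp add: g_def f_def add_divide_distrib mult.commute)
  ultimately show ?thesis by (simp add: f_def)
qed

section \<open>From eigenvectors to multiplicities and the Riesz mean\<close>

context sloshing_domain
begin

text \<open>The trace of a function is determined by the function, although its gradient component is not
  yet known to vanish: the trace estimate holds with arbitrarily small weight on the gradient.\<close>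

lemma boundary_zero_if_AE_zero:
  assumes v: "v \<in> V" and zero: "AE x in lborel. x \<in> \<Omega> \<longrightarrow> fst v x = 0"
  shows "boundary v v = 0"
proof -
  have vT: "v \<in> T" using v V_subset_T by blast
  have "mass v v = (LINT x:\<Omega>|lborel. 0::real)"
    unfolding mass_def L2_inner_def set_lebesgue_integral_def
  proof (rule integral_cong_AE)
    show "AE x in lborel. indicator \<Omega> x *\<^sub>R (fst v x \<bullet> fst v x) = indicator \<Omega> x *\<^sub>R (0::real)"
      using zero by eventually_elim (auto simp: indicator_def)
    show "(\<lambda>x. indicator \<Omega> x *\<^sub>R (fst v x \<bullet> fst v x)) \<in> borel_measurable lborel"
      using L2_inner_integrable[of \<Omega> "fst v" "fst v"] vT
      by (auto simp: T_def set_integrable_def intro: borel_measurable_integrable)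
  qed simp
  then have m: "mass v v = 0" by (simp add: set_lebesgue_integral_def)
  have "boundary v v \<le> \<epsilon>" if \<epsilon>: "0 < \<epsilon>" for \<epsilon>
  proof -
    \<comment> \<open>The gradient weight is scaled by the energy of \<open>v\<close>; adding 1
      covers zero energy.\<close>
    have pos: "0 < \<epsilon> / (dirichlet v v + 1)" using \<epsilon> T_nonneg(2)[OF vT] by simp
    then have "boundary v v \<le> \<epsilon> / (dirichlet v v + 1) * dirichlet v v"
      using boundary_le_mass[OF pos] v m by auto
    also have "\<dots> \<le> \<epsilon> / (dirichlet v v + 1) * (dirichlet v v + 1)"
      using pos by (intro mult_left_mono) auto
    also have "\<dots> = \<epsilon>" using T_nonneg(2)[OF vT] by simp
    finally show ?thesis .
  qed
  then have "boundary v v \<le> 0" by (rule field_le_epsilon[where y = 0, simplified])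
  then show ?thesis using T_nonneg(3)[OF vT] by simp
qed

lemma sloshing_solutionI:
  assumes "e \<in> V" "\<And>v. v \<in> V \<Longrightarrow> dirichlet e v = \<nu> * boundary e v"
  shows "sloshing_solution \<Omega> F \<nu> (fst e)"
  unfolding sloshing_solution_def
proof (intro exI[of _ "fst (snd e)"] exI[of _ "snd (snd e)"] conjI allI impI)
  show "H1_with_gradient \<Omega> (fst e) (fst (snd e))" "is_trace \<Omega> F (fst e) (fst (snd e)) (snd (snd e))"
    using assms(1) by (simp_all add: V_def)
  fix v H h assume "H1_with_gradient \<Omega> v H \<and> is_trace \<Omega> F v H h"
  then have "(v, H, h) \<in> V" by (simp add: V_def)
  from assms(2)[OF this] show "(LINT x:\<Omega>|lborel. fst (snd e) x \<bullet> H x) = \<nu> * (LINT s:F|lborel. snd (snd e) s * h s)"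
    by (simp add: dirichlet_def boundary_def L2_inner_def)
qed

text \<open>Multiplicity is defined by independence almost everywhere in \<Omega>, whereas the
  eigenvectors are orthonormal in the boundary form. A combination vanishing almost everywhere has
  zero boundary norm, so by Cauchy-Schwarz its pairing with each eigenvector, which is a
  coefficient, vanishes.\<close>

lemma multiplicity_ge_card:
  assumes "finite I" and e: "\<And>i. i \<in> I \<Longrightarrow> e i \<in> V"
    and eig: "\<And>i v. i \<in> I \<Longrightarrow> v \<in> V \<Longrightarrow> dirichlet (e i) v = \<nu> * boundary (e i) v"
    and orth: "\<And>i j. i \<in> I \<Longrightarrow> j \<in> I \<Longrightarrow> boundary (e i) (e j) = (if i = j then 1 else 0)"
  shows "enat (card I) \<le> sloshing_multiplicity \<Omega> F \<nu>"
proof -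
  obtain f where f: "bij_betw f {..<card I} I"
    using ex_bij_betw_nat_finite[OF \<open>finite I\<close>] by (auto simp: atLeast0LessThan)
  have fI: "f i \<in> I" if "i < card I" for i using f that by (auto simp: bij_betw_def)
  have inj: "f i = f j \<longleftrightarrow> i = j" if "i < card I" "j < card I" for i j
    using f that by (auto simp: bij_betw_def inj_on_def)
  have "c j = 0" if ae: "AE x in lborel. x \<in> \<Omega> \<longrightarrow> (\<Sum>i<card I. c i * fst (e (f i)) x) = 0" and j: "j < card I"
    for c :: "nat \<Rightarrow> real" and j
  proof -
    define w where "w = (\<Sum>i<card I. c i *\<^sub>R e (f i))"
    have wV: "w \<in> V" unfolding w_def by (intro forms.a.mem_intros) (use e fI in auto)
    have "fst w x = (\<Sum>i<card I. c i * fst (e (f i)) x)" for x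
      by (simp add: w_def fst_sum sum_fun_apply)
    with ae have "boundary w w = 0" by (intro boundary_zero_if_AE_zero[OF wV]) simp
    have V: "e (f j) \<in> V" using e fI j by blast
    have "(boundary w (e (f j)))\<^sup>2 \<le> boundary w w * boundary (e (f j)) (e (f j))"
      by (rule forms.b.cauchy_schwarz[OF wV V])
    then have "boundary w (e (f j)) = 0" using \<open>boundary w w = 0\<close> by simp
    moreover have "boundary w (e (f j)) = (\<Sum>i<card I. c i * boundary (e (f i)) (e (f j)))"
      unfolding w_def by (rule forms.b.sum_scale_left) (use e fI V in auto)
    moreover have "\<dots> = (\<Sum>i<card I. if i = j then c i else 0)"
      by (intro sum.cong refl) (use orth fI j inj in auto)
    ultimately show ?thesis using j by simp
  qed
  moreover have "sloshing_solution \<Omega> F \<nu> (fst (e (f i)))" if "i < card I" for i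
    using e eig fI[OF that] by (intro sloshing_solutionI) auto
  ultimately have "enat (card I) \<in> {enat k |k. \<exists>u :: nat \<Rightarrow> real \<times> real \<Rightarrow> real.
        (\<forall>i<k. sloshing_solution \<Omega> F \<nu> (u i)) \<and>
        (\<forall>c :: nat \<Rightarrow> real. (AE x in lborel. x \<in> \<Omega> \<longrightarrow> (\<Sum>i<k. c i * u i x) = 0) \<longrightarrow>
           (\<forall>i<k. c i = 0))}"
    by (intro CollectI exI[of _ "card I"] conjI refl exI[of _ "\<lambda>i. fst (e (f i))"]) blast+
  then show ?thesis unfolding sloshing_multiplicity_def by (rule Sup_upper)
qed

text \<open>Indices with equal \<nu> form a boundary-orthonormal family for one eigenvalue, whose
  size is at most the multiplicity. All other eigenvalues only add nonnegative terms.\<close>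

lemma riesz_mean_ge_sum:
  fixes N :: nat
  assumes e: "\<And>i. i < N \<Longrightarrow> e i \<in> V"
    and eig: "\<And>i v. i < N \<Longrightarrow> v \<in> V \<Longrightarrow> dirichlet (e i) v = \<nu> i * boundary (e i) v"
    and orth: "\<And>i j. i < N \<Longrightarrow> j < N \<Longrightarrow> boundary (e i) (e j) = (if i = j then 1 else 0)"
  shows "ennreal (\<Sum>i<N. max 0 (z - \<nu> i) powr \<gamma>) \<le> riesz_mean \<Omega> F \<gamma> z"
proof -
  define G where "G t = ennreal (max 0 (z - t) powr \<gamma>)" for t
  let ?mult = "\<lambda>t. ennreal_of_enat (sloshing_multiplicity \<Omega> F t)"
  have eigenvalue: "sloshing_eigenvalue \<Omega> F (\<nu> i)" if i: "i < N" for i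
    unfolding sloshing_eigenvalue_def
  proof (intro exI[of _ "fst (e i)"] conjI notI)
    show "sloshing_solution \<Omega> F (\<nu> i) (fst (e i))"
      using e eig i by (intro sloshing_solutionI) auto
    assume "AE x in lborel. x \<in> \<Omega> \<longrightarrow> fst (e i) x = 0"
    then have "boundary (e i) (e i) = 0" by (rule boundary_zero_if_AE_zero[OF e[OF i]])
    then show False using orth[OF i i] by simp
  qed
  have "ennreal (\<Sum>i<N. max 0 (z - \<nu> i) powr \<gamma>) = (\<Sum>i<N. G (\<nu> i))"
    unfolding G_def by (rule sum_ennreal[symmetric]) simp
  also have "\<dots> = (\<Sum>t\<in>\<nu> ` {..<N}. \<Sum>i\<in>{i \<in> {..<N}. \<nu> i = t}. G (\<nu> i))"
    by (rule sum.image_gen) simp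
  also have "\<dots> \<le> (\<Sum>t\<in>\<nu> ` {..<N}. ?mult t * G t)"
  proof (rule sum_mono)
    fix t assume "t \<in> \<nu> ` {..<N}"
    define I where "I = {i \<in> {..<N}. \<nu> i = t}"
    have "(\<Sum>i\<in>I. G (\<nu> i)) = of_nat (card I) * G t" by (simp add: I_def)
    also have "\<dots> = ennreal_of_enat (enat (card I)) * G t" by simp
    also have "\<dots> \<le> ?mult t * G t"
    proof (rule mult_right_mono)
      have "enat (card I) \<le> sloshing_multiplicity \<Omega> F t"
        by (rule multiplicity_ge_card[where e = e]) (use e eig orth in \<open>auto simp: I_def\<close>)
      then show "ennreal_of_enat (enat (card I)) \<le> ?mult t"
        by (simp only: ennreal_of_enat_le_iff)
    qed simp
    finally show "(\<Sum>i\<in>{i \<in> {..<N}. \<nu> i = t}. G (\<nu> i)) \<le> ?mult t * G t"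
      by (simp add: I_def)
  qed
  also have "\<dots> = (\<Sum>\<^sub>\<infinity>t\<in>\<nu> ` {..<N}. ?mult t * G t)"
    by simp
  also have "\<dots> \<le> (\<Sum>\<^sub>\<infinity>t\<in>{t. sloshing_eigenvalue \<Omega> F t}. ?mult t * G t)"
    by (rule infsum_mono_neutral) (use eigenvalue in \<open>auto intro: nonneg_summable_on_complete\<close>)
  finally show ?thesis by (simp add: riesz_mean_def G_def)
qed

theorem riesz_mean_lower_bound:
  assumes \<gamma>: "1 \<le> \<gamma>" and z: "0 < z"
  shows "ennreal (l / (pi * (\<gamma> + 1)) * z powr (\<gamma> + 1) + 1 / 2 * z powr \<gamma>) \<le> riesz_mean \<Omega> F \<gamma> z"
proof -
  \<comment> \<open>From index \<open>N\<close> on the comparison frequencies exceed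
    \<open>z\<close>, so \<open>N\<close> eigenvectors already capture the whole trapezoidal
    sum.\<close>
  obtain N :: nat where "z / (pi / l) < real N" using reals_Archimedean2 by blast
  then have N: "z \<le> pi / l * real N" using l_pos by (simp add: field_simps)
  obtain e \<nu> where e: "\<And>i. i < N \<Longrightarrow> e i \<in> V" and \<nu>: "\<And>i. i < N \<Longrightarrow> \<nu> i \<le> freq i"
    and eig: "\<And>i v. i < N \<Longrightarrow> v \<in> V \<Longrightarrow> dirichlet (e i) v = \<nu> i * boundary (e i) v"
    and orth: "\<And>i j. i < N \<Longrightarrow> j < N \<Longrightarrow> boundary (e i) (e j) = (if i = j then 1 else 0)"
    using eigenvectors_exist[of N] by blast
  have "l / (pi * (\<gamma> + 1)) * z powr (\<gamma> + 1) + 1 / 2 * z powr \<gamma>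
      = z powr (\<gamma> + 1) / (pi / l * (\<gamma> + 1)) + z powr \<gamma> / 2"
    using l_pos by simp
  also have "\<dots> \<le> (\<Sum>i<N. max 0 (z - pi / l * real i) powr \<gamma>)"
    by (rule trapezoid_riesz) (use l_pos z \<gamma> N in auto)
  also have "\<dots> \<le> (\<Sum>i<N. max 0 (z - \<nu> i) powr \<gamma>)"
    using \<nu> \<gamma> by (intro sum_mono powr_mono2 max.mono) (auto simp: freq_def)
  finally have "ennreal (l / (pi * (\<gamma> + 1)) * z powr (\<gamma> + 1) + 1 / 2 * z powr \<gamma>)
      \<le> ennreal (\<Sum>i<N. max 0 (z - \<nu> i) powr \<gamma>)" by (rule ennreal_leI)
  also have "\<dots> \<le> riesz_mean \<Omega> F \<gamma> z"
    by (rule riesz_mean_ge_sum[OF e eig orth])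
  finally show ?thesis .
qed

end

theorem proposition2p8:
  fixes \<Omega> B :: "(real \<times> real) set" and F :: "real set" and l \<gamma> z :: real
  assumes "admissible_domain \<Omega> F B"
    and "0 < l" and "{0<..<l} \<subseteq> F" and "F \<subseteq> {0..l}"
    and "john_condition \<Omega> F"
    and "1 \<le> \<gamma>" and "0 < z"
  shows "riesz_mean \<Omega> F \<gamma> z \<ge>
    ennreal (l / (pi * (\<gamma> + 1)) * z powr (\<gamma> + 1) + 1 / 2 * z powr \<gamma>)"
proof -
  interpret sloshing_domain \<Omega> B F l by standard fact+
  show ?thesis by (rule riesz_mean_lower_bound[OF assms(6,7)])
qed

end
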